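(* Let $a\in\mathbb{R}$, $b\in(a,\infty)$, $c,T\in(0,\infty)$, $\mathbf a\in C^1(\mathbb{R},\mathbb{R})$, and consider the set $\mathbf N$ of artificial neural networks, the number of parameters $\mathcal P\colon\mathbf N\to\mathbb N$, and the realization map $\mathcal R$ with activation function $\mathbf a$, as defined in the context. For every $d\in\mathbb N$ let $\varphi_d\in C(\mathbb{R}^d,\mathbb{R})$, let $(\phi_{\varepsilon,d})_{(\varepsilon,d)\in(0,1]\times\mathbb N}\subseteq\mathbf N$, let $\|\cdot\|$ denote the Euclidean norm on each $\mathbb{R}^d$, and assume for all $\varepsilon\in(0,1]$, $d\in\mathbb N$, $x\in\mathbb{R}^d$ that $(\mathcal R\phi_{\varepsilon,d})\in C(\mathbb{R}^d,\mathbb{R})$, $$|(\mathcal R\phi_{\varepsilon,d})(x)|+\|(\nabla(\mathcal R\phi_{\varepsilon,d}))(x)\|\le c\,d^c(1+\|x\|^c),$$ $$\mathcal P(\phi_{\varepsilon,d})\le c\,d^c\varepsilon^{-c},\qquad |\varphi_d(x)-(\mathcal R\phi_{\varepsilon,d})(x)|\le\varepsilon\,c\,d^c(1+\|x\|^c).$$ Then: (i) there exist unique at most polynomially growing $u_d\in C([0,T]\times\mathbb{R}^d,\mathbb{R})$, $d\in\mathbb N$, which satisfy for all $d\in\mathbb N$, $t\in(0,T]$, $x\in\mathbb{R}^d$ that $u_d|_{(0,T]\times\mathbb{R}^d}\in C^{1,2}((0,T]\times\mathbb{R}^d,\mathbb{R})$, $u_d(0,x)=\varphi_d(x)$, and $$(\tfrac{\partial}{\partial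 t}u_d)(t,x)=(\Delta_x u_d)(t,x);$$ (ii) there exist $(\psi_{\varepsilon,d})_{(\varepsilon,d)\in(0,1]\times\mathbb N}\subseteq\mathbf N$ and $\kappa\in\mathbb{R}$ such that for all $\varepsilon\in(0,1]$, $d\in\mathbb N$ we have $\mathcal P(\psi_{\varepsilon,d})\le\kappa d^\kappa\varepsilon^{-\kappa}$, $(\mathcal R\psi_{\varepsilon,d})\in C(\mathbb{R}^d,\mathbb{R})$, and $$\sup_{x\in[a,b]^d}|u_d(T,x)-(\mathcal R\psi_{\varepsilon,d})(x)|\le\varepsilon.$$
   Context: $\mathbb N=\{1,2,3,\ldots\}$. Networks: $\mathbf N=\bigcup_{L\in\mathbb N\cap[2,\infty)}\bigcup_{l_0,\ldots,l_L\in\mathbb N}\big(\times_{k=1}^L(\mathbb{R}^{l_k\times l_{k-1}}\times\mathbb{R}^{l_k})\big)$. For $n\in\mathbb N$ let $\mathbf A_n\colon\mathbb{R}^n\to\mathbb{R}^n$, $\mathbf A_n(x_1,\ldots,x_n)=(\mathbf a(x_1),\ldots,\mathbf a(x_n))$. For $\Phi=((W_1,B_1),\ldots,(W_L,B_L))\in\times_{k=1}^L(\mathbb{R}^{l_k\times l_{k-1}}\times\mathbb{R}^{l_k})$ the number of parameters is $\mathcal P(\Phi)=\sum_{k=1}^L l_k(l_{k-1}+1)$, and the realization $(\mathcal R\Phi)\in C(\mathbb{R}^{l_0},\mathbb{R}^{l_L})$ is given for $x_0\in\mathbb{R}^{l_0}$ by $(\mathcal R\Phi)(x_0)=W_Lx_{L-1}+B_L$,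 where $x_k=\mathbf A_{l_k}(W_kx_{k-1}+B_k)$ for $k\in\{1,\ldots,L-1\}$. A function $u\in C([0,T]\times\mathbb{R}^d,\mathbb{R})$ is at most polynomially growing if $\inf_{\gamma\in(0,\infty)}\sup_{(s,y)\in[0,T]\times\mathbb{R}^d}\frac{|u(s,y)|}{1+\|y\|^\gamma}<\infty$. *)

theory Defs
  imports "HOL-Analysis.Analysis" "Jordan_Normal_Form.Matrix"
begin

text \<open>
  As the dimension \<open>d\<close> is quantified inside the theorem, the space of real \<open>d\<close>-tuples is the
  library's \<^const>\<open>Euclidean_space\<close>: its points are the \<open>x :: nat \<Rightarrow> real\<close> with \<open>x i = 0\<close> for all
  \<open>i \<ge> d\<close>, and coordinates are counted from \<open>0\<close>. The Euclidean norm of such an \<open>x\<close> is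
  \<^term>\<open>L2_set x {..<d}\<close>.
\<close>

abbreviation Rn :: "nat \<Rightarrow> (nat \<Rightarrow> real) set"
  where "Rn d \<equiv> topspace (Euclidean_space d)"

definition partial_deriv :: "nat \<Rightarrow> ((nat \<Rightarrow> real) \<Rightarrow> real) \<Rightarrow> (nat \<Rightarrow> real) \<Rightarrow> real"
  where "partial_deriv i f x = deriv (\<lambda>s. f (x(i := s))) (x i)"

definition partially_differentiable :: "nat \<Rightarrow> ((nat \<Rightarrow> real) \<Rightarrow> real) \<Rightarrow> (nat \<Rightarrow> real) \<Rightarrow> bool"
  where "partially_differentiable i f x \<longleftrightarrow> (\<lambda>s. f (x(i := s))) differentiable at (x i)"

definition gradient :: "nat \<Rightarrow> ((nat \<Rightarrow> real) \<Rightarrow> real) \<Rightarrow> (nat \<Rightarrow> real) \<Rightarrow> (nat \<Rightarrow> real)"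
  where "gradient d f x = (\<lambda>i. if i < d then partial_deriv i f x else 0)"

definition laplacian :: "nat \<Rightarrow> ((nat \<Rightarrow> real) \<Rightarrow> real) \<Rightarrow> (nat \<Rightarrow> real) \<Rightarrow> real"
  where "laplacian d f x = (\<Sum>i<d. partial_deriv i (partial_deriv i f) x)"


subsection \<open>Neural networks\<close>

type_synonym ann = "(real mat \<times> real vec) list"

text \<open>The list position \<open>k\<close> holds the pair that is usually numbered \<open>k + 1\<close>.\<close>

definition anns :: "ann set"
  where "anns = {\<Phi>. length \<Phi> \<ge> 2 \<and>
    (\<exists>l :: nat \<Rightarrow> nat. (\<forall>k \<le> length \<Phi>. l k \<ge> 1) \<and>
      (\<forall>k < length \<Phi>. fst (\<Phi> ! k) \<in> carrier_mat (l (k + 1)) (l k) \<and>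
                      snd (\<Phi> ! k) \<in> carrier_vec (l (k + 1))))}"

definition num_params :: "ann \<Rightarrow> nat"
  where "num_params \<Phi> = (\<Sum>(W, B)\<leftarrow>\<Phi>. dim_row W * (dim_col W + 1))"

definition in_dim :: "ann \<Rightarrow> nat"
  where "in_dim \<Phi> = dim_col (fst (hd \<Phi>))"

definition out_dim :: "ann \<Rightarrow> nat"
  where "out_dim \<Phi> = dim_row (fst (last \<Phi>))"

definition affine_layer :: "real mat \<Rightarrow> real vec \<Rightarrow> (nat \<Rightarrow> real) \<Rightarrow> (nat \<Rightarrow> real)"
  where "affine_layer W B x =
    (\<lambda>i. if i < dim_row W
         then vec_index (W *\<^sub>v Matrix.vec (dim_col W) x + B) i else 0)"

definition activate :: "(real \<Rightarrow> real) \<Rightarrow> nat \<Rightarrow> (nat \<Rightarrow> real) \<Rightarrow> (nat \<Rightarrow> real)"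
  where "activate act n x = (\<lambda>i. if i < n then act (x i) else 0)"

text \<open>The last pair is not followed by an activation; the value at the empty list is irrelevant.\<close>

fun realization :: "(real \<Rightarrow> real) \<Rightarrow> ann \<Rightarrow> (nat \<Rightarrow> real) \<Rightarrow> (nat \<Rightarrow> real)"
  where
    "realization act [] x = x"
  | "realization act [(W, B)] x = affine_layer W B x"
  | "realization act ((W, B) # L # \<Phi>) x =
       realization act (L # \<Phi>) (activate act (dim_row W) (affine_layer W B x))"

text \<open>The realization is a continuous function from \<open>d\<close>-tuples to \<open>k\<close>-tuples. The dimensions are
  recorded separately because functions in HOL do not carry their domain and codomain.\<close>

definition realizes_C :: "(real \<Rightarrow> real) \<Rightarrow> ann \<Rightarrow> nat \<Rightarrow> nat \<Rightarrow> bool"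
  where "realizes_C act \<Phi> d k \<longleftrightarrow> in_dim \<Phi> = d \<and> out_dim \<Phi> = k \<and>
    continuous_map (Euclidean_space d) (Euclidean_space k) (realization act \<Phi>)"

text \<open>For networks with one-dimensional output, 1-tuples are identified with real numbers.\<close>

definition realization1 :: "(real \<Rightarrow> real) \<Rightarrow> ann \<Rightarrow> (nat \<Rightarrow> real) \<Rightarrow> real"
  where "realization1 act \<Phi> x = realization act \<Phi> x 0"


subsection \<open>The heat equation\<close>

definition continuous_time_space ::
    "real set \<Rightarrow> nat \<Rightarrow> (real \<Rightarrow> (nat \<Rightarrow> real) \<Rightarrow> real) \<Rightarrow> bool"
  where "continuous_time_space I d u \<longleftrightarrow>
    continuous_map (prod_topology (top_of_set I) (Euclidean_space d)) euclideanreal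
      (\<lambda>(t, x). u t x)"

text \<open>The derivative is taken within \<open>I\<close>, hence is one-sided at an end point belonging to \<open>I\<close>.\<close>

definition time_deriv ::
    "real set \<Rightarrow> (real \<Rightarrow> (nat \<Rightarrow> real) \<Rightarrow> real) \<Rightarrow> real \<Rightarrow> (nat \<Rightarrow> real) \<Rightarrow> real"
  where "time_deriv I u t x = vector_derivative (\<lambda>s. u s x) (at t within I)"

text \<open>Once continuously differentiable in time, twice in space, on \<open>I \<times> Rn d\<close>.\<close>

definition C12 :: "real set \<Rightarrow> nat \<Rightarrow> (real \<Rightarrow> (nat \<Rightarrow> real) \<Rightarrow> real) \<Rightarrow> bool"
  where "C12 I d u \<longleftrightarrow>
    continuous_time_space I d u \<and>
    (\<forall>t \<in> I. \<forall>x \<in> Rn d. (\<lambda>s. u s x) differentiable (at t within I)) \<and>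
    continuous_time_space I d (time_deriv I u) \<and>
    (\<forall>i < d.
      (\<forall>t \<in> I. \<forall>x \<in> Rn d. partially_differentiable i (u t) x) \<and>
      continuous_time_space I d (\<lambda>t. partial_deriv i (u t)) \<and>
      (\<forall>j < d.
        (\<forall>t \<in> I. \<forall>x \<in> Rn d. partially_differentiable j (partial_deriv i (u t)) x) \<and>
        continuous_time_space I d (\<lambda>t. partial_deriv j (partial_deriv i (u t)))))"

definition poly_growing :: "real \<Rightarrow> nat \<Rightarrow> (real \<Rightarrow> (nat \<Rightarrow> real) \<Rightarrow> real) \<Rightarrow> bool"
  where "poly_growing T d u \<longleftrightarrow>
    (INF \<gamma> \<in> {0 :: real <..}. SUP (s, y) \<in> {0..T} \<times> Rn d.
      ereal (\<bar>u s y\<bar> / (1 + L2_set y {..<d} powr \<gamma>))) < \<infinity>"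

definition heat_solution ::
    "real \<Rightarrow> nat \<Rightarrow> ((nat \<Rightarrow> real) \<Rightarrow> real) \<Rightarrow> (real \<Rightarrow> (nat \<Rightarrow> real) \<Rightarrow> real) \<Rightarrow> bool"
  where "heat_solution T d \<phi> u \<longleftrightarrow>
    continuous_time_space {0..T} d u \<and> poly_growing T d u \<and>
    C12 {0<..T} d u \<and>
    (\<forall>x \<in> Rn d. u 0 x = \<phi> x) \<and>
    (\<forall>t \<in> {0<..T}. \<forall>x \<in> Rn d. time_deriv {0<..T} u t x = laplacian d (u t) x)"

end

theory Submission
  imports Defs "HOL-Probability.Probability" "HOL-Real_Asymp.Real_Asymp"
begin

text \<open>
  The solution is \<open>u (t, x) = E [\<phi> (x + sqrt (2 t) Z)]\<close> with \<open>Z\<close> a standard Gaussian vector. For \<open>t > 0\<close> it is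
  also a convolution with the heat kernel, which gives the smoothness; uniqueness among polynomially
  growing solutions is the maximum principle with the barrier \<open>e\<^sup>2\<^sup>t (\<Sum>i. cosh x\<^sub>i)\<close>.

  For the networks, replace \<open>\<phi>\<close> by an approximating realization \<open>f\<close> and the expectation at time \<open>T\<close> by a
  finite weighted sum \<open>\<Sum>m. c m * f (x + z m)\<close>, which is again the realization of a network: the shifts go
  into the first bias, the weights into the last layer, and the layers in between become block diagonal.
  Good points \<open>z m\<close> exist by exponential moment bounds and a union over a grid of \<open>n\<^sup>d\<close> points of the
  cube; only the logarithm of the number of grid points enters, so polynomially many samples suffice.
\<close>

subsection \<open>Networks\<close>

text \<open>What shapes the proof is that every constant must stay polynomial in \<open>d\<close>
  and \<open>1 / \<epsilon>\<close>. Exponential moment bounds need bounded integrands, whereas the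
  realizations grow polynomially; dividing by \<open>wt d z ^ k\<close> and sampling from the
  correspondingly reweighted Gaussian restores boundedness, and the price, the Gaussian moment of
  the weight, is polynomial in \<open>d\<close>. A grid helps only if the integrands vary little
  between its points, with a bound that is uniform over the networks: here the gradient bound
  enters, and differentiability of the activation turns it into a Lipschitz bound with the same
  weight. The error \<epsilon> is spent in four equal parts: replacing \<phi> by \<open>f\<close>,
  moving to the grid in the exact mean, sampling at the grid, and moving back in the sample mean. Of
  the two forms of the solution, the Gaussian one behaves well down to \<open>t = 0\<close>, where
  the kernel degenerates; the kernel form puts all dependence on \<open>t\<close> and
  \<open>x\<close> into a smooth factor, so that no derivative of \<phi> occurs.\<close>

lemma Euclidean_space_eq_top_of_set: "Euclidean_space d = top_of_set (Rn d)"
  by (simp add: Euclidean_space_def topspace_Euclidean_space euclidean_product_topology)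

lemma continuous_map_Euclidean_space:
  "continuous_map (Euclidean_space p) (Euclidean_space q) f \<longleftrightarrow> continuous_on (Rn p) f \<and> f ` Rn p \<subseteq> Rn q"
  by (subst (1 2) Euclidean_space_eq_top_of_set) auto

lemma continuous_map_Euclidean_space_real:
  "continuous_map (Euclidean_space p) euclideanreal f \<longleftrightarrow> continuous_on (Rn p) f"
  by (subst Euclidean_space_eq_top_of_set) auto

lemma Rn_iff: "x \<in> Rn d \<longleftrightarrow> (\<forall>i\<ge>d. x i = 0)"
  by (simp add: topspace_Euclidean_space)

lemma Rn_update: "x \<in> Rn d \<Longrightarrow> i < d \<Longrightarrow> x(i := s) \<in> Rn d"
  by (auto simp: Rn_iff)

fun layered :: "nat \<Rightarrow> ann \<Rightarrow> nat \<Rightarrow> bool" where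
  "layered p [] q \<longleftrightarrow> p = q \<and> p \<ge> 1"
| "layered p ((W, B) # \<Phi>) q \<longleftrightarrow> p \<ge> 1 \<and> dim_col W = p \<and> dim_vec B = dim_row W \<and>
     layered (dim_row W) \<Phi> q"

lemma layered_iff_widths:
  "layered p \<Phi> q \<longleftrightarrow> (\<exists>l. l 0 = p \<and> l (length \<Phi>) = q \<and> (\<forall>k \<le> length \<Phi>. l k \<ge> 1) \<and>
      (\<forall>k < length \<Phi>. fst (\<Phi> ! k) \<in> carrier_mat (l (k + 1)) (l k) \<and>
                      snd (\<Phi> ! k) \<in> carrier_vec (l (k + 1))))"
proof (induction \<Phi> arbitrary: p)
  case Nil
  show ?case by auto
next
  case (Cons L \<Phi>)
  obtain W B where L: "L = (W, B)" by fastforce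
  show ?case
  proof
    assume *: "layered p (L # \<Phi>) q"
    then have "layered (dim_row W) \<Phi> q" by (simp add: L)
    then obtain l where l: "l 0 = dim_row W" "l (length \<Phi>) = q" "\<forall>k \<le> length \<Phi>. l k \<ge> 1"
      "\<forall>k < length \<Phi>. fst (\<Phi> ! k) \<in> carrier_mat (l (k + 1)) (l k) \<and>
                      snd (\<Phi> ! k) \<in> carrier_vec (l (k + 1))"
      unfolding Cons.IH by blast
    have "B \<in> carrier_vec (dim_row W)"
      using * by (auto simp: L intro: carrier_vecI)
    then show "\<exists>l. l 0 = p \<and> l (length (L # \<Phi>)) = q \<and> (\<forall>k \<le> length (L # \<Phi>). l k \<ge> 1) \<and>
      (\<forall>k < length (L # \<Phi>). fst ((L # \<Phi>) ! k) \<in> carrier_mat (l (k + 1)) (l k) \<and>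
                      snd ((L # \<Phi>) ! k) \<in> carrier_vec (l (k + 1)))"
      using * l
      by (intro exI[of _ "case_nat p l"])
        (auto simp: L nth_Cons less_Suc_eq_0_disj le_Suc_eq split: nat.splits)
  next
    assume "\<exists>l. l 0 = p \<and> l (length (L # \<Phi>)) = q \<and> (\<forall>k \<le> length (L # \<Phi>). l k \<ge> 1) \<and>
      (\<forall>k < length (L # \<Phi>). fst ((L # \<Phi>) ! k) \<in> carrier_mat (l (k + 1)) (l k) \<and>
                      snd ((L # \<Phi>) ! k) \<in> carrier_vec (l (k + 1)))"
    then obtain l where l: "l 0 = p" "l (length (L # \<Phi>)) = q" "\<forall>k \<le> length (L # \<Phi>). l k \<ge> 1"
      "\<And>k. k < length (L # \<Phi>) \<Longrightarrow> fst ((L # \<Phi>) ! k) \<in> carrier_mat (l (k + 1)) (l k) \<and>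
                      snd ((L # \<Phi>) ! k) \<in> carrier_vec (l (k + 1))"
      by blast
    have 0: "W \<in> carrier_mat (l 1) p" "B \<in> carrier_vec (l 1)"
      using l(4)[of 0] l(1) by (auto simp: L)
    have "layered (dim_row W) \<Phi> q"
      unfolding Cons.IH
      using l(2,3) l(4)[of "Suc _"] 0
      by (intro exI[of _ "\<lambda>k. l (Suc k)"]) auto
    then show "layered p (L # \<Phi>) q"
      using 0 l(1,3) by (auto simp: L)
  qed
qed

lemma layered_dims:
  assumes "layered p \<Phi> q" "\<Phi> \<noteq> []"
  shows "in_dim \<Phi> = p" "out_dim \<Phi> = q"
proof -
  obtain W B \<Psi> where \<Phi>: "\<Phi> = (W, B) # \<Psi>" using assms(2) by (metis neq_Nil_conv prod.exhaust)
  show "in_dim \<Phi> = p" using assms by (simp add: \<Phi> in_dim_def)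
  show "out_dim \<Phi> = q"
    using assms
  proof (induction \<Phi> arbitrary: p)
    case (Cons L \<Phi>)
    then show ?case by (cases L; cases "\<Phi> = []") (auto simp: out_dim_def)
  qed simp
qed

lemma anns_iff_layered:
  "\<Phi> \<in> anns \<longleftrightarrow> length \<Phi> \<ge> 2 \<and> layered (in_dim \<Phi>) \<Phi> (out_dim \<Phi>)"
proof
  assume "\<Phi> \<in> anns"
  then have "length \<Phi> \<ge> 2" "\<exists>p q. layered p \<Phi> q"
    unfolding layered_iff_widths anns_def by auto
  then show "length \<Phi> \<ge> 2 \<and> layered (in_dim \<Phi>) \<Phi> (out_dim \<Phi>)"
    using layered_dims by fastforce
qed (auto simp: layered_iff_widths anns_def)

section \<open>Regularity of realizations\<close>

lemma affine_layer_nth: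
  assumes "dim_vec B = dim_row W" "i < dim_row W"
  shows "affine_layer W B x i = (\<Sum>j<dim_col W. W $$ (i, j) * x j) + B $ i"
  using assms by (simp add: affine_layer_def scalar_prod_def lessThan_atLeast0 row_def)

lemma affine_layer_differentiable:
  assumes "dim_vec B = dim_row W" "\<And>j. (\<lambda>s. X s j) differentiable (at (s0 :: real))"
  shows "(\<lambda>s. affine_layer W B (X s) i) differentiable (at s0)"
proof (cases "i < dim_row W")
  case True
  show ?thesis
    unfolding affine_layer_nth[OF assms(1) True]
    by (intro differentiable_add differentiable_const differentiable_sum ballI
        differentiable_mult assms(2) finite_lessThan)
qed (simp add: affine_layer_def)

lemma affine_layer_continuous:
  assumes "dim_vec B = dim_row W" "\<And>j. continuous_on S (\<lambda>s. X s j :: real)"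
  shows "continuous_on S (\<lambda>s. affine_layer W B (X s) i)"
proof (cases "i < dim_row W")
  case True
  show ?thesis
    unfolding affine_layer_nth[OF assms(1) True]
    by (intro continuous_intros assms(2))
qed (simp add: affine_layer_def)

lemma realization_Cons:
  "\<Phi> \<noteq> [] \<Longrightarrow> realization act ((W, B) # \<Phi>) x =
     realization act \<Phi> (activate act (dim_row W) (affine_layer W B x))"
  by (cases \<Phi>) auto

text \<open>Stated for an arbitrary differentiable curve \<open>X\<close> of inputs, because the
  output of the first layer along a curve is again such a curve; this is the form that survives the
  induction. Coordinate lines are the case of interest.\<close>

lemma realization_differentiable:
  assumes "\<And>r. act differentiable (at r)"
    and "layered p \<Phi> q" "\<And>j. (\<lambda>s. X s j) differentiable (at (s0 :: real))"
  shows "(\<lambda>s. realization act \<Phi> (X s) i) differentiable (at s0)"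
  using assms(2,3)
proof (induction \<Phi> arbitrary: p X)
  case (Cons L \<Phi>)
  obtain W B where L: "L = (W, B)" by fastforce
  have *: "(\<lambda>s. affine_layer W B (X s) j) differentiable at s0" for j
    using Cons.prems by (intro affine_layer_differentiable) (auto simp: L)
  have "(\<lambda>s. activate act (dim_row W) (affine_layer W B (X s)) j) differentiable at s0" for j
  proof (cases "j < dim_row W")
    case True
    have "(act \<circ> (\<lambda>s. affine_layer W B (X s) j)) differentiable at s0"
      by (intro differentiable_chain_at * assms(1))
    then show ?thesis using True by (simp add: activate_def o_def)
  qed (simp add: activate_def)
  then show ?case
    using Cons.IH[of "dim_row W" "\<lambda>s. activate act (dim_row W) (affine_layer W B (X s))"] Cons.prems *
    by (cases "\<Phi> = []") (auto simp: L realization_Cons)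
qed auto

lemma realization_continuous:
  assumes "continuous_on UNIV act"
    and "layered p \<Phi> q" "\<And>j. continuous_on S (\<lambda>s. X s j)"
  shows "continuous_on S (\<lambda>s. realization act \<Phi> (X s) i)"
  using assms(2,3)
proof (induction \<Phi> arbitrary: p X)
  case (Cons L \<Phi>)
  obtain W B where L: "L = (W, B)" by fastforce
  have *: "continuous_on S (\<lambda>s. affine_layer W B (X s) j)" for j
    using Cons.prems by (intro affine_layer_continuous) (auto simp: L)
  have "continuous_on S (\<lambda>s. activate act (dim_row W) (affine_layer W B (X s)) j)" for j
    by (cases "j < dim_row W")
      (auto simp: activate_def intro: continuous_on_compose2[OF assms(1) *])
  then show ?case
    using Cons.IH[of "dim_row W" "\<lambda>s. activate act (dim_row W) (affine_layer W B (X s))"] Cons.prems *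
    by (cases "\<Phi> = []") (auto simp: L realization_Cons)
qed auto

lemma realization_eq_0:
  assumes "layered p \<Phi> q" "\<Phi> \<noteq> []" "i \<ge> q"
  shows "realization act \<Phi> x i = 0"
  using assms
proof (induction \<Phi> arbitrary: p x)
  case (Cons L \<Phi>)
  then show ?case
    by (cases L; cases "\<Phi> = []") (auto simp: realization_Cons affine_layer_def)
qed auto

lemma realizes_C_if_layered:
  assumes "continuous_on UNIV act" "layered p \<Phi> q" "\<Phi> \<noteq> []"
  shows "realizes_C act \<Phi> p q"
proof -
  have "continuous_on (Rn p) (\<lambda>x. realization act \<Phi> x i)" for i
    using continuous_on_subset[OF continuous_on_product_coordinates subset_UNIV]
    by (rule realization_continuous[OF assms(1,2), where X="\<lambda>x. x"])
  then have "continuous_on (Rn p) (realization act \<Phi>)"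
    by (rule continuous_on_coordinatewise_then_product)
  moreover have "realization act \<Phi> x \<in> Rn q" for x
    using realization_eq_0[OF assms(2,3)] by (auto simp: Rn_iff)
  ultimately show ?thesis
    using layered_dims[OF assms(2,3)]
    by (auto simp: realizes_C_def continuous_map_Euclidean_space)
qed

text \<open>\<open>M\<close> copies of a layer of width \<open>r\<close> are stored as one layer of width \<open>M * r\<close>, neuron \<open>j\<close> of copy \<open>m\<close>
  having index \<open>m * r + j\<close>.\<close>

fun average_tail :: "nat \<Rightarrow> (nat \<Rightarrow> real) \<Rightarrow> ann \<Rightarrow> ann" where
  "average_tail M c [] = []"
| "average_tail M c [(W, B)] =
    [(Matrix.mat (dim_row W) (M * dim_col W) (\<lambda>(i, j). c (j div dim_col W) * W $$ (i, j mod dim_col W)),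
      Matrix.vec (dim_row W) (\<lambda>i. (\<Sum>m<M. c m) * vec_index B i))]"
| "average_tail M c ((W, B) # L # \<Phi>) =
    (Matrix.mat (M * dim_row W) (M * dim_col W) (\<lambda>(i, j). if i div dim_row W = j div dim_col W
        then W $$ (i mod dim_row W, j mod dim_col W) else 0),
     Matrix.vec (M * dim_row W) (\<lambda>i. vec_index B (i mod dim_row W))) # average_tail M c (L # \<Phi>)"

text \<open>All copies read the same input, so the first matrix is stacked, not block diagonal. From
  W (x + z) + B = W x + (W z + B), the bias of copy \<open>m\<close> is the value of the first layer
  at \<open>z m\<close>. The weights enter only in \<open>average_tail\<close>, hence the interest
  in lists of length at least 2, as in \<open>anns\<close>.\<close>

definition average_net :: "nat \<Rightarrow> (nat \<Rightarrow> real) \<Rightarrow> (nat \<Rightarrow> nat \<Rightarrow> real) \<Rightarrow> ann \<Rightarrow> ann" where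
  "average_net M c z \<Phi> = (case \<Phi> of (W, B) # \<Phi>' \<Rightarrow>
    (Matrix.mat (M * dim_row W) (dim_col W) (\<lambda>(i, j). W $$ (i mod dim_row W, j)),
     Matrix.vec (M * dim_row W) (\<lambda>i. affine_layer W B (z (i div dim_row W)) (i mod dim_row W)))
    # average_tail M c \<Phi>')"

lemma average_tail_Cons:
  "\<Phi> \<noteq> [] \<Longrightarrow> average_tail M c ((W, B) # \<Phi>) =
    (Matrix.mat (M * dim_row W) (M * dim_col W) (\<lambda>(i, j). if i div dim_row W = j div dim_col W
        then W $$ (i mod dim_row W, j mod dim_col W) else 0),
     Matrix.vec (M * dim_row W) (\<lambda>i. vec_index B (i mod dim_row W))) # average_tail M c \<Phi>"
  by (cases \<Phi>) auto

lemma average_tail_eq_Nil [simp]: "average_tail M c \<Phi> = [] \<longleftrightarrow> \<Phi> = []"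
  by (cases "(M, c, \<Phi>)" rule: average_tail.cases) auto

lemma block_index_less:
  fixes m M r :: nat
  assumes "m < M" "j < r"
  shows "m * r + j < M * r"
proof -
  have "m * r + j < Suc m * r" using assms(2) by simp
  also have "\<dots> \<le> M * r" using assms(1) by (intro mult_le_mono1) simp
  finally show ?thesis .
qed

lemma sum_blocks: "(\<Sum>j<M * r. f j) = (\<Sum>m<M. \<Sum>j<r. f (m * r + j))" for f :: "nat \<Rightarrow> real"
proof -
  have "sum f {m * r..<m * r + r} = (\<Sum>j<r. f (m * r + j))" for m
    using sum.shift_bounds_nat_ivl[of f 0 "m * r" r] unfolding atLeast0LessThan by (simp only: add_0 add.commute)
  then show ?thesis
    by (simp only: sum.nat_group[symmetric])
qed

lemma layered_average_tail:
  assumes "layered p \<Phi> q" "\<Phi> \<noteq> []" "M \<ge> 1"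
  shows "layered (M * p) (average_tail M c \<Phi>) q"
  using assms
proof (induction \<Phi> arbitrary: p)
  case (Cons L \<Phi>)
  then show ?case
    by (cases L; cases "\<Phi> = []") (auto simp: average_tail_Cons)
qed auto

text \<open>The stacked input \<open>X\<close> is compared with the inputs \<open>x m\<close> of the
  copies only at indices that exist. In this form the claim passes through a block diagonal layer,
  whose output stacks the outputs of the copies.\<close>

lemma realization_average_tail:
  assumes "layered p \<Phi> q" "\<Phi> \<noteq> []" "i < q"
    and "\<And>m j. m < M \<Longrightarrow> j < p \<Longrightarrow> X (m * p + j) = x m j"
  shows "realization act (average_tail M c \<Phi>) X i = (\<Sum>m<M. c m * realization act \<Phi> (x m) i)"
  using assms
proof (induction \<Phi> arbitrary: p X x)
  case (Cons L \<Phi>)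
  obtain W B where L: "L = (W, B)" by fastforce
  have W: "dim_col W = p" "dim_vec B = dim_row W" "p \<ge> 1" "layered (dim_row W) \<Phi> q"
    using Cons.prems(1) by (auto simp: L)
  show ?case
  proof (cases "\<Phi> = []")
    case True
    then have i: "i < dim_row W" using Cons.prems(1,3) by (auto simp: L)
    have "(\<Sum>j<M * p. c (j div p) * W $$ (i, j mod p) * X j) =
       (\<Sum>m<M. \<Sum>j<p. c m * W $$ (i, j) * x m j)"
      unfolding sum_blocks using Cons.prems(4) W(3) by (intro sum.cong refl) auto
    then show ?thesis
      using i W True
      by (simp add: L affine_layer_nth distrib_left sum.distrib sum_distrib_left sum_distrib_right mult.assoc)
  next
    case False
    let ?r = "dim_row W"
    define X' where "X' = activate act (M * ?r) (affine_layer
      (Matrix.mat (M * ?r) (M * p) (\<lambda>(i, j). if i div ?r = j div p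
        then W $$ (i mod ?r, j mod p) else 0))
      (Matrix.vec (M * ?r) (\<lambda>i. vec_index B (i mod ?r))) X)"
    have X': "X' (m * ?r + j) = activate act ?r (affine_layer W B (x m)) j" if "m < M" "j < ?r" for m j
    proof -
      have less: "m * ?r + j < M * ?r"
        using that by (rule block_index_less)
      \<comment> \<open>In a row belonging to copy \<open>m\<close>, all blocks except the one in
        column block \<open>m\<close> vanish.\<close>
      have "(\<Sum>k<M * p. (if (m * ?r + j) div ?r = k div p
         then W $$ ((m * ?r + j) mod ?r, k mod p) else 0) * X k) =
         (\<Sum>m'<M. \<Sum>k<p. if m' = m then W $$ (j, k) * x m k else 0)"
        unfolding sum_blocks using Cons.prems(4) that by (intro sum.cong refl) auto
      also have "\<dots> = (\<Sum>m'<M. if m' = m then \<Sum>k<p. W $$ (j, k) * x m k else 0)"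
        by (intro sum.cong) auto
      also have "\<dots> = (\<Sum>k<p. W $$ (j, k) * x m k)"
        using that by simp
      finally show ?thesis
        using that less W(1,2)
        by (simp add: X'_def activate_def affine_layer_nth)
    qed
    show ?thesis
      using Cons.IH[where X = X' and x = "\<lambda>m. activate act (dim_row W) (affine_layer W B (x m))",
        OF W(4) False Cons.prems(3) X'] False
      unfolding X'_def W(1)[symmetric] by (simp add: L realization_Cons average_tail_Cons)
  qed
qed auto

lemma num_params_Cons: "num_params ((W, B) # \<Phi>) = dim_row W * (dim_col W + 1) + num_params \<Phi>"
  by (simp add: num_params_def)

text \<open>The zeros outside the diagonal blocks are counted as parameters too, so a matrix grows
  by the factor \<open>M * M\<close>.\<close>

lemma num_params_average_tail:
  assumes "M \<ge> 1"
  shows "num_params (average_tail M c \<Phi>) \<le> M\<^sup>2 * num_params \<Phi>"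
proof (induction \<Phi>)
  case (Cons L \<Phi>)
  obtain W B where L: "L = (W, B)" by fastforce
  have "M \<le> M\<^sup>2" "1 \<le> M\<^sup>2" using assms by (auto simp: power2_eq_square)
  then have "r * (M * p) \<le> M\<^sup>2 * (r * p)" "r \<le> M\<^sup>2 * r" "M * r \<le> M\<^sup>2 * r" for r p
    by (simp_all add: ac_simps mult_le_mono)
  moreover have "M * r * (M * p) = M\<^sup>2 * (r * p)" for r p
    by (simp add: power2_eq_square)
  ultimately show ?case
    using Cons.IH
    by (cases "\<Phi> = []") (auto simp: L average_tail_Cons num_params_Cons distrib_left power2_eq_square
      intro!: add_mono)
qed (simp add: num_params_def)

lemma average_net:
  assumes "\<Phi> \<in> anns" "in_dim \<Phi> = d" "out_dim \<Phi> = q" "M \<ge> 1"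
  shows "average_net M c z \<Phi> \<in> anns" "layered d (average_net M c z \<Phi>) q"
    "average_net M c z \<Phi> \<noteq> []"
    "num_params (average_net M c z \<Phi>) \<le> M\<^sup>2 * num_params \<Phi>"
    "i < q \<Longrightarrow> realization act (average_net M c z \<Phi>) x i =
       (\<Sum>m<M. c m * realization act \<Phi> (\<lambda>j. x j + z m j) i)"
proof -
  obtain W B \<Psi> where \<Phi>: "\<Phi> = (W, B) # \<Psi>" and \<Psi>: "\<Psi> \<noteq> []"
    using assms(1) by (cases \<Phi>; cases "tl \<Phi>") (auto simp: anns_def)
  have W: "dim_col W = d" "dim_vec B = dim_row W" "d \<ge> 1" "layered (dim_row W) \<Psi> q"
    using assms(1-3) by (auto simp: anns_iff_layered \<Phi>)
  let ?r = "dim_row W"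
  show l: "layered d (average_net M c z \<Phi>) q" and ne: "average_net M c z \<Phi> \<noteq> []"
    using W layered_average_tail[OF W(4) \<Psi> assms(4)] by (auto simp: average_net_def \<Phi>)
  have "length (average_net M c z \<Phi>) \<ge> 2"
    using \<Psi> average_tail_eq_Nil[of M c \<Psi>] by (cases "average_tail M c \<Psi>") (auto simp: average_net_def \<Phi>)
  then show "average_net M c z \<Phi> \<in> anns"
    using l layered_dims[OF l ne] by (simp add: anns_iff_layered)
  have "M \<le> M\<^sup>2" using assms by (auto simp: power2_eq_square)
  then have "M * ?r * (d + 1) \<le> M\<^sup>2 * (?r * (d + 1))"
    by (metis mult_le_mono1 mult.assoc)
  then show "num_params (average_net M c z \<Phi>) \<le> M\<^sup>2 * num_params \<Phi>"
    using num_params_average_tail[OF assms(4), of c \<Psi>] W(1)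
    by (simp add: average_net_def \<Phi> num_params_Cons distrib_left)
  show "realization act (average_net M c z \<Phi>) x i =
       (\<Sum>m<M. c m * realization act \<Phi> (\<lambda>j. x j + z m j) i)" if "i < q"
  proof -
    define X where "X = activate act (M * ?r) (affine_layer
        (Matrix.mat (M * ?r) d (\<lambda>(i, j). W $$ (i mod ?r, j)))
        (Matrix.vec (M * ?r) (\<lambda>i. affine_layer W B (z (i div ?r)) (i mod ?r))) x)"
    have X: "X (m * ?r + j) = activate act ?r (affine_layer W B (\<lambda>j. x j + z m j)) j" if "m < M" "j < ?r" for m j
    proof -
      have less: "m * ?r + j < M * ?r"
        using that by (rule block_index_less)
      then show ?thesis
        using that W(1,2)
        by (simp add: X_def activate_def affine_layer_nth distrib_left sum.distrib add.assoc)
    qed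
    show ?thesis
      using realization_average_tail[where X = X and
          x = "\<lambda>m. activate act (dim_row W) (affine_layer W B (\<lambda>j. x j + z m j))",
          OF W(4) \<Psi> that X] \<Psi> W(1)
      by (simp add: average_net_def \<Phi> realization_Cons X_def)
  qed
qed

subsection \<open>Uniqueness for the heat equation\<close>

text \<open>If \<open>D\<close> were positive, \<open>g'\<close> would be positive just to the right
  of its zero \<open>s0\<close>, and the mean value theorem would make \<open>g\<close> exceed its
  maximum. The second derivative is required only at \<open>s0\<close>.\<close>

lemma second_deriv_nonpos_at_max:
  fixes g g' :: "real \<Rightarrow> real"
  assumes "r > 0" and g: "\<And>s. \<bar>s - s0\<bar> < r \<Longrightarrow> (g has_real_derivative g' s) (at s)"
    and g': "(g' has_real_derivative D) (at s0)"
    and max: "\<And>s. \<bar>s - s0\<bar> < r \<Longrightarrow> g s \<le> g s0"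
  shows "D \<le> 0"
proof (rule ccontr)
  assume "\<not> D \<le> 0"
  then obtain e where e: "e > 0" "\<And>h. 0 < h \<Longrightarrow> h < e \<Longrightarrow> g' s0 < g' (s0 + h)"
    using has_real_derivative_pos_inc_right[OF g'] by auto
  have 0: "g' s0 = 0"
    using DERIV_local_max[OF g[of s0] \<open>r > 0\<close>] max \<open>r > 0\<close> by (simp add: abs_minus_commute)
  define h where "h = min e r / 2"
  have h: "h > 0" "h < e" "h < r" using e \<open>r > 0\<close> by (auto simp: h_def min_def)
  obtain z where z: "z > s0" "z < s0 + h" "g (s0 + h) - g s0 = (s0 + h - s0) * g' z"
    using MVT2[of s0 "s0 + h" g g'] g h by force
  have "g' z > 0" using e(2)[of "z - s0"] z h 0 by auto
  then have "g (s0 + h) > g s0" using z h by (simp add: algebra_simps)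
  then show False using max[of "s0 + h"] h by auto
qed

text \<open>Only earlier times are compared with \<open>t0\<close>, so a maximum at the end point
  \<open>T\<close> is covered as well.\<close>

lemma time_deriv_nonneg_at_max:
  fixes g :: "real \<Rightarrow> real"
  assumes "0 < t0" "t0 \<le> T" and g: "(g has_real_derivative D) (at t0 within {0<..T})"
    and max: "\<And>s. 0 < s \<Longrightarrow> s \<le> T \<Longrightarrow> g s \<le> g t0"
  shows "D \<ge> 0"
proof (rule ccontr)
  assume "\<not> D \<ge> 0"
  then obtain e where e: "e > 0" "\<And>h. 0 < h \<Longrightarrow> t0 - h \<in> {0<..T} \<Longrightarrow> h < e \<Longrightarrow> g t0 < g (t0 - h)"
    using has_real_derivative_neg_dec_left[OF g] by auto
  define h where "h = min e t0 / 2"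
  have h: "h > 0" "h < e" "h < t0" using e \<open>t0 > 0\<close> by (auto simp: h_def min_def)
  then show False using e(2)[of h] max[of "t0 - h"] assms(2) by auto
qed

lemma partial_deriv_line:
  assumes "\<And>x. x \<in> Rn d \<Longrightarrow> partially_differentiable i f x" "x \<in> Rn d" "i < d"
  shows "((\<lambda>s. f (x(i := s))) has_real_derivative partial_deriv i f (x(i := s))) (at s)"
  using assms(1)[OF Rn_update[OF assms(2,3), of s]]
  unfolding partially_differentiable_def partial_deriv_def
  by (simp add: DERIV_deriv_iff_real_differentiable)

lemma continuous_time_space_iff:
  "continuous_time_space I d u \<longleftrightarrow> continuous_on (I \<times> Rn d) (\<lambda>(t, x). u t x)"
  unfolding continuous_time_space_def
  by (subst Euclidean_space_eq_top_of_set) simp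

text \<open>In the product topology over all coordinates the set is a product of compact sets, with
  factor {0} from coordinate \<open>d\<close> on.\<close>

lemma compact_cube: "compact {x \<in> Rn d. \<forall>i<d. \<bar>x i\<bar> \<le> R}"
proof -
  have "{x \<in> Rn d. \<forall>i<d. \<bar>x i\<bar> \<le> R} = PiE UNIV (\<lambda>i. if i < d then {-R..R} else {0})"
    by (auto simp: Rn_iff PiE_iff abs_le_iff split: if_splits) (metis minus_le_iff)
  then have "compactin (powertop_real UNIV) {x \<in> Rn d. \<forall>i<d. \<bar>x i\<bar> \<le> R}"
    by (auto simp: compactin_PiE)
  then show ?thesis
    by (simp add: euclidean_product_topology)
qed

lemma time_deriv_works:
  assumes "C12 {0<..T} d u" "t \<in> {0<..T}" "x \<in> Rn d"
  shows "((\<lambda>s. u s x) has_real_derivative time_deriv {0<..T} u t x) (at t within {0<..T})"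
  using assms unfolding C12_def time_deriv_def has_real_derivative_iff_has_vector_derivative
  by (auto simp: vector_derivative_works)

text \<open>A finite infimum means that one exponent has a finite supremum; taking
  \<open>max C 1\<close> makes the constant positive.\<close>

lemma poly_growing_bound:
  assumes "poly_growing T d u"
  obtains C \<gamma> where "\<gamma> > 0" "C > 0"
    "\<And>s y. s \<in> {0..T} \<Longrightarrow> y \<in> Rn d \<Longrightarrow> \<bar>u s y\<bar> \<le> C * (1 + L2_set y {..<d} powr \<gamma>)"
proof -
  from assms obtain \<gamma> where \<gamma>: "\<gamma> > 0" and
    "(SUP (s, y) \<in> {0..T} \<times> Rn d. ereal (\<bar>u s y\<bar> / (1 + L2_set y {..<d} powr \<gamma>))) < \<infinity>"
    unfolding poly_growing_def INF_less_iff by auto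
  then obtain C where C: "(SUP (s, y) \<in> {0..T} \<times> Rn d. ereal (\<bar>u s y\<bar> / (1 + L2_set y {..<d} powr \<gamma>))) \<le> ereal C"
    by (cases "SUP (s, y) \<in> {0..T} \<times> Rn d. ereal (\<bar>u s y\<bar> / (1 + L2_set y {..<d} powr \<gamma>))") auto
  have "\<bar>u s y\<bar> \<le> max C 1 * (1 + L2_set y {..<d} powr \<gamma>)" if "s \<in> {0..T}" "y \<in> Rn d" for s y
  proof -
    have "(\<lambda>(s, y). ereal (\<bar>u s y\<bar> / (1 + L2_set y {..<d} powr \<gamma>))) (s, y) \<le> ereal C"
      using that by (intro order.trans[OF SUP_upper C]) auto
    then have "\<bar>u s y\<bar> / (1 + L2_set y {..<d} powr \<gamma>) \<le> max C 1" by simp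
    then show ?thesis
      by (subst (asm) pos_divide_le_eq) (auto intro: add_pos_nonneg)
  qed
  then show ?thesis using \<gamma> that[of \<gamma> "max C 1"] by auto
qed

lemma L2_set_le_cube:
  assumes "\<And>i. i < d \<Longrightarrow> \<bar>x i\<bar> \<le> R"
  shows "L2_set x {..<d} \<le> real d * R"
proof -
  have "L2_set x {..<d} \<le> (\<Sum>i<d. \<bar>x i\<bar>)" by (rule L2_set_le_sum_abs)
  also have "\<dots> \<le> (\<Sum>i<d. R)" using assms by (intro sum_mono) auto
  finally show ?thesis by simp
qed

text \<open>The barrier h = exp (2 s) * sum of cosh (y i) has time derivative 2 h but Laplacian h,
  so subtracting \<eta> h from u - v makes the heat inequality strict. Since cosh outgrows every
  power, the difference is negative on the faces of a large cube, and a positive maximum is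
  impossible. Letting \<eta> be small gives the claim.\<close>

lemma heat_solution_le:
  assumes u: "heat_solution T d \<phi> u" and v: "heat_solution T d \<phi> v"
    and "d \<ge> 1" and t: "t \<in> {0..T}" and x: "x \<in> Rn d"
  shows "u t x \<le> v t x"
proof -
  obtain C1 \<gamma>1 where b1: "\<gamma>1 > 0" "C1 > 0"
    "\<And>s y. s \<in> {0..T} \<Longrightarrow> y \<in> Rn d \<Longrightarrow> \<bar>u s y\<bar> \<le> C1 * (1 + L2_set y {..<d} powr \<gamma>1)"
    using u poly_growing_bound[of T d u] unfolding heat_solution_def by metis
  obtain C2 \<gamma>2 where b2: "\<gamma>2 > 0" "C2 > 0"
    "\<And>s y. s \<in> {0..T} \<Longrightarrow> y \<in> Rn d \<Longrightarrow> \<bar>v s y\<bar> \<le> C2 * (1 + L2_set y {..<d} powr \<gamma>2)"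
    using v poly_growing_bound[of T d v] unfolding heat_solution_def by metis
  let ?h = "\<lambda>s y. exp (2 * s) * (\<Sum>i<d. cosh (y i :: real))"
  have sum_ge: "cosh (y i) \<le> (\<Sum>i<d. cosh (y i :: real))" if "i < d" for i y
    using that by (intro member_le_sum) (auto intro: less_imp_le[OF cosh_real_pos])
  have h_pos: "?h s y > 0" for s y
    using less_le_trans[OF cosh_real_pos sum_ge[of 0 y]] \<open>d \<ge> 1\<close> by (intro mult_pos_pos) auto
  have le: "u t x - v t x \<le> \<eta> * ?h t x" if "\<eta> > 0" for \<eta>
  proof -
    define F where "F = (\<lambda>s y. u s y - v s y - \<eta> * ?h s y)"
    have "real d > 0" using \<open>d \<ge> 1\<close> by simp
    \<comment> \<open>\<open>R\<close> is chosen so that on every face of the cube of radius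
      \<open>R\<close> the barrier exceeds the growth bounds of both solutions together, and so that
      \<open>x\<close> lies in the cube. The estimate uses exp R / 2 as a lower bound of cosh
      R.\<close>
    then have ev: "eventually (\<lambda>R. C1 * (1 + (real d * R) powr \<gamma>1) + C2 * (1 + (real d * R) powr \<gamma>2) < \<eta> * (exp R / 2)) at_top"
      using b1(1,2) b2(1,2) that by real_asymp
    have le: "\<eta> * (exp R / 2) \<le> \<eta> * cosh R" for R
      using that by (simp add: cosh_def)
    have "eventually (\<lambda>R. C1 * (1 + (real d * R) powr \<gamma>1) + C2 * (1 + (real d * R) powr \<gamma>2) < \<eta> * cosh R) at_top"
      using ev by (rule eventually_mono) (rule less_le_trans[OF _ le])
    moreover have "eventually (\<lambda>R. R > (\<Sum>i<d. \<bar>x i\<bar>) \<and> R > 0) at_top"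
      by (auto intro: eventually_conj eventually_gt_at_top)
    ultimately have "eventually (\<lambda>R. C1 * (1 + (real d * R) powr \<gamma>1) + C2 * (1 + (real d * R) powr \<gamma>2) < \<eta> * cosh R
      \<and> R > (\<Sum>i<d. \<bar>x i\<bar>) \<and> R > 0) at_top"
      by eventually_elim auto
    then obtain R where R: "C1 * (1 + (real d * R) powr \<gamma>1) + C2 * (1 + (real d * R) powr \<gamma>2) < \<eta> * cosh R"
      "R > (\<Sum>i<d. \<bar>x i\<bar>)" "R > 0"
      using eventually_happens by fastforce
    define K where "K = {y \<in> Rn d. \<forall>i<d. \<bar>y i\<bar> \<le> R}"
    have K: "K \<subseteq> Rn d" by (auto simp: K_def)
    have xK: "x \<in> K"
      using x R(2) member_le_sum[of _ "{..<d}" "\<lambda>i. \<bar>x i\<bar>"] by (fastforce simp: K_def)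
    have cont: "continuous_on ({0..T} \<times> K) (\<lambda>(s, y). u s y)" "continuous_on ({0..T} \<times> K) (\<lambda>(s, y). v s y)"
      using u v K unfolding heat_solution_def continuous_time_space_iff
      by (auto elim!: continuous_on_subset)
    have coord: "continuous_on S (\<lambda>p :: real \<times> (nat \<Rightarrow> real). snd p i)" for S i
      using continuous_on_compose[OF continuous_on_snd[OF continuous_on_id]
          continuous_on_subset[OF continuous_on_product_coordinates subset_UNIV], of S i]
      by (simp add: o_def)
    have "continuous_on ({0..T} \<times> K) (\<lambda>(s, y). F s y)"
      using cont unfolding F_def case_prod_unfold cosh_def
      by (auto intro!: continuous_intros coord)
    moreover have "compact ({0..T} \<times> K)"
      unfolding K_def by (intro compact_Times compact_cube compact_Icc)
    moreover have "(t, x) \<in> {0..T} \<times> K" using t xK by auto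
    ultimately obtain p where "p \<in> {0..T} \<times> K" "\<forall>q \<in> {0..T} \<times> K. (\<lambda>(s, y). F s y) q \<le> (\<lambda>(s, y). F s y) p"
      using continuous_attains_sup[of "{0..T} \<times> K" "\<lambda>(s, y). F s y"] by blast
    then obtain t0 x0 where p: "t0 \<in> {0..T}" "x0 \<in> K" and max: "\<And>s y. s \<in> {0..T} \<Longrightarrow> y \<in> K \<Longrightarrow> F s y \<le> F t0 x0"
      by (cases p) auto
    have x0: "x0 \<in> Rn d" using p K by auto
    have "F t0 x0 \<le> 0"
    proof (rule ccontr)
      \<comment> \<open>The maximum point is neither at time 0, where F = - \<eta> h, nor on a face.
        In the remaining case the signs of the time derivative and of the second space derivatives
        give 2 \<eta> h <= Laplacian of (u - v) <= \<eta> h, against h > 0.\<close>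
      assume "\<not> F t0 x0 \<le> 0"
      then have pos: "F t0 x0 > 0" by simp
      have "t0 \<noteq> 0"
      proof
        assume "t0 = 0"
        then have "F t0 x0 = - \<eta> * ?h 0 x0"
          using u v x0 by (simp add: F_def heat_solution_def)
        then show False using pos h_pos[of 0 x0] \<open>\<eta> > 0\<close> by (simp add: zero_less_mult_iff mult_less_0_iff)
      qed
      then have t0: "t0 \<in> {0<..T}" using p by auto
      have inner: "\<bar>x0 i\<bar> < R" if "i < d" for i
      proof (rule ccontr)
        assume "\<not> \<bar>x0 i\<bar> < R"
        then have "\<bar>x0 i\<bar> = R" using p that by (force simp: K_def)
        then have "cosh R = cosh (x0 i)" by (metis cosh_real_abs)
        then have "cosh R \<le> (\<Sum>i<d. cosh (x0 i))" using sum_ge[OF that, of x0] by (simp only:)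
        also have "\<dots> \<le> ?h t0 x0"
          using mult_right_mono[of 1 "exp (2 * t0)" "\<Sum>i<d. cosh (x0 i)"] t0
          by (auto intro!: sum_nonneg less_imp_le[OF cosh_real_pos])
        finally have 1: "\<eta> * cosh R \<le> \<eta> * ?h t0 x0" using \<open>\<eta> > 0\<close> by simp
        have L: "L2_set x0 {..<d} \<le> real d * R"
          using p by (intro L2_set_le_cube) (auto simp: K_def)
        have "\<bar>u t0 x0\<bar> \<le> C1 * (1 + (real d * R) powr \<gamma>1)" "\<bar>v t0 x0\<bar> \<le> C2 * (1 + (real d * R) powr \<gamma>2)"
          using b1 b2 L p x0
          by (auto intro!: order.trans[OF b1(3)] order.trans[OF b2(3)] powr_mono2)
        then show False using 1 R(1) pos unfolding F_def by linarith
      qed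
      have time: "((\<lambda>s. F s x0) has_real_derivative
          time_deriv {0<..T} u t0 x0 - time_deriv {0<..T} v t0 x0 - \<eta> * (2 * ?h t0 x0)) (at t0 within {0<..T})"
        unfolding F_def
        using time_deriv_works[OF _ t0 x0, of u] time_deriv_works[OF _ t0 x0, of v] u v
        by (auto simp: heat_solution_def intro!: derivative_eq_intros)
      have "0 \<le> time_deriv {0<..T} u t0 x0 - time_deriv {0<..T} v t0 x0 - \<eta> * (2 * ?h t0 x0)"
        using t0 p max by (intro time_deriv_nonneg_at_max[OF _ _ time]) auto
      also have "time_deriv {0<..T} u t0 x0 - time_deriv {0<..T} v t0 x0 = laplacian d (u t0) x0 - laplacian d (v t0) x0"
        using u v t0 x0 by (auto simp: heat_solution_def)
      finally have ge: "2 * \<eta> * ?h t0 x0 \<le> laplacian d (u t0) x0 - laplacian d (v t0) x0" by simp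
      have "partial_deriv i (partial_deriv i (u t0)) x0 - partial_deriv i (partial_deriv i (v t0)) x0
          - \<eta> * (exp (2 * t0) * cosh (x0 i)) \<le> 0" if i: "i < d" for i
      proof -
        have pd: "partially_differentiable i (w t0) y" "partially_differentiable i (partial_deriv i (w t0)) y"
          if "heat_solution T d \<phi> w" "y \<in> Rn d" for w y
          using that i t0 unfolding heat_solution_def C12_def by auto
        let ?c = "\<lambda>s. (\<Sum>k<d. cosh ((x0(i := s)) k))"
        have c: "?c s = cosh s + (\<Sum>k\<in>{..<d} - {i}. cosh (x0 k))" for s
          using i by (subst sum.remove[of _ i]) (auto intro!: sum.cong)
        have D1: "((\<lambda>s. F t0 (x0(i := s))) has_real_derivative
           partial_deriv i (u t0) (x0(i := s)) - partial_deriv i (v t0) (x0(i := s)) - \<eta> * (exp (2 * t0) * sinh s)) (at s)" for s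
          unfolding F_def c
          by (auto intro!: derivative_eq_intros partial_deriv_line[where d=d] pd u v x0 i)
        have D2: "((\<lambda>s. partial_deriv i (u t0) (x0(i := s)) - partial_deriv i (v t0) (x0(i := s)) - \<eta> * (exp (2 * t0) * sinh s))
          has_real_derivative partial_deriv i (partial_deriv i (u t0)) (x0(i := x0 i)) - partial_deriv i (partial_deriv i (v t0)) (x0(i := x0 i))
          - \<eta> * (exp (2 * t0) * cosh (x0 i))) (at (x0 i))"
          by (auto intro!: derivative_eq_intros partial_deriv_line[where d=d] pd u v x0 i)
        have "x0(i := s) \<in> K" if "\<bar>s - x0 i\<bar> < R - \<bar>x0 i\<bar>" for s
          using that p(2) i Rn_update[OF x0 i] by (auto simp: K_def)
        then show ?thesis
          using second_deriv_nonpos_at_max[OF _ D1 D2, of "R - \<bar>x0 i\<bar>"] inner[OF i] max[OF p(1)] by simp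
      qed
      then have "(\<Sum>i<d. partial_deriv i (partial_deriv i (u t0)) x0 - partial_deriv i (partial_deriv i (v t0)) x0
          - \<eta> * (exp (2 * t0) * cosh (x0 i))) \<le> 0"
        by (intro sum_nonpos) auto
      then have "laplacian d (u t0) x0 - laplacian d (v t0) x0 \<le> \<eta> * ?h t0 x0"
        by (simp add: laplacian_def sum_subtractf sum_distrib_left)
      moreover have "\<eta> * ?h t0 x0 > 0"
        using h_pos[of t0 x0] \<open>\<eta> > 0\<close> by (rule mult_pos_pos[rotated])
      ultimately show False using ge by linarith
    qed
    then show ?thesis using max[OF t xK] unfolding F_def by simp
  qed
  show ?thesis
  proof (rule ccontr)
    assume "\<not> u t x \<le> v t x"
    \<comment> \<open>For this \<eta> the bound reads u - v <= (u - v) / 2, although u - v is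
      positive.\<close>
    then show False
      using le[of "(u t x - v t x) / (2 * ?h t x)"] h_pos[of t x] by (auto split: if_splits)
  qed
qed

lemma heat_solution_unique:
  assumes "heat_solution T d \<phi> u" "heat_solution T d \<phi> v"
    and "d \<ge> 1" "t \<in> {0..T}" "x \<in> Rn d"
  shows "v t x = u t x"
  using heat_solution_le[OF assms] heat_solution_le[OF assms(2,1,3-5)] by simp

subsection \<open>The Gaussian measure\<close>

text \<open>Points of a product measure over \<open>{..<d}\<close> are \<open>undefined\<close> from
  coordinate \<open>d\<close> on, whereas points of \<open>Rn d\<close> are 0 there;
  \<open>ext0\<close> translates between the two conventions.\<close>

definition ext0 :: "nat \<Rightarrow> (nat \<Rightarrow> real) \<Rightarrow> nat \<Rightarrow> real"
  where "ext0 d y = (\<lambda>i. if i < d then y i else 0)"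

text \<open>One plus the squared Euclidean norm: a polynomial weight that is at least 1, so its
  natural powers increase with the exponent and have Gaussian moments of all orders.\<close>

definition wt :: "nat \<Rightarrow> (nat \<Rightarrow> real) \<Rightarrow> real"
  where "wt d x = 1 + (\<Sum>i<d. (x i)\<^sup>2)"

abbreviation lebesgue_n :: "nat \<Rightarrow> (nat \<Rightarrow> real) measure"
  where "lebesgue_n d \<equiv> PiM {..<d} (\<lambda>_. lborel)"

definition gauss :: "nat \<Rightarrow> (nat \<Rightarrow> real) measure"
  where "gauss d = PiM {..<d} (\<lambda>_. density lborel std_normal_density)"

lemma ext0_in_Rn [simp]: "ext0 d y \<in> Rn d"
  by (simp add: ext0_def Rn_iff)

lemma ext0_id: "x \<in> Rn d \<Longrightarrow> ext0 d x = x"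
  by (auto simp: ext0_def Rn_iff)

lemma wt_ge_1: "wt d x \<ge> 1"
  by (simp add: wt_def sum_nonneg)

lemma wt_pos [simp]: "wt d x > 0"
  using wt_ge_1[of d x] by linarith

lemma wt_nonneg [simp]: "wt d x \<ge> 0"
  by (rule less_imp_le) simp

lemma wt_ext0 [simp]: "wt d (ext0 d x) = wt d x"
  by (simp add: wt_def ext0_def)

lemma wt_eq_L2_set: "wt d x = 1 + (L2_set x {..<d})\<^sup>2"
  by (simp add: wt_def L2_set_def sum_nonneg)

text \<open>From (p + q)^2 <= 2 p^2 + 2 q^2, and then a sum of two numbers that are at least 1 is
  bounded through their product. The product form lets the dependence on \<open>x\<close> leave the
  integral over \<open>z\<close>; the bound \<open>S\<close> makes it uniform in \<sigma>.\<close>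

lemma wt_affine:
  assumes "\<sigma>\<^sup>2 \<le> S"
  shows "wt d (\<lambda>i. x i + \<sigma> * z i) \<le> 2 * (1 + S) * wt d x * wt d z"
proof -
  have "S \<ge> 0" using assms zero_le_power2[of \<sigma>] by linarith
  have "(x i + \<sigma> * z i)\<^sup>2 \<le> 2 * (x i)\<^sup>2 + 2 * S * (z i)\<^sup>2" for i
  proof -
    have "(x i + \<sigma> * z i)\<^sup>2 \<le> 2 * (x i)\<^sup>2 + 2 * (\<sigma> * z i)\<^sup>2"
      using sum_squares_bound[of "x i" "\<sigma> * z i"] by (simp add: power2_sum)
    also have "(\<sigma> * z i)\<^sup>2 \<le> S * (z i)\<^sup>2"
      unfolding power_mult_distrib by (intro mult_right_mono assms) auto
    finally show ?thesis by simp
  qed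
  then have "(\<Sum>i<d. (x i + \<sigma> * z i)\<^sup>2) \<le> (\<Sum>i<d. 2 * (x i)\<^sup>2 + 2 * S * (z i)\<^sup>2)"
    by (intro sum_mono) auto
  also have "\<dots> = 2 * (\<Sum>i<d. (x i)\<^sup>2) + 2 * S * (\<Sum>i<d. (z i)\<^sup>2)"
    by (simp add: sum.distrib sum_distrib_left)
  finally have le: "wt d (\<lambda>i. x i + \<sigma> * z i) \<le> 2 * wt d x + 2 * S * wt d z"
    using \<open>S \<ge> 0\<close> by (simp add: wt_def algebra_simps)
  have "wt d x \<le> wt d x * wt d z" "wt d z \<le> wt d x * wt d z"
    using wt_ge_1[of d x] wt_ge_1[of d z] by auto
  then have "2 * wt d x + 2 * S * wt d z \<le> 2 * (wt d x * wt d z) + 2 * S * (wt d x * wt d z)"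
    using \<open>S \<ge> 0\<close> by (intro add_mono mult_left_mono) auto
  then show ?thesis using le by (simp add: algebra_simps)
qed

text \<open>Trades the real exponent of the hypotheses for a natural one, so that all growth is
  measured by powers of \<open>wt\<close>.\<close>

lemma one_plus_L2_set_powr_le:
  assumes "c > 0" "real k \<ge> c"
  shows "1 + L2_set x {..<d} powr c \<le> 2 * wt d x ^ k"
proof -
  have "L2_set x {..<d} \<le> sqrt (wt d x)"
    unfolding wt_eq_L2_set by (rule real_le_rsqrt) simp
  also have "\<dots> \<le> wt d x" using wt_ge_1[of d x] by (intro real_le_lsqrt self_le_power) auto
  finally have "L2_set x {..<d} powr c \<le> wt d x powr c"
    using assms by (intro powr_mono2) auto
  also have "\<dots> \<le> wt d x powr k"
    using assms wt_ge_1 by (intro powr_mono) auto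
  also have "\<dots> = wt d x ^ k" by (simp add: powr_realpow)
  finally show ?thesis
    using one_le_power[OF wt_ge_1, of d x k] by simp
qed

text \<open>The sum is at most the number of terms times the largest one, whose power is a term on
  the right.\<close>

lemma sum_power_le:
  fixes a :: "'i \<Rightarrow> real"
  assumes "finite A" "\<And>i. i \<in> A \<Longrightarrow> a i \<ge> 0" "A \<noteq> {}"
  shows "(\<Sum>i\<in>A. a i) ^ k \<le> real (card A) ^ k * (\<Sum>i\<in>A. a i ^ k)"
proof -
  have "Max (a ` A) \<in> a ` A" using assms(1,3) by (intro Max_in) auto
  then obtain j where "j \<in> A" "a j = Max (a ` A)" by (metis imageE)
  then have j: "j \<in> A" "\<And>i. i \<in> A \<Longrightarrow> a i \<le> a j"
    using assms(1) by auto
  have "(\<Sum>i\<in>A. a i) ^ k \<le> (real (card A) * a j) ^ k"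
    using assms j sum_bounded_above[of A a "a j"] by (intro power_mono sum_nonneg) auto
  also have "\<dots> \<le> real (card A) ^ k * (\<Sum>i\<in>A. a i ^ k)"
    using assms j unfolding power_mult_distrib by (intro mult_left_mono member_le_sum) auto
  finally show ?thesis .
qed

text \<open>Reduces moments of the weight to moments of single coordinates, with a factor that is
  polynomial in the dimension.\<close>

lemma wt_power_le: "wt d z ^ k \<le> (real d + 1) ^ k * (1 + (\<Sum>i<d. (z i) ^ (2 * k)))"
proof -
  \<comment> \<open>The additional index \<open>d\<close> carries the summand 1.\<close>
  have "wt d z = (\<Sum>i\<le>d. if i = d then 1 else (z i)\<^sup>2)"
    unfolding lessThan_Suc_atMost[symmetric] by (simp add: wt_def)
  then have "wt d z ^ k \<le> real (card {..d}) ^ k * (\<Sum>i\<le>d. (if i = d then 1 else (z i)\<^sup>2) ^ k)"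
    by (simp only:) (intro sum_power_le, auto)
  also have "(\<Sum>i\<le>d. (if i = d then 1 else (z i)\<^sup>2) ^ k) = 1 + (\<Sum>i<d. (z i) ^ (2 * k))"
    unfolding lessThan_Suc_atMost[symmetric] by (simp add: power_mult)
  finally show ?thesis by (simp add: add.commute)
qed

interpretation std_normal: prob_space "density lborel std_normal_density"
  by (rule prob_space_normal_density) simp

lemma prob_space_gauss: "prob_space (gauss d)"
  unfolding gauss_def by (intro prob_space_PiM std_normal.prob_space_axioms)

lemma integral_gauss_moment:
  assumes "i < d"
  shows "integrable (gauss d) (\<lambda>z. (z i) ^ (2 * k))"
    "(\<integral>z. (z i) ^ (2 * k) \<partial>gauss d) = (\<integral>r. std_normal_density r * r ^ (2 * k) \<partial>lborel)"
proof -
  let ?N = "density lborel std_normal_density"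
  have d: "distr (gauss d) ?N (\<lambda>z. z i) = ?N"
    unfolding gauss_def using assms by (intro distr_PiM_component std_normal.prob_space_axioms) auto
  have m: "(\<lambda>z. z i) \<in> measurable (gauss d) ?N"
    unfolding gauss_def using assms by (intro measurable_component_singleton) auto
  have "integrable ?N (\<lambda>r. r ^ (2 * k))"
    by (subst integrable_density) (auto simp: integrable_std_normal_moment)
  then show "integrable (gauss d) (\<lambda>z. (z i) ^ (2 * k))"
    by (subst (asm) d[symmetric]) (auto simp: integrable_distr_eq[OF m])
  have "(\<integral>z. (z i) ^ (2 * k) \<partial>gauss d) = (\<integral>r. r ^ (2 * k) \<partial>?N)"
    by (subst d[symmetric]) (auto simp: integral_distr[OF m])
  also have "\<dots> = (\<integral>r. std_normal_density r * r ^ (2 * k) \<partial>lborel)"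
    by (subst integral_density) auto
  finally show "(\<integral>z. (z i) ^ (2 * k) \<partial>gauss d) = (\<integral>r. std_normal_density r * r ^ (2 * k) \<partial>lborel)" .
qed

lemma sets_gauss [measurable_cong]: "sets (gauss d) = sets (PiM {..<d} (\<lambda>_. borel))"
  unfolding gauss_def by (intro sets_PiM_cong) auto

lemma sets_lebesgue_n [measurable_cong]: "sets (lebesgue_n d) = sets (PiM {..<d} (\<lambda>_. borel))"
  by (intro sets_PiM_cong) auto

lemma wt_measurable [measurable]: "wt d \<in> borel_measurable (PiM {..<d} (\<lambda>_. borel))"
  unfolding wt_def[abs_def] by measurable

text \<open>For fixed \<open>k\<close> the remaining integral is a constant, so the bound is a
  polynomial in \<open>d\<close>. This is what keeps reweighting by the moment affordable.\<close>

lemma gauss_wt_moment: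
  shows "integrable (gauss d) (\<lambda>z. wt d z ^ k)"
    "(\<integral>z. wt d z ^ k \<partial>gauss d)
       \<le> (real d + 1) ^ k * (1 + real d * (\<integral>r. std_normal_density r * r ^ (2 * k) \<partial>lborel))"
proof -
  interpret prob_space "gauss d" by (rule prob_space_gauss)
  let ?g = "\<lambda>z. (real d + 1) ^ k * (1 + (\<Sum>i<d. (z i) ^ (2 * k)))"
  have g: "integrable (gauss d) ?g"
    using integral_gauss_moment(1) by (auto intro!: integrable_mult_right Bochner_Integration.integrable_add Bochner_Integration.integrable_sum)
  show 1: "integrable (gauss d) (\<lambda>z. wt d z ^ k)"
    by (rule Bochner_Integration.integrable_bound[OF g])
      (use wt_power_le[of d _ k] wt_ge_1[of d] in \<open>auto simp: abs_of_pos intro!: order.trans[OF wt_power_le] \<close>)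
  have "(\<integral>z. wt d z ^ k \<partial>gauss d) \<le> (\<integral>z. ?g z \<partial>gauss d)"
    using wt_power_le by (intro integral_mono[OF 1 g]) auto
  also have "\<dots> = (real d + 1) ^ k * (1 + (\<Sum>i<d. (\<integral>z. (z i) ^ (2 * k) \<partial>gauss d)))"
    using integral_gauss_moment(1)
    by (subst integral_mult_right_zero, subst Bochner_Integration.integral_add)
      (auto simp: prob_space Bochner_Integration.integral_sum intro!: Bochner_Integration.integrable_sum)
  finally show "(\<integral>z. wt d z ^ k \<partial>gauss d)
       \<le> (real d + 1) ^ k * (1 + real d * (\<integral>r. std_normal_density r * r ^ (2 * k) \<partial>lborel))"
    by (simp add: integral_gauss_moment(2))
qed

section \<open>Densities and affine images of Gaussian products\<close>

lemma PiM_density_lborel: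
  fixes f :: "nat \<Rightarrow> real \<Rightarrow> real"
  assumes [measurable]: "\<And>i. f i \<in> borel_measurable borel" and nonneg: "\<And>i r. f i r \<ge> 0"
    and "\<And>i. prob_space (density lborel (f i))"
  shows "PiM {..<d} (\<lambda>i. density lborel (f i)) = density (lebesgue_n d) (\<lambda>y. \<Prod>i<d. f i (y i))"
proof -
  interpret L: product_sigma_finite "\<lambda>_ :: nat. lborel :: real measure" by standard
  interpret P: product_prob_space "\<lambda>i. density lborel (f i)"
    by (intro product_prob_spaceI assms(3))
  show ?thesis
  \<comment> \<open>The product measure is determined by its values on boxes, where indicator and
    density both factorize over the coordinates.\<close>
  proof (rule P.PiM_eqI[symmetric])
    show "sets (density (lebesgue_n d) (\<lambda>y. \<Prod>i<d. f i (y i))) = sets (PiM {..<d} (\<lambda>i. density lborel (f i)))"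
      by (simp, intro sets_PiM_cong) auto
    fix A assume A: "\<And>i. i \<in> {..<d} \<Longrightarrow> A i \<in> sets (density lborel (f i))"
    then have [measurable]: "\<And>i. i < d \<Longrightarrow> A i \<in> sets borel" by simp
    have box: "Pi\<^sub>E {..<d} A \<in> sets (lebesgue_n d)"
      using A by (intro sets_PiM_I_finite) auto
    have ind: "indicator (Pi\<^sub>E {..<d} A) y = (\<Prod>i<d. indicator (A i) (y i) :: ennreal)" if "y \<in> space (lebesgue_n d)" for y
      using that by (auto simp: indicator_def space_PiM PiE_iff prod_zero_iff)
    have "emeasure (density (lebesgue_n d) (\<lambda>y. \<Prod>i<d. f i (y i))) (Pi\<^sub>E {..<d} A)
      = (\<integral>\<^sup>+y. ennreal (\<Prod>i<d. f i (y i)) * indicator (Pi\<^sub>E {..<d} A) y \<partial>lebesgue_n d)"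
      using box by (intro emeasure_density) auto
    also have "\<dots> = (\<integral>\<^sup>+y. (\<Prod>i<d. ennreal (f i (y i)) * indicator (A i) (y i)) \<partial>lebesgue_n d)"
      by (intro nn_integral_cong) (simp add: ind prod.distrib prod_ennreal nonneg)
    also have "\<dots> = (\<Prod>i<d. \<integral>\<^sup>+r. ennreal (f i r) * indicator (A i) r \<partial>lborel)"
      by (intro L.product_nn_integral_prod) auto
    also have "\<dots> = (\<Prod>i<d. emeasure (density lborel (f i)) (A i))"
      by (intro prod.cong refl emeasure_density[symmetric]) auto
    finally show "emeasure (density (lebesgue_n d) (\<lambda>y. \<Prod>i<d. f i (y i))) (Pi\<^sub>E {..<d} A)
       = (\<Prod>i<d. emeasure (density lborel (f i)) (A i))" .
  qed simp
qed

text \<open>The coordinates stay independent, so on boxes the claim reduces to one dimension, where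
  an affine image of a standard normal variable is normal with mean \<open>x i\<close> and standard
  deviation \<sigma>.\<close>

lemma distr_gauss_affine:
  assumes "\<sigma> > 0"
  shows "distr (gauss d) (PiM {..<d} (\<lambda>_. borel)) (\<lambda>z. \<lambda>i\<in>{..<d}. x i + \<sigma> * z i)
    = density (lebesgue_n d) (\<lambda>y. \<Prod>i<d. normal_density (x i) \<sigma> (y i))"
proof -
  let ?N = "density lborel std_normal_density"
  interpret P: product_prob_space "\<lambda>i. density lborel (normal_density (x i) \<sigma>)"
    by (intro product_prob_spaceI prob_space_normal_density assms)
  interpret G: product_prob_space "\<lambda>i. ?N"
    by (intro product_prob_spaceI prob_space_normal_density) simp
  have one: "distr ?N lborel (\<lambda>r. a + \<sigma> * r) = density lborel (normal_density a \<sigma>)" for a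
  proof -
    have "distributed ?N lborel (\<lambda>r. r) std_normal_density"
      by (auto simp: distributed_def distr_id2)
    from std_normal.normal_density_affine[OF this, of \<sigma> a] assms
    show ?thesis by (simp add: distributed_def)
  qed
  let ?f = "\<lambda>z. \<lambda>i\<in>{..<d}. x i + \<sigma> * z i"
  have f[measurable]: "?f \<in> measurable (gauss d) (PiM {..<d} (\<lambda>_. borel))"
    by measurable
  have "distr (gauss d) (PiM {..<d} (\<lambda>_. borel)) ?f = PiM {..<d} (\<lambda>i. density lborel (normal_density (x i) \<sigma>))"
  proof (rule P.PiM_eqI)
    show "sets (distr (gauss d) (PiM {..<d} (\<lambda>_. borel)) ?f) = sets (PiM {..<d} (\<lambda>i. density lborel (normal_density (x i) \<sigma>)))"
      by (simp, intro sets_PiM_cong) auto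
    fix A assume "\<And>i. i \<in> {..<d} \<Longrightarrow> A i \<in> sets (density lborel (normal_density (x i) \<sigma>))"
    then have A [measurable]: "\<And>i. i < d \<Longrightarrow> A i \<in> sets borel" by simp
    have "emeasure (distr (gauss d) (PiM {..<d} (\<lambda>_. borel)) ?f) (Pi\<^sub>E {..<d} A)
       = emeasure (gauss d) (?f -` (Pi\<^sub>E {..<d} A) \<inter> space (gauss d))"
      by (intro emeasure_distr f sets_PiM_I_finite) auto
    also have "?f -` (Pi\<^sub>E {..<d} A) \<inter> space (gauss d) = Pi\<^sub>E {..<d} (\<lambda>i. (\<lambda>r. x i + \<sigma> * r) -` A i)"
      by (auto simp: gauss_def space_PiM PiE_iff)
    also have "emeasure (gauss d) \<dots> = (\<Prod>i<d. emeasure ?N ((\<lambda>r. x i + \<sigma> * r) -` A i))"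
      unfolding gauss_def
      by (intro G.emeasure_PiM) (auto intro!: measurable_sets_borel[of _ borel] A)
    also have "\<dots> = (\<Prod>i<d. emeasure (distr ?N lborel (\<lambda>r. x i + \<sigma> * r)) (A i))"
      by (intro prod.cong refl) (subst emeasure_distr, auto)
    finally show "emeasure (distr (gauss d) (PiM {..<d} (\<lambda>_. borel)) ?f) (Pi\<^sub>E {..<d} A)
       = (\<Prod>i<d. emeasure (density lborel (normal_density (x i) \<sigma>)) (A i))"
      by (simp only: one)
  qed simp
  also have "\<dots> = density (lebesgue_n d) (\<lambda>y. \<Prod>i<d. normal_density (x i) \<sigma> (y i))"
    by (rule PiM_density_lborel) (auto intro: prob_space_normal_density assms)
  finally show ?thesis .
qed

text \<open>Continuity is known only on \<open>Rn d\<close>, so \<open>ext0\<close> is taken as a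
  measurable map into that subspace before composing.\<close>

lemma ext0_measurable:
  assumes "continuous_on (Rn d) f"
  shows "(\<lambda>y. f (ext0 d y)) \<in> borel_measurable (PiM {..<d} (\<lambda>_. borel))"
proof -
  have "ext0 d \<in> borel_measurable (PiM {..<d} (\<lambda>_. borel))"
  proof (rule measurable_coordinatewise_then_product)
    show "(\<lambda>y. ext0 d y i) \<in> borel_measurable (PiM {..<d} (\<lambda>_. borel))" for i
      by (cases "i < d") (auto simp: ext0_def intro: measurable_component_singleton)
  qed
  then have "ext0 d \<in> measurable (PiM {..<d} (\<lambda>_. borel)) (restrict_space borel (Rn d))"
    by (intro measurable_restrict_space2) auto
  then show ?thesis
    using borel_measurable_continuous_on_restrict[OF assms] by (rule measurable_compose)
qed

lemma shifted_measurable: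
  assumes "continuous_on (Rn d) f"
  shows "(\<lambda>z. f (ext0 d (\<lambda>i. x i + \<sigma> * z i))) \<in> borel_measurable (gauss d)"
proof -
  have "(\<lambda>z. \<lambda>i\<in>{..<d}. x i + \<sigma> * z i) \<in> measurable (gauss d) (PiM {..<d} (\<lambda>_. borel))"
    by measurable
  from measurable_compose[OF this ext0_measurable[OF assms]]
  show ?thesis by (simp add: ext0_def cong: if_cong)
qed

text \<open>Moves \<open>x\<close> and \<sigma> from the argument of \<open>f\<close> into a smooth
  density, where they can be differentiated although \<open>f\<close> is merely continuous.\<close>

lemma integral_gauss_affine:
  assumes "\<sigma> > 0" "continuous_on (Rn d) f"
  shows "(\<integral>z. f (ext0 d (\<lambda>i. x i + \<sigma> * z i)) \<partial>gauss d)
    = (\<integral>y. f (ext0 d y) * (\<Prod>i<d. normal_density (x i) \<sigma> (y i)) \<partial>lebesgue_n d)"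
proof -
  let ?f = "\<lambda>z. \<lambda>i\<in>{..<d}. x i + \<sigma> * z i"
  have [measurable]: "(\<lambda>y. f (ext0 d y)) \<in> borel_measurable (PiM {..<d} (\<lambda>_. borel))"
    by (rule ext0_measurable[OF assms(2)])
  have e: "ext0 d (?f z) = ext0 d (\<lambda>i. x i + \<sigma> * z i)" for z
    by (auto simp: ext0_def)
  have "(\<integral>z. f (ext0 d (\<lambda>i. x i + \<sigma> * z i)) \<partial>gauss d)
     = (\<integral>y. f (ext0 d y) \<partial>distr (gauss d) (PiM {..<d} (\<lambda>_. borel)) ?f)"
    by (subst integral_distr) (auto simp: e)
  also have "\<dots> = (\<integral>y. (\<Prod>i<d. normal_density (x i) \<sigma> (y i)) *\<^sub>R f (ext0 d y) \<partial>lebesgue_n d)"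
    unfolding distr_gauss_affine[OF assms(1)]
    by (intro integral_density) (auto intro!: prod_nonneg)
  finally show ?thesis by (simp add: mult.commute)
qed

subsection \<open>The heat kernel\<close>

text \<open>For \<open>j\<close> = 0, 1, 2 this is the \<open>j\<close>-th derivative in
  \<open>r\<close> of the one-dimensional kernel exp (- r^2 / (4 t)) / sqrt (4 pi t), the normal
  density of variance 2 t.\<close>

definition heat_kernel :: "nat \<Rightarrow> real \<Rightarrow> real \<Rightarrow> real"
  where "heat_kernel j t r = (if j = 0 then 1 else if j = 1 then - r / (2 * t) else r\<^sup>2 / (4 * t\<^sup>2) - 1 / (2 * t))
    * (exp (- r\<^sup>2 / (4 * t)) / sqrt (4 * pi * t))"

lemma heat_kernel_0: "t > 0 \<Longrightarrow> heat_kernel 0 t (x - y) = normal_density x (sqrt (2 * t)) y"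
  by (simp add: heat_kernel_def normal_density_def power2_commute)

lemma heat_kernel_space_deriv:
  assumes "t > 0" "j \<le> 1"
  shows "(heat_kernel j t has_real_derivative heat_kernel (Suc j) t r) (at r)"
proof -
  define C where "C = sqrt (4 * pi * t)"
  have C: "C > 0" using assms by (simp add: C_def)
  consider "j = 0" | "j = 1" using assms(2) by linarith
  then show ?thesis
  proof cases
    case 1
    then show ?thesis
      unfolding heat_kernel_def[abs_def] C_def[symmetric] using assms C
      by (auto intro!: derivative_eq_intros simp: field_simps)
  next
    case 2
    then show ?thesis
      unfolding heat_kernel_def[abs_def] C_def[symmetric] using assms C
      by (auto intro!: derivative_eq_intros simp: field_simps power2_eq_square)
  qed
qed

text \<open>The heat equation in one dimension, as \<open>heat_kernel 2\<close> is the second space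
  derivative of the kernel.\<close>

lemma heat_kernel_time_deriv:
  assumes "t > 0"
  shows "((\<lambda>t. heat_kernel 0 t r) has_real_derivative heat_kernel 2 t r) (at t)"
proof -
  have s: "sqrt (4 * pi * t) * sqrt (4 * pi * t) = 4 * pi * t" "sqrt (4 * pi * t) > 0"
    using assms by auto
  have "((\<lambda>t. exp (- r\<^sup>2 / (4 * t)) * (1 / sqrt (4 * pi * t))) has_real_derivative
    (exp (- r\<^sup>2 / (4 * t)) * (r\<^sup>2 / (4 * t\<^sup>2))) * (1 / sqrt (4 * pi * t))
     + (- (1 / (2 * t)) * (1 / sqrt (4 * pi * t))) * exp (- r\<^sup>2 / (4 * t))) (at t)"
  proof (rule DERIV_mult)
    show "((\<lambda>t. exp (- r\<^sup>2 / (4 * t))) has_real_derivative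
        exp (- r\<^sup>2 / (4 * t)) * (r\<^sup>2 / (4 * t\<^sup>2))) (at t)"
      using assms by (auto intro!: derivative_eq_intros simp: power2_eq_square)
    show "((\<lambda>t. 1 / sqrt (4 * pi * t)) has_real_derivative - (1 / (2 * t)) * (1 / sqrt (4 * pi * t))) (at t)"
      using assms s by (auto intro!: derivative_eq_intros simp: divide_simps mult_less_0_iff)
  qed
  then show ?thesis
    by (simp add: heat_kernel_def algebra_simps diff_divide_distrib)
qed

lemma heat_kernel_measurable [measurable]: "heat_kernel j t \<in> borel_measurable borel"
  unfolding heat_kernel_def[abs_def] by measurable

lemma heat_kernel_continuous:
  assumes "(tn \<longlongrightarrow> t) F" "(rn \<longlongrightarrow> r) F" "t > 0"
  shows "((\<lambda>n. heat_kernel j (tn n) (rn n)) \<longlongrightarrow> heat_kernel j t r) F"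
  unfolding heat_kernel_def using assms
  by (cases "j = 0"; cases "j = 1") (auto intro!: tendsto_intros)

lemma one_plus_square_le_exp: "1 + r\<^sup>2 \<le> 2 * exp \<bar>r :: real\<bar>"
  using exp_lower_Taylor_quadratic[of "\<bar>r\<bar>"] by simp

text \<open>One majorant for all orders \<open>j\<close>, for \<open>t\<close> bounded and bounded
  away from 0, and for bounded \<open>x\<close>. Decay at rate 2 leaves room for an integrand
  growing like exp of the absolute value, after which rate 1 still remains for
  integrability.\<close>

lemma heat_kernel_bound:
  assumes "0 < t" "1 / t \<le> S" "t \<le> T" "\<bar>x\<bar> \<le> R"
  shows "\<bar>heat_kernel j t (x - y)\<bar> \<le> 2 * (1 + S + S\<^sup>2) * (1 + S) * exp (9 * T + 2 * R) * exp (- 2 * \<bar>y\<bar>)"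
proof -
  define r where "r = x - y"
  have S: "S > 0" using assms(1,2) by (auto intro: less_le_trans[of 0 "1 / t"])
  have p1: "\<bar>- r / (2 * t)\<bar> \<le> S * (1 + r\<^sup>2)"
  proof -
    have "\<bar>- r / (2 * t)\<bar> = (1 / t) * (\<bar>r\<bar> / 2)" using assms(1) by (simp add: abs_divide abs_mult)
    also have "\<dots> \<le> S * (1 + r\<^sup>2)"
      using assms S sum_squares_bound[of 1 "\<bar>r\<bar>"] by (intro mult_mono) auto
    finally show ?thesis .
  qed
  have p2: "\<bar>r\<^sup>2 / (4 * t\<^sup>2) - 1 / (2 * t)\<bar> \<le> (S + S\<^sup>2) * (1 + r\<^sup>2)"
  proof -
    have "r\<^sup>2 / (4 * t\<^sup>2) = (1 / t)\<^sup>2 * (r\<^sup>2 / 4)" by (simp add: power_divide)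
    also have "\<dots> \<le> S\<^sup>2 * r\<^sup>2"
      using assms by (intro mult_mono power_mono) auto
    finally have 1: "r\<^sup>2 / (4 * t\<^sup>2) \<le> S\<^sup>2 * r\<^sup>2" .
    have 2: "1 / (2 * t) \<le> S" using assms S by (auto simp: field_simps)
    have "\<bar>r\<^sup>2 / (4 * t\<^sup>2) - 1 / (2 * t)\<bar> \<le> \<bar>r\<^sup>2 / (4 * t\<^sup>2)\<bar> + \<bar>1 / (2 * t)\<bar>" by (rule abs_triangle_ineq4)
    also have "\<dots> = r\<^sup>2 / (4 * t\<^sup>2) + 1 / (2 * t)" using assms(1) by simp
    also have "\<dots> \<le> S\<^sup>2 * r\<^sup>2 + S" using 1 2 by simp
    also have "\<dots> \<le> (S + S\<^sup>2) * (1 + r\<^sup>2)" using S by (simp add: algebra_simps)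
    finally show ?thesis .
  qed
  have "\<bar>if j = 0 then 1 else if j = 1 then - r / (2 * t) else r\<^sup>2 / (4 * t\<^sup>2) - 1 / (2 * t)\<bar>
     \<le> (1 + S + S\<^sup>2) * (1 + r\<^sup>2)"
  proof -
    have "S * (1 + r\<^sup>2) \<le> (1 + S + S\<^sup>2) * (1 + r\<^sup>2)" "(S + S\<^sup>2) * (1 + r\<^sup>2) \<le> (1 + S + S\<^sup>2) * (1 + r\<^sup>2)"
      "1 * 1 \<le> (1 + S + S\<^sup>2) * (1 + r\<^sup>2)"
      using S by (intro mult_right_mono mult_mono; simp)+
    then show ?thesis using p1 p2 by (auto intro: order.trans)
  qed
  also have "\<dots> \<le> (1 + S + S\<^sup>2) * (2 * exp \<bar>r\<bar>)"
    using S by (intro mult_left_mono one_plus_square_le_exp) auto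
  finally have poly: "\<bar>if j = 0 then 1 else if j = 1 then - r / (2 * t) else r\<^sup>2 / (4 * t\<^sup>2) - 1 / (2 * t)\<bar>
     \<le> (1 + S + S\<^sup>2) * (2 * exp \<bar>r\<bar>)" .
  \<comment> \<open>Completing the square. Of the rate 3, one unit pays for the polynomial prefactor
    and two are kept for \<open>y\<close>.\<close>
  have e: "exp (- r\<^sup>2 / (4 * t)) \<le> exp (9 * T - 3 * \<bar>r\<bar>)"
  proof -
    have "0 \<le> (\<bar>r\<bar> - 6 * t)\<^sup>2 / (4 * t)" using assms(1) by simp
    also have "\<dots> = r\<^sup>2 / (4 * t) + 9 * t - 3 * \<bar>r\<bar>"
      using assms(1) by (simp add: power2_diff field_simps) (simp add: power2_eq_square)
    finally show ?thesis using assms(3) by simp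
  qed
  have s: "1 / sqrt (4 * pi * t) \<le> 1 + S"
  proof -
    have "1 / sqrt (4 * pi * t) \<le> 1 / sqrt t"
      using assms(1) pi_gt3 by (intro divide_left_mono) (auto intro!: mult_pos_pos)
    also have "\<dots> = sqrt (1 / t)" by (simp add: real_sqrt_divide)
    also have "\<dots> \<le> 1 + S"
      using assms S by (intro real_le_lsqrt) (auto simp: power2_eq_square algebra_simps intro: order.trans)
    finally show ?thesis .
  qed
  have "\<bar>heat_kernel j t r\<bar> = \<bar>if j = 0 then 1 else if j = 1 then - r / (2 * t) else r\<^sup>2 / (4 * t\<^sup>2) - 1 / (2 * t)\<bar>
      * (exp (- r\<^sup>2 / (4 * t)) * (1 / sqrt (4 * pi * t)))"
    using assms(1) unfolding heat_kernel_def abs_mult by simp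
  also have "\<dots> \<le> ((1 + S + S\<^sup>2) * (2 * exp \<bar>r\<bar>)) * (exp (9 * T - 3 * \<bar>r\<bar>) * (1 + S))"
    using assms(1) S by (intro mult_mono poly e s) auto
  also have "\<dots> = 2 * (1 + S + S\<^sup>2) * (1 + S) * (exp \<bar>r\<bar> * exp (9 * T - 3 * \<bar>r\<bar>))"
    by (simp only: mult_ac)
  also have "exp \<bar>r\<bar> * exp (9 * T - 3 * \<bar>r\<bar>) = exp (9 * T - 2 * \<bar>r\<bar>)"
    by (simp add: exp_add[symmetric])
  also have "2 * (1 + S + S\<^sup>2) * (1 + S) * exp (9 * T - 2 * \<bar>r\<bar>)
     \<le> 2 * (1 + S + S\<^sup>2) * (1 + S) * exp (9 * T + 2 * R - 2 * \<bar>y\<bar>)"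
  proof -
    have "\<bar>y\<bar> \<le> R + \<bar>r\<bar>" using assms(4) unfolding r_def by linarith
    then show ?thesis using S by (intro mult_left_mono) auto
  qed
  finally show ?thesis by (simp add: r_def exp_diff exp_minus divide_inverse mult.assoc)
qed

text \<open>Dominated by the exponential density plus its reflection at 0.\<close>

lemma integrable_exp_neg_abs: "integrable lborel (\<lambda>y :: real. exp (- \<bar>y\<bar>))"
proof -
  interpret prob_space "density lborel (exponential_density 1)"
    by (rule prob_space_exponential_density) simp
  have "(\<integral>\<^sup>+y. ennreal (exponential_density 1 y) \<partial>lborel) = 1"
    using emeasure_space_1 by (simp add: emeasure_density)
  then have e: "integrable lborel (exponential_density 1)"
    by (intro integrableI_nonneg) (auto simp: exponential_density_def)
  have "integrable lborel (\<lambda>y. exponential_density 1 y + exponential_density 1 (0 + (-1) * y))"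
    by (intro Bochner_Integration.integrable_add e lborel_integrable_real_affine) simp
  then show ?thesis
    by (rule Bochner_Integration.integrable_bound) (auto simp: exponential_density_def)
qed

text \<open>Dominated convergence for the difference quotients, which the mean value theorem bounds
  by the majorant \<open>G\<close> of the derivatives.\<close>

lemma has_real_derivative_integral:
  fixes f f' :: "real \<Rightarrow> 'a \<Rightarrow> real"
  assumes "e > 0" and int: "\<And>s. \<bar>s - s0\<bar> < e \<Longrightarrow> integrable M (f s)"
    and deriv: "\<And>s y. \<bar>s - s0\<bar> < e \<Longrightarrow> y \<in> space M \<Longrightarrow> ((\<lambda>s. f s y) has_real_derivative f' s y) (at s)"
    and meas: "f' s0 \<in> borel_measurable M"
    and G: "integrable M G" "\<And>s y. \<bar>s - s0\<bar> < e \<Longrightarrow> y \<in> space M \<Longrightarrow> \<bar>f' s y\<bar> \<le> G y"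
  shows "((\<lambda>s. \<integral>y. f s y \<partial>M) has_real_derivative (\<integral>y. f' s0 y \<partial>M)) (at s0)"
proof -
  define B where "B = {s0 - e<..<s0 + e}"
  have B: "s \<in> B \<longleftrightarrow> \<bar>s - s0\<bar> < e" for s by (auto simp: B_def)
  have at: "at s0 within B = at s0"
    using \<open>e > 0\<close> by (intro at_within_open) (auto simp: B_def)
  have "((\<lambda>s. (integral\<^sup>L M (f s) - integral\<^sup>L M (f s0)) / (s - s0)) \<longlongrightarrow> integral\<^sup>L M (f' s0)) (at s0 within B)"
    unfolding tendsto_at_iff_sequentially o_def
  proof (intro allI impI)
    fix X assume X: "\<forall>i. X i \<in> B - {s0}" "X \<longlonglongrightarrow> s0"
    have 1: "(integral\<^sup>L M (f (X i)) - integral\<^sup>L M (f s0)) / (X i - s0) = (\<integral>y. (f (X i) y - f s0 y) / (X i - s0) \<partial>M)" for i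
      using X(1) \<open>e > 0\<close> by (simp add: Bochner_Integration.integral_diff int B)
    show "(\<lambda>i. (integral\<^sup>L M (f (X i)) - integral\<^sup>L M (f s0)) / (X i - s0)) \<longlonglongrightarrow> integral\<^sup>L M (f' s0)"
      unfolding 1
    proof (rule integral_dominated_convergence[OF meas _ G(1)])
      show "(\<lambda>y. (f (X i) y - f s0 y) / (X i - s0)) \<in> borel_measurable M" for i
        using X(1) \<open>e > 0\<close> int[THEN borel_measurable_integrable] by (auto simp: B)
      show "AE y in M. (\<lambda>i. (f (X i) y - f s0 y) / (X i - s0)) \<longlonglongrightarrow> f' s0 y"
      proof (rule AE_I2)
        fix y assume "y \<in> space M"
        then have "((\<lambda>s. (f s y - f s0 y) / (s - s0)) \<longlongrightarrow> f' s0 y) (at s0 within B)"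
          using deriv[of s0 y] \<open>e > 0\<close> unfolding at by (simp add: has_field_derivative_iff)
        then show "(\<lambda>i. (f (X i) y - f s0 y) / (X i - s0)) \<longlonglongrightarrow> f' s0 y"
          using X unfolding tendsto_at_iff_sequentially o_def by blast
      qed
      show "AE y in M. norm ((f (X i) y - f s0 y) / (X i - s0)) \<le> G y" for i
      proof (rule AE_I2)
        fix y assume y: "y \<in> space M"
        have "norm (f (X i) y - f s0 y) \<le> G y * norm (X i - s0)"
        proof (rule field_differentiable_bound[of B])
          show "((\<lambda>s. f s y) has_field_derivative f' s y) (at s within B)" if "s \<in> B" for s
            using deriv[of s y] that y by (auto simp: B intro: has_field_derivative_at_within)
        qed (use X(1) \<open>e > 0\<close> G(2) y in \<open>auto simp: B\<close>, simp add: B_def)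
        then show "norm ((f (X i) y - f s0 y) / (X i - s0)) \<le> G y"
          using X(1) by (simp add: norm_divide divide_le_eq)
      qed
    qed
  qed
  then show ?thesis unfolding at has_field_derivative_iff .
qed

text \<open>Bounds the weight \<open>wt\<close> by a product over the coordinates, so that the
  majorant of the heat integral becomes a product of one-dimensional functions.\<close>

lemma one_plus_sum_le_prod:
  fixes a :: "nat \<Rightarrow> real"
  shows "(\<And>i. i < d \<Longrightarrow> a i \<ge> 0) \<Longrightarrow> 1 + (\<Sum>i<d. a i) \<le> (\<Prod>i<d. 1 + a i)"
proof (induction d)
  case (Suc d)
  have "a d * (\<Sum>i<d. a i) \<ge> 0"
    using Suc.prems by (intro mult_nonneg_nonneg sum_nonneg) auto
  then have "1 + (\<Sum>i<Suc d. a i) \<le> (1 + (\<Sum>i<d. a i)) * (1 + a d)"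
    by (simp add: algebra_simps)
  also have "\<dots> \<le> (\<Prod>i<d. 1 + a i) * (1 + a d)"
    using Suc by (intro mult_right_mono) auto
  finally show ?case by simp
qed simp

lemma one_plus_square_power_le_exp:
  "\<exists>P > 0. \<forall>r :: real. (1 + r\<^sup>2) ^ k \<le> P * exp \<bar>r\<bar>"
proof (intro exI conjI allI)
  \<comment> \<open>The estimate for \<open>k = 1\<close> is applied to r / m and then raised to the
    power \<open>k\<close>; with m > k the exponent k / m stays below 1, and \<open>m\<close> is
    nonzero even for \<open>k = 0\<close>.\<close>
  define m where "m = real k + 1"
  have m: "m \<ge> 1" by (simp add: m_def)
  show "(2 * m\<^sup>2) ^ k > 0" using m by simp
  fix r :: real
  have "1 + r\<^sup>2 \<le> m\<^sup>2 * (1 + (r / m)\<^sup>2)"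
    using m by (simp add: power_divide distrib_left)
  also have "\<dots> \<le> m\<^sup>2 * (2 * exp \<bar>r / m\<bar>)"
    by (intro mult_left_mono one_plus_square_le_exp) auto
  finally have "(1 + r\<^sup>2) ^ k \<le> (m\<^sup>2 * (2 * exp \<bar>r / m\<bar>)) ^ k"
    by (intro power_mono) auto
  also have "\<dots> = (2 * m\<^sup>2) ^ k * exp (real k * \<bar>r / m\<bar>)"
    by (simp only: power_mult_distrib exp_of_nat_mult mult_ac)
  also have "real k * \<bar>r / m\<bar> \<le> \<bar>r\<bar>"
    using m mult_right_mono[of "real k" m "\<bar>r\<bar>"] by (simp add: m_def abs_divide field_simps)
  finally show "(1 + r\<^sup>2) ^ k \<le> (2 * m\<^sup>2) ^ k * exp \<bar>r\<bar>" using m by simp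
qed

section \<open>Derivatives of the convolution with the heat kernel\<close>

locale heat_initial_value =
  fixes d :: nat and \<phi> :: "(nat \<Rightarrow> real) \<Rightarrow> real" and C :: real and k :: nat
  assumes cont: "continuous_on (Rn d) \<phi>"
    and bound: "\<And>x. x \<in> Rn d \<Longrightarrow> \<bar>\<phi> x\<bar> \<le> C * wt d x ^ k"
begin

text \<open>\<open>q i\<close> counts the space derivatives taken in direction \<open>i\<close>, so
  that all derivatives considered of the convolution are again heat integrals.\<close>

definition heat_int :: "(nat \<Rightarrow> nat) \<Rightarrow> real \<Rightarrow> (nat \<Rightarrow> real) \<Rightarrow> real"
  where "heat_int q t x =
    (\<integral>y. \<phi> (ext0 d y) * (\<Prod>i<d. heat_kernel (q i) t (x i - y i)) \<partial>lebesgue_n d)"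

text \<open>The Gaussian form makes sense at \<open>t = 0\<close> without a case distinction, where
  it is the integral of a constant.\<close>

definition heat_sol :: "real \<Rightarrow> (nat \<Rightarrow> real) \<Rightarrow> real"
  where "heat_sol t x = (\<integral>z. \<phi> (ext0 d (\<lambda>i. x i + sqrt (2 * t) * z i)) \<partial>gauss d)"

lemma C_nonneg: "C \<ge> 0"
  using bound[of "\<lambda>_. 0"] by (simp add: Rn_iff wt_def)

lemma \<phi>_measurable [measurable]: "(\<lambda>y. \<phi> (ext0 d y)) \<in> borel_measurable (PiM {..<d} (\<lambda>_. borel))"
  by (rule ext0_measurable[OF cont])

lemma integrand_measurable [measurable]:
  "(\<lambda>y. \<phi> (ext0 d y) * (\<Prod>i<d. heat_kernel (q i) t (x i - y i))) \<in> borel_measurable (lebesgue_n d)"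
  by measurable

text \<open>Per coordinate, the growth of \<phi> costs exp of the absolute value and the kernel
  supplies decay at rate 2, so an integrable product of exponentials remains. The bound
  \<open>R\<close> may vary with the coordinate, which suits changing a single one.\<close>

lemma heat_int_dominated:
  obtains G where "integrable (lebesgue_n d) G"
    "\<And>q t x y. 0 < t \<Longrightarrow> 1 / t \<le> S \<Longrightarrow> t \<le> T \<Longrightarrow> (\<And>i. i < d \<Longrightarrow> \<bar>x i\<bar> \<le> R i) \<Longrightarrow>
      \<bar>\<phi> (ext0 d y) * (\<Prod>i<d. heat_kernel (q i) t (x i - y i))\<bar> \<le> G y"
proof -
  interpret L: product_sigma_finite "\<lambda>_ :: nat. lborel :: real measure" by standard
  obtain P :: real where P: "P > 0" "\<And>r. (1 + r\<^sup>2) ^ k \<le> P * exp \<bar>r\<bar>"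
    using one_plus_square_power_le_exp[of k] by blast
  define A where "A i = 2 * (1 + S + S\<^sup>2) * (1 + S) * exp (9 * T + 2 * R i)" for i
  define G where "G y = C * (\<Prod>i<d. P * A i * exp (- \<bar>y i\<bar>))" for y
  have "integrable (lebesgue_n d) G"
    unfolding G_def[abs_def]
    by (intro integrable_mult_right L.product_integrable_prod integrable_exp_neg_abs) auto
  moreover have "\<bar>\<phi> (ext0 d y) * (\<Prod>i<d. heat_kernel (q i) t (x i - y i))\<bar> \<le> G y"
    if t: "0 < t" "1 / t \<le> S" "t \<le> T" and x: "\<And>i. i < d \<Longrightarrow> \<bar>x i\<bar> \<le> R i" for q t x y
  proof -
    have "wt d y ^ k \<le> (\<Prod>i<d. 1 + (y i)\<^sup>2) ^ k"
      unfolding wt_def by (intro power_mono one_plus_sum_le_prod) (auto intro!: add_nonneg_nonneg sum_nonneg)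
    also have "\<dots> \<le> (\<Prod>i<d. P * exp \<bar>y i\<bar>)"
      unfolding prod_power_distrib by (intro prod_mono) (auto simp: P)
    finally have "\<bar>\<phi> (ext0 d y)\<bar> \<le> C * (\<Prod>i<d. P * exp \<bar>y i\<bar>)"
      using bound[of "ext0 d y"] C_nonneg by (auto intro: order.trans mult_left_mono)
    moreover have "\<bar>\<Prod>i<d. heat_kernel (q i) t (x i - y i)\<bar> \<le> (\<Prod>i<d. A i * exp (- 2 * \<bar>y i\<bar>))"
      unfolding abs_prod A_def by (intro prod_mono conjI heat_kernel_bound t x) auto
    ultimately have "\<bar>\<phi> (ext0 d y) * (\<Prod>i<d. heat_kernel (q i) t (x i - y i))\<bar>
      \<le> (C * (\<Prod>i<d. P * exp \<bar>y i\<bar>)) * (\<Prod>i<d. A i * exp (- 2 * \<bar>y i\<bar>))"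
      unfolding abs_mult by (intro mult_mono order.trans[OF abs_ge_zero]) auto
    also have "\<dots> = C * (\<Prod>i<d. (P * exp \<bar>y i\<bar>) * (A i * exp (- 2 * \<bar>y i\<bar>)))"
      by (simp only: prod.distrib mult.assoc)
    also have "\<dots> = C * (\<Prod>i<d. P * A i * exp (- \<bar>y i\<bar>))"
    proof -
      have "(P * exp \<bar>y i\<bar>) * (A i * exp (- 2 * \<bar>y i\<bar>)) = P * A i * exp (- \<bar>y i\<bar>)" for i
        using exp_add[of "\<bar>y i\<bar>" "- 2 * \<bar>y i\<bar>"] by simp
      then show ?thesis by (simp only:)
    qed
    finally show ?thesis unfolding G_def .
  qed
  ultimately show ?thesis by (rule that)
qed

text \<open>Convergent sequences are bounded, and 1 / t is bounded along \<open>tn\<close> because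
  its limit is positive; hence one majorant serves all members.\<close>

lemma heat_int_tendsto:
  assumes t: "\<And>n. tn n > 0" "tn \<longlonglongrightarrow> t" "t > 0" and x: "\<And>i. i < d \<Longrightarrow> (\<lambda>n. xn n i) \<longlonglongrightarrow> x i"
  shows "(\<lambda>n. heat_int q (tn n) (xn n)) \<longlonglongrightarrow> heat_int q t x"
proof -
  have "(\<lambda>n. 1 / tn n) \<longlonglongrightarrow> 1 / t" using t by (intro tendsto_intros) auto
  from convergent_imp_Bseq[OF convergentI[OF this]] obtain S where S: "\<And>n. 1 / tn n \<le> S"
    unfolding Bseq_def by (metis abs_le_D1 real_norm_def)
  from convergent_imp_Bseq[OF convergentI[OF t(2)]] obtain T where T: "\<And>n. tn n \<le> T"
    unfolding Bseq_def by (metis abs_le_D1 real_norm_def)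
  have "\<exists>R. \<forall>n. \<bar>xn n i\<bar> \<le> R" if "i < d" for i
    using convergent_imp_Bseq[OF convergentI[OF x[OF that]]] unfolding Bseq_def by auto
  then obtain R where R: "\<And>i n. i < d \<Longrightarrow> \<bar>xn n i\<bar> \<le> R i" by metis
  obtain G where G: "integrable (lebesgue_n d) G"
    "\<And>q t x y. 0 < t \<Longrightarrow> 1 / t \<le> S \<Longrightarrow> t \<le> T \<Longrightarrow> (\<And>i. i < d \<Longrightarrow> \<bar>x i\<bar> \<le> R i) \<Longrightarrow>
      \<bar>\<phi> (ext0 d y) * (\<Prod>i<d. heat_kernel (q i) t (x i - y i))\<bar> \<le> G y"
    using heat_int_dominated[where S=S and T=T and R=R] by blast
  show ?thesis
    unfolding heat_int_def
  proof (rule integral_dominated_convergence[OF _ _ G(1)])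
    show "AE y in lebesgue_n d. (\<lambda>n. \<phi> (ext0 d y) * (\<Prod>i<d. heat_kernel (q i) (tn n) (xn n i - y i)))
        \<longlonglongrightarrow> \<phi> (ext0 d y) * (\<Prod>i<d. heat_kernel (q i) t (x i - y i))"
      by (intro AE_I2 tendsto_intros heat_kernel_continuous t x) auto
    show "AE y in lebesgue_n d. norm (\<phi> (ext0 d y) * (\<Prod>i<d. heat_kernel (q i) (tn n) (xn n i - y i))) \<le> G y" for n
      unfolding real_norm_def using t(1) S T R by (intro AE_I2 G(2)) auto
  qed auto
qed

lemma heat_int_integrable:
  assumes "t > 0"
  shows "integrable (lebesgue_n d) (\<lambda>y. \<phi> (ext0 d y) * (\<Prod>i<d. heat_kernel (q i) t (x i - y i)))"
proof -
  obtain G where G: "integrable (lebesgue_n d) G"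
    "\<And>q s z y. 0 < s \<Longrightarrow> 1 / s \<le> 1 / t \<Longrightarrow> s \<le> t \<Longrightarrow> (\<And>i. i < d \<Longrightarrow> \<bar>z i\<bar> \<le> \<bar>x i\<bar>) \<Longrightarrow>
      \<bar>\<phi> (ext0 d y) * (\<Prod>i<d. heat_kernel (q i) s (z i - y i))\<bar> \<le> G y"
    using heat_int_dominated[where S="1 / t" and T=t and R="\<lambda>i. \<bar>x i\<bar>"] by blast
  show ?thesis
    by (rule Bochner_Integration.integrable_bound[OF G(1)])
      (use G(2)[of t x] assms in \<open>auto intro!: AE_I2 intro: order.trans[OF _ abs_ge_self]\<close>)
qed

lemma heat_int_space_deriv:
  assumes "t > 0" "j < d" "q j \<le> 1"
  shows "((\<lambda>s. heat_int q t (x(j := s))) has_real_derivative heat_int (q(j := Suc (q j))) t (x(j := s0))) (at s0)"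
proof -
  \<comment> \<open>The maximum with |s0| + 1 admits every value within distance 1 of
    \<open>s0\<close> in the coordinate that varies.\<close>
  obtain G where G: "integrable (lebesgue_n d) G"
    "\<And>q s z y. 0 < s \<Longrightarrow> 1 / s \<le> 1 / t \<Longrightarrow> s \<le> t \<Longrightarrow> (\<And>i. i < d \<Longrightarrow> \<bar>z i\<bar> \<le> max \<bar>x i\<bar> (\<bar>s0\<bar> + 1)) \<Longrightarrow>
      \<bar>\<phi> (ext0 d y) * (\<Prod>i<d. heat_kernel (q i) s (z i - y i))\<bar> \<le> G y"
    using heat_int_dominated[where S="1 / t" and T=t and R="\<lambda>i. max \<bar>x i\<bar> (\<bar>s0\<bar> + 1)"] by blast
  have split: "(\<Prod>i<d. heat_kernel (q' i) t ((x(j := s)) i - y i)) =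
    heat_kernel (q' j) t (s - y j) * (\<Prod>i\<in>{..<d} - {j}. heat_kernel (q' i) t (x i - y i))" for q' s y
    using assms(2) by (subst prod.remove[of _ j]) auto
  show ?thesis
    unfolding heat_int_def
  proof (rule has_real_derivative_integral[where e=1 and G=G])
    fix s y
    show "((\<lambda>s. \<phi> (ext0 d y) * (\<Prod>i<d. heat_kernel (q i) t ((x(j := s)) i - y i))) has_real_derivative
      \<phi> (ext0 d y) * (\<Prod>i<d. heat_kernel ((q(j := Suc (q j))) i) t ((x(j := s)) i - y i))) (at s)"
      unfolding split
      by (auto intro!: derivative_eq_intros DERIV_chain2[OF heat_kernel_space_deriv[OF assms(1,3)]])
    assume "\<bar>s - s0\<bar> < 1"
    then show "\<bar>\<phi> (ext0 d y) * (\<Prod>i<d. heat_kernel ((q(j := Suc (q j))) i) t ((x(j := s)) i - y i))\<bar> \<le> G y"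
      using assms(1) by (intro G(2)) auto
  qed (use assms(1) G(1) in \<open>auto intro: heat_int_integrable\<close>)
qed

text \<open>By the product rule each summand differentiates one factor in time, which turns it into
  its second space derivative; the sum is the Laplacian of the heat integral.\<close>

lemma heat_int_time_deriv:
  assumes "t > 0"
  shows "((\<lambda>t. heat_int (\<lambda>_. 0) t x) has_real_derivative (\<Sum>j<d. heat_int ((\<lambda>_. 0)(j := 2)) t x)) (at t)"
proof -
  obtain G where G: "integrable (lebesgue_n d) G"
    "\<And>q s z y. 0 < s \<Longrightarrow> 1 / s \<le> 2 / t \<Longrightarrow> s \<le> 2 * t \<Longrightarrow> (\<And>i. i < d \<Longrightarrow> \<bar>z i\<bar> \<le> \<bar>x i\<bar>) \<Longrightarrow>
      \<bar>\<phi> (ext0 d y) * (\<Prod>i<d. heat_kernel (q i) s (z i - y i))\<bar> \<le> G y"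
    using heat_int_dominated[where S="2 / t" and T="2 * t" and R="\<lambda>i. \<bar>x i\<bar>"] by blast
  have split: "(\<Prod>i<d. heat_kernel (((\<lambda>_. 0)(j := 2)) i) s (x i - y i)) =
    heat_kernel 2 s (x j - y j) * (\<Prod>i\<in>{..<d} - {j}. heat_kernel 0 s (x i - y i))" if "j < d" for j s y
    using that by (subst prod.remove[of _ j]) auto
  have "((\<lambda>t. heat_int (\<lambda>_. 0) t x) has_real_derivative
     (\<integral>y. (\<Sum>j<d. \<phi> (ext0 d y) * (\<Prod>i<d. heat_kernel (((\<lambda>_. 0)(j := 2)) i) t (x i - y i))) \<partial>lebesgue_n d)) (at t)"
    unfolding heat_int_def
  \<comment> \<open>The radius t / 2 keeps the times between t / 2 and 2 t, where \<open>G\<close>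
    was obtained. Its factor \<open>d\<close> counts the summands of the product rule.\<close>
  proof (rule has_real_derivative_integral[where e="t/2" and G="\<lambda>y. real d * G y"])
    fix s y assume "\<bar>s - t\<bar> < t / 2"
    then have s': "s > t / 2" "s < 2 * t" using assms by linarith+
    then have s: "s > 0" "1 / s \<le> 2 / t" "s \<le> 2 * t"
      using assms by (auto simp: field_simps)
    show "((\<lambda>s. \<phi> (ext0 d y) * (\<Prod>i<d. heat_kernel 0 s (x i - y i))) has_real_derivative
      (\<Sum>j<d. \<phi> (ext0 d y) * (\<Prod>i<d. heat_kernel (((\<lambda>_. 0)(j := 2)) i) s (x i - y i)))) (at s)"
      unfolding sum_distrib_left[symmetric]
      by (rule DERIV_cmult, rule DERIV_cong[OF has_field_derivative_prod[OF heat_kernel_time_deriv[OF s(1)]]])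
        (intro sum.cong refl, subst split, auto)
    have "\<bar>\<Sum>j<d. \<phi> (ext0 d y) * (\<Prod>i<d. heat_kernel (((\<lambda>_. 0)(j := 2)) i) s (x i - y i))\<bar> \<le> (\<Sum>j<d. G y)"
      using s by (intro order.trans[OF sum_abs] sum_mono G(2)) auto
    then show "\<bar>\<Sum>j<d. \<phi> (ext0 d y) * (\<Prod>i<d. heat_kernel (((\<lambda>_. 0)(j := 2)) i) s (x i - y i))\<bar> \<le> real d * G y"
      by simp
  next
    show "integrable (lebesgue_n d) (\<lambda>y. \<phi> (ext0 d y) * (\<Prod>i<d. heat_kernel 0 s (x i - y i)))"
      if "\<bar>s - t\<bar> < t / 2" for s
    proof -
      have "s > 0" using that assms by linarith
      then show ?thesis by (rule heat_int_integrable)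
    qed
  qed (use assms G(1) in auto)
  also have "(\<integral>y. (\<Sum>j<d. \<phi> (ext0 d y) * (\<Prod>i<d. heat_kernel (((\<lambda>_. 0)(j := 2)) i) t (x i - y i))) \<partial>lebesgue_n d)
    = (\<Sum>j<d. heat_int ((\<lambda>_. 0)(j := 2)) t x)"
    unfolding heat_int_def by (intro Bochner_Integration.integral_sum heat_int_integrable assms)
  finally show ?thesis .
qed

lemma heat_sol_eq_heat_int: "t > 0 \<Longrightarrow> heat_sol t x = heat_int (\<lambda>_. 0) t x"
  unfolding heat_sol_def heat_int_def
  by (subst integral_gauss_affine) (auto simp: cont heat_kernel_0)

end

section \<open>The solution up to time zero\<close>

lemma continuous_on_coordinate: "continuous_on S f \<Longrightarrow> continuous_on S (\<lambda>p. f p i :: real)"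
  using continuous_on_compose2[OF continuous_on_product_coordinates, of S f i] by auto

lemma tendsto_coordinate: "(f \<longlongrightarrow> l) F \<Longrightarrow> ((\<lambda>n. f n i :: real) \<longlongrightarrow> l i) F"
  using continuous_on_tendsto_compose[OF continuous_on_product_coordinates, of f l F i] by auto

lemma one_plus_square_power_le: "(1 + r\<^sup>2) ^ m \<le> 2 ^ m * (1 + r ^ (2 * m))" for r :: real
proof (cases "r\<^sup>2 \<le> 1")
  case True
  then have "(1 + r\<^sup>2) ^ m \<le> 2 ^ m" by (intro power_mono) auto
  also have "\<dots> \<le> 2 ^ m * (1 + r ^ (2 * m))" by (simp add: zero_le_even_power)
  finally show ?thesis .
next
  case False
  then have "(1 + r\<^sup>2) ^ m \<le> (2 * r\<^sup>2) ^ m" by (intro power_mono) auto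
  also have "\<dots> \<le> 2 ^ m * (1 + r ^ (2 * m))" by (simp add: power_mult_distrib power_mult)
  finally show ?thesis .
qed

lemma wt_power_le_powr:
  assumes "m > 0"
  shows "wt d x ^ m \<le> 2 ^ m * (1 + L2_set x {..<d} powr real (2 * m))"
  using one_plus_square_power_le[of "L2_set x {..<d}" m] powr_realpow'[of "L2_set x {..<d}" "2 * m"] assms
  by (simp add: wt_eq_L2_set del: of_nat_mult)

context heat_initial_value
begin

lemma shifted_bound:
  assumes "0 \<le> t" "t \<le> T"
  shows "\<bar>\<phi> (ext0 d (\<lambda>i. x i + sqrt (2 * t) * z i))\<bar> \<le> C * (2 * (1 + 2 * T)) ^ k * wt d x ^ k * wt d z ^ k"
proof -
  have "wt d (\<lambda>i. x i + sqrt (2 * t) * z i) \<le> 2 * (1 + 2 * T) * wt d x * wt d z"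
    using assms by (intro wt_affine) auto
  then have "wt d (\<lambda>i. x i + sqrt (2 * t) * z i) ^ k \<le> (2 * (1 + 2 * T) * wt d x * wt d z) ^ k"
    by (intro power_mono) auto
  then have "C * wt d (\<lambda>i. x i + sqrt (2 * t) * z i) ^ k \<le> C * (2 * (1 + 2 * T) * wt d x * wt d z) ^ k"
    using C_nonneg by (rule mult_left_mono)
  then show ?thesis
    using bound[OF ext0_in_Rn, of "\<lambda>i. x i + sqrt (2 * t) * z i"]
    by (simp only: wt_ext0 power_mult_distrib mult.assoc)
qed

lemmas \<phi>_shifted_measurable [measurable] = shifted_measurable[OF cont]

lemma heat_sol_bound:
  assumes "0 \<le> t" "t \<le> T"
  shows "\<bar>heat_sol t x\<bar> \<le> C * (2 * (1 + 2 * T)) ^ k * (\<integral>z. wt d z ^ k \<partial>gauss d) * wt d x ^ k"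
proof -
  have "\<bar>heat_sol t x\<bar> \<le> (\<integral>z. \<bar>\<phi> (ext0 d (\<lambda>i. x i + sqrt (2 * t) * z i))\<bar> \<partial>gauss d)"
    unfolding heat_sol_def by (rule integral_abs_bound)
  also have "\<dots> \<le> (\<integral>z. C * (2 * (1 + 2 * T)) ^ k * wt d x ^ k * wt d z ^ k \<partial>gauss d)"
  proof (rule integral_mono)
    show i: "integrable (gauss d) (\<lambda>z. C * (2 * (1 + 2 * T)) ^ k * wt d x ^ k * wt d z ^ k)"
      by (intro integrable_mult_right gauss_wt_moment)
    show "integrable (gauss d) (\<lambda>z. \<bar>\<phi> (ext0 d (\<lambda>i. x i + sqrt (2 * t) * z i))\<bar>)"
      by (rule Bochner_Integration.integrable_bound[OF i])
        (auto intro!: AE_I2 order.trans[OF shifted_bound[OF assms]])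
  qed (rule shifted_bound[OF assms])
  also have "\<dots> = C * (2 * (1 + 2 * T)) ^ k * (\<integral>z. wt d z ^ k \<partial>gauss d) * wt d x ^ k"
    by simp
  finally show ?thesis .
qed

text \<open>Uses the Gaussian form, whose integrand depends continuously on time and space down to
  time 0. Along a convergent sequence the weights of the space points are bounded by some
  \<open>W\<close>, which yields an integrable majorant.\<close>

lemma heat_sol_continuous: "continuous_on ({0..T} \<times> Rn d) (\<lambda>(t, x). heat_sol t x)"
proof (rule continuous_on_sequentiallyI)
  fix p :: "nat \<Rightarrow> real \<times> (nat \<Rightarrow> real)" and a
  assume p: "\<forall>n. p n \<in> {0..T} \<times> Rn d" and a: "a \<in> {0..T} \<times> Rn d" and lim: "p \<longlonglongrightarrow> a"
  have "(\<lambda>n. wt d (snd (p n))) \<longlonglongrightarrow> wt d (snd a)"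
    unfolding wt_def by (intro tendsto_intros tendsto_coordinate[OF tendsto_snd[OF lim]])
  from convergent_imp_Bseq[OF convergentI[OF this]] obtain W where W: "\<And>n. wt d (snd (p n)) \<le> W"
    unfolding Bseq_def by (metis abs_le_D1 real_norm_def)
  have "(\<lambda>n. \<integral>z. \<phi> (ext0 d (\<lambda>i. snd (p n) i + sqrt (2 * fst (p n)) * z i)) \<partial>gauss d)
    \<longlonglongrightarrow> (\<integral>z. \<phi> (ext0 d (\<lambda>i. snd a i + sqrt (2 * fst a) * z i)) \<partial>gauss d)"
  proof (rule integral_dominated_convergence[where w = "\<lambda>z. C * (2 * (1 + 2 * T)) ^ k * W ^ k * wt d z ^ k"])
    show "integrable (gauss d) (\<lambda>z. C * (2 * (1 + 2 * T)) ^ k * W ^ k * wt d z ^ k)"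
      by (intro integrable_mult_right gauss_wt_moment)
    show "AE z in gauss d. norm (\<phi> (ext0 d (\<lambda>i. snd (p n) i + sqrt (2 * fst (p n)) * z i)))
        \<le> C * (2 * (1 + 2 * T)) ^ k * W ^ k * wt d z ^ k" for n
    proof (rule AE_I2)
      fix z
      have t: "0 \<le> fst (p n)" "fst (p n) \<le> T" using p by (auto simp: mem_Times_iff)
      have "wt d (snd (p n)) ^ k \<le> W ^ k" using W by (intro power_mono) auto
      then have "C * (2 * (1 + 2 * T)) ^ k * wt d (snd (p n)) ^ k * wt d z ^ k
        \<le> C * (2 * (1 + 2 * T)) ^ k * W ^ k * wt d z ^ k"
        using C_nonneg t by (intro mult_right_mono mult_left_mono) auto
      then show "norm (\<phi> (ext0 d (\<lambda>i. snd (p n) i + sqrt (2 * fst (p n)) * z i)))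
        \<le> C * (2 * (1 + 2 * T)) ^ k * W ^ k * wt d z ^ k"
        using shifted_bound[OF t, of "snd (p n)" z] by simp
    qed
    show "AE z in gauss d. (\<lambda>n. \<phi> (ext0 d (\<lambda>i. snd (p n) i + sqrt (2 * fst (p n)) * z i)))
       \<longlonglongrightarrow> \<phi> (ext0 d (\<lambda>i. snd a i + sqrt (2 * fst a) * z i))"
    proof (rule AE_I2)
      fix z
      have "continuous_on UNIV (\<lambda>q. ext0 d (\<lambda>i. snd q i + sqrt (2 * fst q) * z i))"
      proof (rule continuous_on_coordinatewise_then_product)
        show "continuous_on UNIV (\<lambda>q. ext0 d (\<lambda>i. snd q i + sqrt (2 * fst q) * z i) i)" for i
          unfolding ext0_def
          by (cases "i < d") (auto intro!: continuous_intros continuous_on_coordinate[OF continuous_on_snd[OF continuous_on_id]])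
      qed
      then have "continuous_on UNIV (\<lambda>q. \<phi> (ext0 d (\<lambda>i. snd q i + sqrt (2 * fst q) * z i)))"
        by (rule continuous_on_compose2[OF cont]) auto
      from continuous_on_tendsto_compose[OF this lim]
      show "(\<lambda>n. \<phi> (ext0 d (\<lambda>i. snd (p n) i + sqrt (2 * fst (p n)) * z i)))
       \<longlonglongrightarrow> \<phi> (ext0 d (\<lambda>i. snd a i + sqrt (2 * fst a) * z i))"
        by auto
    qed
  qed auto
  then show "(\<lambda>n. case p n of (t, x) \<Rightarrow> heat_sol t x) \<longlonglongrightarrow> (case a of (t, x) \<Rightarrow> heat_sol t x)"
    by (simp add: case_prod_unfold heat_sol_def)
qed

lemma heat_int_continuous: "continuous_on ({0<..T} \<times> Rn d) (\<lambda>(t, x). heat_int q t x)"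
proof (rule continuous_on_sequentiallyI)
  fix p :: "nat \<Rightarrow> real \<times> (nat \<Rightarrow> real)" and a
  assume p: "\<forall>n. p n \<in> {0<..T} \<times> Rn d" and a: "a \<in> {0<..T} \<times> Rn d" and lim: "p \<longlonglongrightarrow> a"
  have "(\<lambda>n. heat_int q (fst (p n)) (snd (p n))) \<longlonglongrightarrow> heat_int q (fst a) (snd a)"
    using p a by (intro heat_int_tendsto tendsto_fst[OF lim] tendsto_coordinate[OF tendsto_snd[OF lim]]) (auto simp: mem_Times_iff)
  then show "(\<lambda>n. case p n of (t, x) \<Rightarrow> heat_int q t x) \<longlonglongrightarrow> (case a of (t, x) \<Rightarrow> heat_int q t x)"
    by (simp add: case_prod_unfold)
qed

lemma heat_sol_poly_growing:
  assumes "T \<ge> 0"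
  shows "poly_growing T d heat_sol"
proof -
  define A where "A = C * (2 * (1 + 2 * T)) ^ k * (\<integral>z. wt d z ^ k \<partial>gauss d)"
  have A: "A \<ge> 0"
    unfolding A_def using C_nonneg assms by (auto intro!: mult_nonneg_nonneg integral_nonneg)
  \<comment> \<open>The successor makes the growth exponent 2 m positive, as
    \<open>poly_growing\<close> demands, even for \<open>k = 0\<close>.\<close>
  define m where "m = Suc k"
  have le: "ereal (\<bar>heat_sol s y\<bar> / (1 + L2_set y {..<d} powr real (2 * m))) \<le> ereal (A * 2 ^ m)"
    if "s \<in> {0..T}" for s y
  proof -
    have pos: "1 + L2_set y {..<d} powr real (2 * m) > 0" by (intro add_pos_nonneg) auto
    have "\<bar>heat_sol s y\<bar> \<le> A * wt d y ^ k"
      using heat_sol_bound[of s T y] that by (simp add: A_def)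
    also have "\<dots> \<le> A * wt d y ^ m"
      using A wt_ge_1 unfolding m_def by (intro mult_left_mono power_increasing) auto
    also have "\<dots> \<le> A * (2 ^ m * (1 + L2_set y {..<d} powr real (2 * m)))"
      using A by (intro mult_left_mono wt_power_le_powr) (auto simp: m_def)
    finally show ?thesis
      using pos by (simp add: divide_le_eq mult.assoc)
  qed
  have "(SUP (s, y) \<in> {0..T} \<times> Rn d. ereal (\<bar>heat_sol s y\<bar> / (1 + L2_set y {..<d} powr real (2 * m)))) \<le> ereal (A * 2 ^ m)"
    using le by (intro SUP_least) auto
  also have "\<dots> < \<infinity>" by simp
  finally show ?thesis
    unfolding poly_growing_def INF_less_iff by (intro bexI[of _ "real (2 * m)"]) (auto simp: m_def)
qed

lemma heat_sol_time_deriv: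
  assumes "t > 0"
  shows "((\<lambda>s. heat_sol s x) has_real_derivative (\<Sum>j<d. heat_int ((\<lambda>_. 0)(j := 2)) t x)) (at t)"
  using heat_int_time_deriv[OF assms]
  by (rule has_field_derivative_transform_within_open[where S = "{0<..}"])
    (use assms in \<open>auto simp: heat_sol_eq_heat_int\<close>)

text \<open>The derivative within the interval is unique because \<open>t\<close> is a limit point
  from the left; thus the two-sided derivative also gives the one-sided one at
  \<open>t = T\<close>.\<close>

lemma time_deriv_heat_sol:
  assumes "0 < t" "t \<le> T"
  shows "time_deriv {0<..T} heat_sol t x = (\<Sum>j<d. heat_int ((\<lambda>_. 0)(j := 2)) t x)"
  unfolding time_deriv_def
proof (rule vector_derivative_within)
  have "t islimpt {0<..<t}" using assms(1) by (rule islimpt_greaterThanLessThan2)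
  then have "t islimpt {0<..T}" by (rule islimpt_subset) (use assms in auto)
  then show "at t within {0<..T} \<noteq> bot" by (simp add: trivial_limit_within)
  show "((\<lambda>s. heat_sol s x) has_vector_derivative (\<Sum>j<d. heat_int ((\<lambda>_. 0)(j := 2)) t x)) (at t within {0<..T})"
    using heat_sol_time_deriv[OF assms(1)] has_real_derivative_iff_has_vector_derivative
      has_vector_derivative_at_within by blast
qed

lemma partial_deriv_heat_int:
  assumes "t > 0" "j < d" "q j \<le> 1"
  shows "partially_differentiable j (heat_int q t) x"
    "partial_deriv j (heat_int q t) x = heat_int (q(j := Suc (q j))) t x"
  using heat_int_space_deriv[where q=q and x=x and ?s0.0="x j", OF assms]
  unfolding partially_differentiable_def partial_deriv_def
  by (auto simp: DERIV_imp_deriv real_differentiable_def)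

lemma heat_sol_C12: "C12 {0<..T} d heat_sol"
proof -
  have c0: "continuous_on ({0<..T} \<times> Rn d) (\<lambda>(t, x). heat_sol t x)"
    by (rule continuous_on_subset[OF heat_sol_continuous[of T]]) auto
  have "continuous_on ({0<..T} \<times> Rn d) (\<lambda>(t, x). \<Sum>j<d. heat_int ((\<lambda>_. 0)(j := 2)) t x)"
    using heat_int_continuous unfolding case_prod_unfold by (intro continuous_on_sum) auto
  then have c1: "continuous_on ({0<..T} \<times> Rn d) (\<lambda>(t, x). time_deriv {0<..T} heat_sol t x)"
    by (rule continuous_on_eq) (auto simp: time_deriv_heat_sol)
  have eq: "heat_sol t = heat_int (\<lambda>_. 0) t" if "t > 0" for t
    using that by (simp add: fun_eq_iff heat_sol_eq_heat_int)
  have p1: "partial_deriv i (heat_sol t) = heat_int ((\<lambda>_. 0)(i := 1)) t" if "t > 0" "i < d" for t i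
    using that by (simp add: fun_eq_iff partial_deriv_heat_int eq)
  \<comment> \<open>The nested update covers pure and mixed derivatives at once: the order at
    \<open>j\<close> is 2 if \<open>i = j\<close> and 1 otherwise.\<close>
  have p2: "partial_deriv j (partial_deriv i (heat_sol t)) = heat_int (((\<lambda>_. 0)(i := 1))(j := Suc (((\<lambda>_. 0)(i := 1)) j))) t"
    if "t > 0" "i < d" "j < d" for t i j
    using that unfolding p1[OF that(1,2)] by (intro ext partial_deriv_heat_int) auto
  have c2: "continuous_on ({0<..T} \<times> Rn d) (\<lambda>(t, x). partial_deriv i (heat_sol t) x)" if "i < d" for i
    by (rule continuous_on_eq[OF heat_int_continuous[of T "(\<lambda>_. 0)(i := 1)"]]) (use that in \<open>auto simp: p1\<close>)
  have c3: "continuous_on ({0<..T} \<times> Rn d) (\<lambda>(t, x). partial_deriv j (partial_deriv i (heat_sol t)) x)"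
    if "i < d" "j < d" for i j
    by (rule continuous_on_eq[OF heat_int_continuous[of T "((\<lambda>_. 0)(i := 1))(j := Suc (((\<lambda>_. 0)(i := 1)) j))"]])
      (use that p2 in auto)
  have d0: "(\<lambda>s. heat_sol s x) differentiable at t within {0<..T}" if "t > 0" for t x
    using heat_sol_time_deriv[OF that, of x]
    by (meson differentiable_at_withinI real_differentiable_def)
  have d1: "partially_differentiable i (heat_sol t) x" if "t > 0" "i < d" for t x i
    unfolding eq[OF that(1)] using that by (rule partial_deriv_heat_int(1)) simp
  have d2: "partially_differentiable j (partial_deriv i (heat_sol t)) x" if "t > 0" "i < d" "j < d" for t x i j
    unfolding p1[OF that(1,2)] using that(1,3) by (rule partial_deriv_heat_int(1)) simp
  show ?thesis
    unfolding C12_def continuous_time_space_iff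
    using c0 c1 c2 c3 d0 d1 d2 by simp
qed

lemma heat_solution_heat_sol:
  assumes "T > 0"
  shows "heat_solution T d \<phi> heat_sol"
  unfolding heat_solution_def
proof (intro conjI ballI)
  show "continuous_time_space {0..T} d heat_sol"
    unfolding continuous_time_space_iff by (rule heat_sol_continuous)
  show "poly_growing T d heat_sol" using assms by (intro heat_sol_poly_growing) auto
  show "C12 {0<..T} d heat_sol" by (rule heat_sol_C12)
  interpret prob_space "gauss d" by (rule prob_space_gauss)
  show "heat_sol 0 x = \<phi> x" if "x \<in> Rn d" for x
    using that by (simp add: heat_sol_def ext0_id prob_space)
  fix t x assume "t \<in> {0<..T}"
  then have t: "0 < t" "t \<le> T" by auto
  have eq: "heat_sol t = heat_int (\<lambda>_. 0) t"
    using t by (simp add: fun_eq_iff heat_sol_eq_heat_int)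
  have "partial_deriv i (partial_deriv i (heat_sol t)) x = heat_int ((\<lambda>_. 0)(i := 2)) t x" if "i < d" for i
  proof -
    have "partial_deriv i (heat_sol t) = heat_int ((\<lambda>_. 0)(i := 1)) t"
      unfolding eq using that t by (simp add: fun_eq_iff partial_deriv_heat_int)
    then show ?thesis
      using that t by (simp add: partial_deriv_heat_int numeral_2_eq_2)
  qed
  then show "time_deriv {0<..T} heat_sol t x = laplacian d (heat_sol t) x"
    unfolding time_deriv_heat_sol[OF t] laplacian_def by simp
qed

end

subsection \<open>Monte Carlo sampling\<close>

context prob_space
begin

text \<open>Hoeffding's lemma for the interval from -B to B, of length 2 B, where (2 B)^2 / 8 = B^2
  / 2.\<close>

lemma expectation_exp_centered_le:
  fixes h :: "'a \<Rightarrow> real"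
  assumes [measurable]: "h \<in> borel_measurable M" and bd: "\<And>z. z \<in> space M \<Longrightarrow> \<bar>h z\<bar> \<le> B"
    and "l > 0"
  shows "integrable M (\<lambda>z. exp (l * (h z - expectation h)))"
    "expectation (\<lambda>z. exp (l * (h z - expectation h))) \<le> exp (l\<^sup>2 * B\<^sup>2 / 2)"
proof -
  interpret interval_bounded_random_variable M h "-B" B
    by unfold_locales (auto intro!: AE_I2 dest: bd simp: abs_le_iff)
  show int: "integrable M (\<lambda>z. exp (l * (h z - expectation h)))"
  proof (rule integrable_const_bound)
    show "AE z in M. norm (exp (l * (h z - expectation h))) \<le> exp (l * (B - expectation h))"
      using bd \<open>l > 0\<close> by (intro AE_I2) (auto simp: abs_le_iff)
  qed measurable
  have "ennreal (expectation (\<lambda>z. exp (l * (h z - expectation h))))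
      = (\<integral>\<^sup>+z. exp (l * (h z - expectation h)) \<partial>M)"
    using int by (intro nn_integral_eq_integral[symmetric]) auto
  also have "\<dots> \<le> ennreal (exp (l\<^sup>2 * (B - (-B))\<^sup>2 / 8))"
    by (rule Hoeffdings_lemma_nn_integral[OF \<open>l > 0\<close>])
  also have "l\<^sup>2 * (B - (-B))\<^sup>2 / 8 = l\<^sup>2 * B\<^sup>2 / 2"
    by (simp add: power2_eq_square)
  finally show "expectation (\<lambda>z. exp (l * (h z - expectation h))) \<le> exp (l\<^sup>2 * B\<^sup>2 / 2)"
    by simp
qed

text \<open>The sample points are chosen one after the other so that the potential grows by no more than its
  average factor; neither independence nor a product space is needed.\<close>

lemma exists_points_exp_sum_le:
  fixes h :: "'i \<Rightarrow> 'a \<Rightarrow> real"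
  assumes "finite P" and meas: "\<And>p. p \<in> P \<Longrightarrow> h p \<in> borel_measurable M"
    and bd: "\<And>p z. p \<in> P \<Longrightarrow> z \<in> space M \<Longrightarrow> \<bar>h p z\<bar> \<le> B" and "l > 0"
  shows "\<exists>zs. (\<forall>m<n. zs m \<in> space M) \<and>
    (\<Sum>p\<in>P. exp (l * (\<Sum>m<n. h p (zs m) - expectation (h p)))) \<le> real (card P) * exp (l\<^sup>2 * B\<^sup>2 / 2) ^ n"
proof (induction n)
  case 0
  show ?case by simp
next
  case (Suc n)
  then obtain zs where zs: "\<forall>m<n. zs m \<in> space M"
    "(\<Sum>p\<in>P. exp (l * (\<Sum>m<n. h p (zs m) - expectation (h p)))) \<le> real (card P) * exp (l\<^sup>2 * B\<^sup>2 / 2) ^ n"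
    by blast
  \<comment> \<open>\<open>S p\<close> is the contribution of \<open>p\<close> to the potential of
    the points chosen so far, and \<open>F z\<close> is the potential after adding \<open>z\<close>.
    Some \<open>z\<close> does not exceed the mean of \<open>F\<close>.\<close>
  define S where "S p = exp (l * (\<Sum>m<n. h p (zs m) - expectation (h p)))" for p
  define F where "F z = (\<Sum>p\<in>P. S p * exp (l * (h p z - expectation (h p))))" for z
  note e = expectation_exp_centered_le[OF meas bd \<open>l > 0\<close>]
  have int: "integrable M F"
    unfolding F_def[abs_def] by (intro Bochner_Integration.integrable_sum integrable_mult_right e)
  have "expectation F = (\<Sum>p\<in>P. S p * expectation (\<lambda>z. exp (l * (h p z - expectation (h p)))))"
    unfolding F_def[abs_def] by (subst Bochner_Integration.integral_sum) (auto intro: e)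
  also have "\<dots> \<le> (\<Sum>p\<in>P. S p * exp (l\<^sup>2 * B\<^sup>2 / 2))"
    by (intro sum_mono mult_left_mono e) (auto simp: S_def)
  also have "\<dots> = (\<Sum>p\<in>P. S p) * exp (l\<^sup>2 * B\<^sup>2 / 2)" by (simp add: sum_distrib_right)
  also have "\<dots> \<le> (real (card P) * exp (l\<^sup>2 * B\<^sup>2 / 2) ^ n) * exp (l\<^sup>2 * B\<^sup>2 / 2)"
    using zs(2) by (intro mult_right_mono) (auto simp: S_def)
  finally have le: "expectation F \<le> real (card P) * exp (l\<^sup>2 * B\<^sup>2 / 2) ^ Suc n" by (simp add: mult_ac)
  have "\<exists>z\<in>space M. F z \<le> expectation F"
  proof (rule ccontr)
    assume "\<not> (\<exists>z\<in>space M. F z \<le> expectation F)"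
    then have "expectation F < expectation F"
      by (intro expectation_greater int AE_I2) auto
    then show False by simp
  qed
  then obtain z where z: "z \<in> space M" "F z \<le> expectation F" by blast
  have "(\<Sum>m<Suc n. h p ((zs(n := z)) m) - expectation (h p))
      = (\<Sum>m<n. h p (zs m) - expectation (h p)) + (h p z - expectation (h p))" for p
    by simp
  then have "(\<Sum>p\<in>P. exp (l * (\<Sum>m<Suc n. h p ((zs(n := z)) m) - expectation (h p)))) = F z"
    unfolding F_def S_def by (simp only: distrib_left exp_add)
  then show ?case
    using z zs(1) le by (intro exI[of _ "zs(n := z)"]) auto
qed

text \<open>Every summand of the exponential potential is at most the whole sum, so the logarithm of
  its bound controls all deviations simultaneously and the number of functions enters only through
  \<open>ln\<close>.\<close>

lemma monte_carlo:
  fixes g :: "'i \<Rightarrow> 'a \<Rightarrow> real"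
  assumes "finite K" "K \<noteq> {}" and meas: "\<And>k. k \<in> K \<Longrightarrow> g k \<in> borel_measurable M"
    and bd: "\<And>k z. k \<in> K \<Longrightarrow> z \<in> space M \<Longrightarrow> \<bar>g k z\<bar> \<le> B"
    and "B > 0" "\<epsilon> > 0" "n > 0" and n: "real n \<ge> 2 * B\<^sup>2 * ln (2 * card K) / \<epsilon>\<^sup>2"
  obtains zs where "\<And>m. m < n \<Longrightarrow> zs m \<in> space M"
    "\<And>k. k \<in> K \<Longrightarrow> \<bar>(\<Sum>m<n. g k (zs m)) / n - expectation (g k)\<bar> \<le> \<epsilon>"
proof -
  \<comment> \<open>With this \<open>l\<close>, the sample size makes both ln (2 * card K) and n l^2
    B^2 / 2 at most n \<epsilon>^2 / (2 B^2), together l n \<epsilon>.\<close>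
  define l where "l = \<epsilon> / B\<^sup>2"
  have l: "l > 0" using assms by (simp add: l_def)
  \<comment> \<open>The boolean is a sign: upper bounds for \<open>g\<close> and for its negative
    give the absolute value. This doubles the number of functions, hence the 2 under the
    logarithm.\<close>
  define h where "h = (\<lambda>(k, s) z. (if s then 1 else - 1) * g k z)"
  define P where "P = K \<times> (UNIV :: bool set)"
  have hm: "h p \<in> borel_measurable M" if "p \<in> P" for p
  proof -
    have [measurable]: "g (fst p) \<in> borel_measurable M" using that meas by (auto simp: P_def)
    show ?thesis unfolding h_def case_prod_unfold by measurable
  qed
  have hb: "\<bar>h p z\<bar> \<le> B" if "p \<in> P" "z \<in> space M" for p z
    using that bd by (auto simp: P_def h_def)
  have "finite P" using assms(1) by (simp add: P_def)
  from exists_points_exp_sum_le[where h=h and n=n, OF this hm hb l] obtain zs where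
    zs: "\<And>m. m < n \<Longrightarrow> zs m \<in> space M" and
    sum: "(\<Sum>p\<in>P. exp (l * (\<Sum>m<n. h p (zs m) - expectation (h p)))) \<le> real (card P) * exp (l\<^sup>2 * B\<^sup>2 / 2) ^ n"
    by auto
  have card: "card P = 2 * card K" "card K > 0"
    using assms(1,2) by (auto simp: P_def card_cartesian_product card_gt_0_iff)
  have up: "(\<Sum>m<n. h p (zs m) - expectation (h p)) \<le> n * \<epsilon>" if "p \<in> P" for p
  proof -
    have "exp (l * (\<Sum>m<n. h p (zs m) - expectation (h p))) \<le> (\<Sum>p\<in>P. exp (l * (\<Sum>m<n. h p (zs m) - expectation (h p))))"
      using that \<open>finite P\<close> by (intro member_le_sum) auto
    also note sum
    also have "real (card P) * exp (l\<^sup>2 * B\<^sup>2 / 2) ^ n = exp (ln (2 * card K) + n * (l\<^sup>2 * B\<^sup>2 / 2))"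
      using card unfolding exp_add exp_of_nat_mult by simp
    finally have "l * (\<Sum>m<n. h p (zs m) - expectation (h p)) \<le> ln (2 * card K) + n * (l\<^sup>2 * B\<^sup>2 / 2)"
      by simp
    also have "\<dots> \<le> n * \<epsilon>\<^sup>2 / (2 * B\<^sup>2) + n * (l\<^sup>2 * B\<^sup>2 / 2)"
      using n \<open>B > 0\<close> \<open>\<epsilon> > 0\<close> by (intro add_right_mono) (simp add: field_simps)
    also have "\<dots> = l * (n * \<epsilon>)"
      using \<open>B > 0\<close> by (simp add: l_def field_simps power2_eq_square)
    finally show ?thesis using l by simp
  qed
  have eh: "expectation (h (k, s)) = (if s then 1 else - 1) * expectation (g k)" for k s
    by (simp add: h_def)
  have "\<bar>(\<Sum>m<n. g k (zs m)) / n - expectation (g k)\<bar> \<le> \<epsilon>" if "k \<in> K" for k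
  proof -
    have "(\<Sum>m<n. g k (zs m)) - n * expectation (g k) \<le> n * \<epsilon>"
      using up[of "(k, True)"] that by (simp add: P_def eh sum_subtractf) (simp add: h_def)
    moreover have "- (\<Sum>m<n. g k (zs m)) + n * expectation (g k) \<le> n * \<epsilon>"
      using up[of "(k, False)"] that by (simp add: P_def eh sum.distrib) (simp add: h_def sum_negf)
    ultimately have "\<bar>(\<Sum>m<n. g k (zs m)) - n * expectation (g k)\<bar> \<le> n * \<epsilon>" by linarith
    moreover have "(\<Sum>m<n. g k (zs m)) / n - expectation (g k) = ((\<Sum>m<n. g k (zs m)) - n * expectation (g k)) / n"
      using \<open>n > 0\<close> by (simp add: field_simps)
    ultimately show ?thesis
      using \<open>n > 0\<close> by (simp add: abs_divide divide_le_eq mult.commute)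
  qed
  then show ?thesis using that zs by blast
qed

end

section \<open>Grids and Lipschitz bounds on cubes\<close>

definition cube :: "nat \<Rightarrow> real \<Rightarrow> real \<Rightarrow> (nat \<Rightarrow> real) set"
  where "cube d a b = {x \<in> Rn d. \<forall>i<d. x i \<in> {a..b}}"

lemma ext0_in_cube_iff: "ext0 d g \<in> cube d a b \<longleftrightarrow> (\<forall>i<d. g i \<in> {a..b})"
  unfolding cube_def by (simp, simp add: ext0_def)

lemma grid_point_exists:
  fixes a b x :: real
  assumes "a < b" "x \<in> {a..b}" "n > 0"
  obtains j where "j < n" "\<bar>x - (a + real j * ((b - a) / real n))\<bar> \<le> (b - a) / real n"
proof -
  define h where "h = (b - a) / real n"
  have h: "h > 0" "real n * h = b - a" using assms by (auto simp: h_def)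
  \<comment> \<open>Grid points are left ends of the \<open>n\<close> cells. Ceiling minus one,
    unlike the floor, stays below \<open>n\<close> at \<open>x = b\<close>; the point
    \<open>x = a\<close> is treated apart with index 0.\<close>
  define j where "j = nat \<lceil>(x - a) / h\<rceil> - 1"
  show ?thesis
  proof (cases "x = a")
    case True
    then show ?thesis using that[of 0] assms h by (auto simp flip: h_def)
  next
    case False
    then have pos: "(x - a) / h > 0" using assms h by auto
    have "(x - a) / h \<le> real n"
      using assms h by (simp add: pos_divide_le_eq mult.commute)
    then have c: "\<lceil>(x - a) / h\<rceil> \<le> int n" "\<lceil>(x - a) / h\<rceil> \<ge> 1"
      using pos by (simp add: ceiling_le_iff, linarith)
    then have nc: "int (nat \<lceil>(x - a) / h\<rceil>) = \<lceil>(x - a) / h\<rceil>" by simp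
    then have "nat \<lceil>(x - a) / h\<rceil> \<le> n" "nat \<lceil>(x - a) / h\<rceil> \<ge> 1" using c by linarith+
    moreover have "real (nat \<lceil>(x - a) / h\<rceil>) = of_int \<lceil>(x - a) / h\<rceil>"
      using nc by (metis of_int_of_nat_eq)
    ultimately have j: "j < n" "real j = of_int \<lceil>(x - a) / h\<rceil> - 1"
      unfolding j_def by (linarith, simp add: of_nat_diff)
    have "real j < (x - a) / h" "(x - a) / h \<le> real j + 1" unfolding j(2) by linarith+
    then have "real j * h < x - a" "x - a \<le> (real j + 1) * h"
      using h(1) by (simp_all add: pos_less_divide_eq pos_divide_le_eq)
    then have "\<bar>x - (a + real j * h)\<bar> \<le> h" using h(1) by (simp add: abs_le_iff algebra_simps)
    then show ?thesis using that[OF j(1)] by (simp add: h_def)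
  qed
qed

text \<open>The path from \<open>x\<close> to \<open>y\<close> changes one coordinate at a time and
  never leaves the cube, so bounds on partial derivatives suffice and the sum of coordinate
  distances appears.\<close>

lemma lipschitz_of_partial_deriv_bound:
  assumes pd: "\<And>i w. i < d \<Longrightarrow> w \<in> Rn d \<Longrightarrow> partially_differentiable i f w"
    and bd: "\<And>i w. i < d \<Longrightarrow> w \<in> cube d a b \<Longrightarrow> \<bar>partial_deriv i f (ext0 d (\<lambda>i. w i + s i))\<bar> \<le> L"
    and x: "x \<in> cube d a b" and y: "y \<in> cube d a b"
  shows "\<bar>f (ext0 d (\<lambda>i. y i + s i)) - f (ext0 d (\<lambda>i. x i + s i))\<bar> \<le> L * (\<Sum>i<d. \<bar>y i - x i\<bar>)"
proof -
  \<comment> \<open>A hybrid point: coordinates below \<open>m\<close> are already those of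
    \<open>y\<close>, the others still those of \<open>x\<close>.\<close>
  define w where "w m = ext0 d (\<lambda>i. (if i < m then y i else x i) + s i)" for m
  have step: "\<bar>f (w (Suc m)) - f (w m)\<bar> \<le> L * \<bar>y m - x m\<bar>" if m: "m < d" for m
  proof -
    define S where "S = {a + s m..b + s m}"
    have ws: "(w m)(m := r) = ext0 d (\<lambda>i. (if i = m then r - s m else if i < m then y i else x i) + s i)" for r
      using m by (auto simp: w_def ext0_def)
    have "norm (f ((w m)(m := y m + s m)) - f ((w m)(m := x m + s m))) \<le> L * norm ((y m + s m) - (x m + s m))"
    proof (rule field_differentiable_bound[where S = S and f = "\<lambda>r. f ((w m)(m := r))"
          and f' = "\<lambda>r. partial_deriv m f ((w m)(m := r))" and x = "y m + s m" and y = "x m + s m"])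
      fix r assume r: "r \<in> S"
      show "((\<lambda>r. f ((w m)(m := r))) has_field_derivative partial_deriv m f ((w m)(m := r))) (at r within S)"
        using pd[OF m] m
        by (intro has_field_derivative_at_within[OF partial_deriv_line[of d m f "w m"]]) (simp_all add: w_def)
      have "ext0 d (\<lambda>i. if i = m then r - s m else if i < m then y i else x i) \<in> cube d a b"
        using x y r by (auto simp: ext0_in_cube_iff S_def) (auto simp: cube_def)
      from bd[OF m this] show "norm (partial_deriv m f ((w m)(m := r))) \<le> L"
        unfolding ws by (simp add: ext0_def cong: if_cong)
    qed (use x y m in \<open>auto simp: S_def cube_def\<close>)
    moreover have "(w m)(m := y m + s m) = w (Suc m)" "(w m)(m := x m + s m) = w m"
      using m by (auto simp: w_def ext0_def less_Suc_eq)
    ultimately show ?thesis by simp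
  qed
  have "\<bar>f (w d) - f (w 0)\<bar> = \<bar>\<Sum>m<d. f (w (Suc m)) - f (w m)\<bar>"
    by (subst sum_lessThan_telescope) (rule refl)
  also have "\<dots> \<le> (\<Sum>m<d. L * \<bar>y m - x m\<bar>)"
    by (intro order.trans[OF sum_abs] sum_mono step) auto
  also have "\<dots> = L * (\<Sum>m<d. \<bar>y m - x m\<bar>)" by (simp add: sum_distrib_left)
  also have "w d = ext0 d (\<lambda>i. y i + s i)" by (auto simp: w_def ext0_def)
  also have "w 0 = ext0 d (\<lambda>i. x i + s i)" by (simp add: w_def)
  finally show ?thesis .
qed

lemma integrable_shifted:
  assumes "continuous_on (Rn d) f"
    and "\<And>z. \<bar>f (ext0 d (\<lambda>i. x i + \<sigma> * z i))\<bar> \<le> H * wt d z ^ k"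
  shows "integrable (gauss d) (\<lambda>z. f (ext0 d (\<lambda>i. x i + \<sigma> * z i)))"
proof (rule Bochner_Integration.integrable_bound)
  show "integrable (gauss d) (\<lambda>z. H * wt d z ^ k)"
    by (intro integrable_mult_right gauss_wt_moment)
  show "(\<lambda>z. f (ext0 d (\<lambda>i. x i + \<sigma> * z i))) \<in> borel_measurable (gauss d)"
    by (rule shifted_measurable[OF assms(1)])
  show "AE z in gauss d. norm (f (ext0 d (\<lambda>i. x i + \<sigma> * z i))) \<le> norm (H * wt d z ^ k)"
    by (intro AE_I2) (use assms(2) in \<open>auto intro: order.trans[OF _ abs_ge_self]\<close>)
qed

lemma gauss_wt_moment_ge_1: "(\<integral>z. wt d z ^ k \<partial>gauss d) \<ge> 1"
proof -
  interpret prob_space "gauss d" by (rule prob_space_gauss)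
  have "(\<integral>z. 1 \<partial>gauss d) \<le> (\<integral>z. wt d z ^ k \<partial>gauss d)"
    by (intro integral_mono gauss_wt_moment one_le_power wt_ge_1) auto
  then show ?thesis by (simp add: prob_space)
qed

text \<open>Sampling from the Gaussian measure reweighted by \<open>wt d z ^ k\<close> makes the integrands bounded although
  \<open>f\<close> grows polynomially; the union over a grid costs only its logarithm, which is linear in \<open>d\<close>.\<close>

lemma monte_carlo_on_cube:
  fixes f :: "(nat \<Rightarrow> real) \<Rightarrow> real"
  assumes "a < b" and cont: "continuous_on (Rn d) f"
    and bd: "\<And>x z. x \<in> cube d a b \<Longrightarrow> \<bar>f (ext0 d (\<lambda>i. x i + \<sigma> * z i))\<bar> \<le> H * wt d z ^ k"
    and lip: "\<And>x y z. x \<in> cube d a b \<Longrightarrow> y \<in> cube d a b \<Longrightarrow>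
      \<bar>f (ext0 d (\<lambda>i. x i + \<sigma> * z i)) - f (ext0 d (\<lambda>i. y i + \<sigma> * z i))\<bar>
        \<le> H * wt d z ^ k * (\<Sum>i<d. \<bar>x i - y i\<bar>)"
    and "H \<ge> 0" "B > 0" and B: "H * (\<integral>z. wt d z ^ k \<partial>gauss d) \<le> B"
    and "\<epsilon> > 0" "n > 0" and n: "B * (real d * ((b - a) / real n)) \<le> \<epsilon>"
    and "M > 0" and M: "real M \<ge> 2 * B\<^sup>2 * ln (2 * real n ^ d) / \<epsilon>\<^sup>2"
  obtains c z where "\<And>x. x \<in> cube d a b \<Longrightarrow>
    \<bar>(\<integral>w. f (ext0 d (\<lambda>i. x i + \<sigma> * w i)) \<partial>gauss d)
      - (\<Sum>m<M. c m * f (ext0 d (\<lambda>i. x i + \<sigma> * z m i)))\<bar> \<le> 3 * \<epsilon>"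
proof -
  define V where "V = (\<integral>z. wt d z ^ k \<partial>gauss d)"
  have V: "V > 0" using gauss_wt_moment_ge_1[of d k] by (simp add: V_def)
  define \<nu> where "\<nu> = density (gauss d) (\<lambda>z. ennreal (wt d z ^ k / V))"
  have "emeasure \<nu> (space \<nu>) = (\<integral>\<^sup>+z. ennreal (wt d z ^ k / V) \<partial>gauss d)"
    unfolding \<nu>_def by (simp add: emeasure_density cong: nn_integral_cong)
  also have "\<dots> = ennreal (\<integral>z. wt d z ^ k / V \<partial>gauss d)"
    using V by (intro nn_integral_eq_integral integrable_divide gauss_wt_moment) auto
  also have "\<dots> = 1" using V by (simp add: V_def)
  finally interpret \<nu>: prob_space \<nu> by (rule prob_spaceI)
  \<comment> \<open>Multiplying by the inverse density leaves the mean unchanged, while dividing by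
    the weight bounds \<open>g x\<close> by H V <= B.\<close>
  define g where "g x z = V * f (ext0 d (\<lambda>i. x i + \<sigma> * z i)) / wt d z ^ k" for x z
  have meas [measurable]: "g x \<in> borel_measurable \<nu>" for x
    using shifted_measurable[OF cont, of x \<sigma>] unfolding \<nu>_def g_def[abs_def] by measurable
  have gb: "\<bar>g x z\<bar> \<le> B" if "x \<in> cube d a b" for x z
  proof -
    have "\<bar>g x z\<bar> = V * \<bar>f (ext0 d (\<lambda>i. x i + \<sigma> * z i))\<bar> / wt d z ^ k"
      using V by (simp add: g_def abs_mult)
    also have "\<dots> \<le> V * (H * wt d z ^ k) / wt d z ^ k"
      using V by (intro divide_right_mono mult_left_mono bd that) auto
    also have "\<dots> = H * V" by (simp add: less_imp_neq[OF wt_pos, symmetric])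
    finally show ?thesis using B by (simp add: V_def)
  qed
  have gl: "\<bar>g x z - g y z\<bar> \<le> B * (\<Sum>i<d. \<bar>x i - y i\<bar>)" if "x \<in> cube d a b" "y \<in> cube d a b" for x y z
  proof -
    have "\<bar>g x z - g y z\<bar> = V * \<bar>f (ext0 d (\<lambda>i. x i + \<sigma> * z i)) - f (ext0 d (\<lambda>i. y i + \<sigma> * z i))\<bar> / wt d z ^ k"
      using V by (simp add: g_def abs_mult flip: right_diff_distrib diff_divide_distrib)
    also have "\<dots> \<le> V * (H * wt d z ^ k * (\<Sum>i<d. \<bar>x i - y i\<bar>)) / wt d z ^ k"
      using V by (intro divide_right_mono mult_left_mono lip that) auto
    also have "\<dots> = (H * V) * (\<Sum>i<d. \<bar>x i - y i\<bar>)" by (simp add: less_imp_neq[OF wt_pos, symmetric])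
    also have "\<dots> \<le> B * (\<Sum>i<d. \<bar>x i - y i\<bar>)"
      using B by (intro mult_right_mono sum_nonneg) (auto simp: V_def)
    finally show ?thesis .
  qed
  have gint: "integrable \<nu> (g x)" if "x \<in> cube d a b" for x
    using gb[OF that] by (intro \<nu>.integrable_const_bound[where B=B]) auto
  have ge: "\<nu>.expectation (g x) = (\<integral>w. f (ext0 d (\<lambda>i. x i + \<sigma> * w i)) \<partial>gauss d)" for x
  proof -
    have "\<nu>.expectation (g x) = (\<integral>z. (wt d z ^ k / V) *\<^sub>R g x z \<partial>gauss d)"
      unfolding \<nu>_def using meas[of x] V by (intro integral_density) (auto simp: \<nu>_def)
    also have "\<dots> = (\<integral>w. f (ext0 d (\<lambda>i. x i + \<sigma> * w i)) \<partial>gauss d)"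
      using V by (intro Bochner_Integration.integral_cong) (auto simp: g_def less_imp_neq[OF wt_pos, symmetric])
    finally show ?thesis .
  qed
  define K where "K = PiE {..<d} (\<lambda>_. {..<n})"
  define pt where "pt j = ext0 d (\<lambda>i. a + real (j i) * ((b - a) / real n))" for j
  have pt: "pt j \<in> cube d a b" if "j \<in> K" for j
  proof -
    have "a + real (j i) * ((b - a) / real n) \<in> {a..b}" if "i < d" for i
    proof -
      have "real (j i) \<le> real n" using \<open>j \<in> K\<close> that by (auto simp: K_def PiE_iff less_imp_le)
      then have "real (j i) * ((b - a) / real n) \<le> real n * ((b - a) / real n)"
        using \<open>a < b\<close> by (intro mult_right_mono) auto
      then show ?thesis using \<open>a < b\<close> \<open>n > 0\<close> by simp
    qed
    then show ?thesis unfolding pt_def ext0_in_cube_iff by blast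
  qed
  have K: "finite K" "K \<noteq> {}" "card K = n ^ d"
    using \<open>n > 0\<close> by (auto simp: K_def finite_PiE PiE_eq_empty_iff card_PiE)
  obtain zs where zs: "\<And>j. j \<in> K \<Longrightarrow> \<bar>(\<Sum>m<M. g (pt j) (zs m)) / M - \<nu>.expectation (g (pt j))\<bar> \<le> \<epsilon>"
    by (rule \<nu>.monte_carlo[where g = "\<lambda>j. g (pt j)" and K = K and n = M and B = B and \<epsilon> = \<epsilon>])
      (use K M gb pt \<open>B > 0\<close> \<open>\<epsilon> > 0\<close> \<open>M > 0\<close> in auto)
  \<comment> \<open>Three errors of size \<epsilon>: moving \<open>x\<close> to a nearby grid point
    in the mean, the sampling error there, and moving back in the sample average.\<close>
  have main: "\<bar>\<nu>.expectation (g x) - (\<Sum>m<M. g x (zs m)) / M\<bar> \<le> 3 * \<epsilon>" if x: "x \<in> cube d a b" for x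
  proof -
    have "\<exists>j<n. \<bar>x i - (a + real j * ((b - a) / real n))\<bar> \<le> (b - a) / real n" if "i < d" for i
      using grid_point_exists[of a b "x i" n] that x \<open>a < b\<close> \<open>n > 0\<close> by (auto simp: cube_def)
    then obtain j' where j': "\<And>i. i < d \<Longrightarrow> j' i < n"
      "\<And>i. i < d \<Longrightarrow> \<bar>x i - (a + real (j' i) * ((b - a) / real n))\<bar> \<le> (b - a) / real n" by metis
    define j where "j = restrict j' {..<d}"
    have j: "j \<in> K" using j' by (auto simp: j_def K_def)
    have "(\<Sum>i<d. \<bar>x i - pt j i\<bar>) \<le> (\<Sum>i<d. (b - a) / real n)"
      using j'(2) by (intro sum_mono) (auto simp: pt_def ext0_def j_def)
    then have "B * (\<Sum>i<d. \<bar>x i - pt j i\<bar>) \<le> B * (real d * ((b - a) / real n))"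
      using \<open>B > 0\<close> by (intro mult_left_mono) auto
    then have close: "\<bar>g x z - g (pt j) z\<bar> \<le> \<epsilon>" for z
      using gl[OF x pt[OF j], of z] n by linarith
    have "\<bar>\<nu>.expectation (g x) - \<nu>.expectation (g (pt j))\<bar> \<le> \<epsilon>"
    proof -
      have "\<bar>\<nu>.expectation (\<lambda>z. g x z - g (pt j) z)\<bar> \<le> \<nu>.expectation (\<lambda>z. \<bar>g x z - g (pt j) z\<bar>)"
        by (rule integral_abs_bound)
      also have "\<dots> \<le> \<nu>.expectation (\<lambda>z. \<epsilon>)"
        using close by (intro integral_mono integrable_abs Bochner_Integration.integrable_diff gint x pt j) auto
      finally show ?thesis
        by (simp add: Bochner_Integration.integral_diff gint x pt j \<nu>.prob_space)
    qed
    moreover have "\<bar>(\<Sum>m<M. g (pt j) (zs m)) / M - (\<Sum>m<M. g x (zs m)) / M\<bar> \<le> \<epsilon>"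
    proof -
      have "\<bar>\<Sum>m<M. g x (zs m) - g (pt j) (zs m)\<bar> \<le> (\<Sum>m<M. \<epsilon>)"
        by (intro order.trans[OF sum_abs] sum_mono close)
      then have "\<bar>(\<Sum>m<M. g (pt j) (zs m)) - (\<Sum>m<M. g x (zs m))\<bar> \<le> real M * \<epsilon>"
        by (simp add: sum_subtractf abs_minus_commute)
      then show ?thesis
        using \<open>M > 0\<close> by (simp add: abs_divide divide_le_eq mult.commute flip: diff_divide_distrib)
    qed
    ultimately show ?thesis using zs[OF j] by linarith
  qed
  \<comment> \<open>The weights depend on the sample points but not on \<open>x\<close>, so they can
    be stored in a network.\<close>
  have "(\<Sum>m<M. g x (zs m)) / M = (\<Sum>m<M. V / (wt d (zs m) ^ k * M) * f (ext0 d (\<lambda>i. x i + \<sigma> * zs m i)))" for x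
    by (simp add: g_def sum_divide_distrib)
  then show ?thesis
    using that[of "\<lambda>m. V / (wt d (zs m) ^ k * M)" zs] main unfolding ge by simp
qed

lemma C1_differentiable_on_UNIV_differentiable:
  fixes act :: "real \<Rightarrow> real"
  assumes "act C1_differentiable_on UNIV"
  shows "act differentiable (at r)" "continuous_on UNIV act"
proof -
  show d: "act differentiable (at r)" for r
    using assms unfolding C1_differentiable_on_eq by auto
  show "continuous_on UNIV act"
    by (intro differentiable_imp_continuous_on) (auto simp: differentiable_on_def d)
qed

text \<open>\<open>deriv\<close> denotes an actual derivative only where one exists; with this fact
  the gradient bound yields a Lipschitz estimate.\<close>

lemma realization1_partially_differentiable:
  assumes "act C1_differentiable_on UNIV" "layered p \<Phi> q"
  shows "partially_differentiable i (realization1 act \<Phi>) w"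
  unfolding partially_differentiable_def realization1_def
proof (rule realization_differentiable[OF C1_differentiable_on_UNIV_differentiable(1)[OF assms(1)] assms(2)])
  show "(\<lambda>s. (w(i := s)) j) differentiable at (w i)" for j
    by (cases "j = i") auto
qed

lemma wt_cube_le:
  assumes "x \<in> cube d a b" "d \<ge> 1"
  shows "wt d x \<le> real d * (1 + a\<^sup>2 + b\<^sup>2)"
proof -
  have "(x i)\<^sup>2 \<le> a\<^sup>2 + b\<^sup>2" if "i < d" for i
  proof -
    have "\<bar>x i\<bar> \<le> \<bar>a\<bar> \<or> \<bar>x i\<bar> \<le> \<bar>b\<bar>" using assms that by (auto simp: cube_def abs_le_iff)
    then have "(x i)\<^sup>2 \<le> a\<^sup>2 \<or> (x i)\<^sup>2 \<le> b\<^sup>2" by (simp add: abs_le_square_iff)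
    then show ?thesis using zero_le_power2[of a] zero_le_power2[of b] by linarith
  qed
  then have "(\<Sum>i<d. (x i)\<^sup>2) \<le> (\<Sum>i<d. a\<^sup>2 + b\<^sup>2)" by (intro sum_mono) auto
  then show ?thesis using assms(2) by (simp add: wt_def distrib_left) 
qed

subsection \<open>Approximating networks\<close>

text \<open>The case of one dimension and one accuracy. The single number \<open>B\<close> absorbs
  the growth constant, the size of the cube and the Gaussian moment; that it is polynomial in
  \<open>d\<close> is left to the caller.\<close>

lemma exists_approximating_network:
  fixes \<Phi> :: "real \<Rightarrow> ann" and \<phi> :: "(nat \<Rightarrow> real) \<Rightarrow> real"
  assumes "a < b" "c > 0" "T > 0" "d \<ge> 1" and act: "act C1_differentiable_on UNIV"
    and cont: "continuous_on (Rn d) \<phi>"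
    and anns: "\<And>\<delta>. \<delta> \<in> {0<..1} \<Longrightarrow> \<Phi> \<delta> \<in> anns"
    and real: "\<And>\<delta>. \<delta> \<in> {0<..1} \<Longrightarrow> realizes_C act (\<Phi> \<delta>) d 1"
    and growth: "\<And>\<delta> x. \<delta> \<in> {0<..1} \<Longrightarrow> x \<in> Rn d \<Longrightarrow>
           \<bar>realization1 act (\<Phi> \<delta>) x\<bar> + L2_set (gradient d (realization1 act (\<Phi> \<delta>)) x) {..<d}
           \<le> c * real d powr c * (1 + L2_set x {..<d} powr c)"
    and params: "\<And>\<delta>. \<delta> \<in> {0<..1} \<Longrightarrow> real (num_params (\<Phi> \<delta>)) \<le> c * real d powr c * \<delta> powr (- c)"
    and approx: "\<And>\<delta> x. \<delta> \<in> {0<..1} \<Longrightarrow> x \<in> Rn d \<Longrightarrow>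
           \<bar>\<phi> x - realization1 act (\<Phi> \<delta>) x\<bar> \<le> \<delta> * c * real d powr c * (1 + L2_set x {..<d} powr c)"
    and "real k \<ge> c" and "B \<ge> 1"
    and B: "2 * (c * real d powr c) * (2 * (1 + 2 * T) * (real d * (1 + a\<^sup>2 + b\<^sup>2))) ^ k * (\<integral>z. wt d z ^ k \<partial>gauss d) \<le> B"
    and \<epsilon>: "\<epsilon> \<in> {0<..1}"
  shows "\<exists>\<Psi> \<in> anns. realizes_C act \<Psi> d 1 \<and>
    (\<forall>x \<in> cube d a b. \<bar>heat_initial_value.heat_sol d \<phi> T x - realization1 act \<Psi> x\<bar> \<le> \<epsilon>) \<and>
    real (num_params \<Psi>) \<le> ((32 * (4 * (b - a) + 3) + 2) * B ^ 3 * (real d)\<^sup>2 / \<epsilon> ^ 3)\<^sup>2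
      * (c * real d powr c * (4 * B / \<epsilon>) powr c)"
proof -
  define A where "A = c * real d powr c"
  have A: "A \<ge> 0" using \<open>c > 0\<close> by (simp add: A_def)
  define H where "H = 2 * A * (2 * (1 + 2 * T) * (real d * (1 + a\<^sup>2 + b\<^sup>2))) ^ k"
  have H: "H \<ge> 0" unfolding H_def using A \<open>T > 0\<close> by (intro mult_nonneg_nonneg zero_le_power) auto
  have HB: "H * (\<integral>z. wt d z ^ k \<partial>gauss d) \<le> B" using B by (simp add: H_def A_def)
  \<comment> \<open>Replacing \<phi> by a realization costs at most \<delta> B in the mean, which
    becomes \<epsilon> / 4.\<close>
  define \<delta> where "\<delta> = \<epsilon> / (4 * B)"
  have \<delta>: "\<delta> \<in> {0<..1}" using \<epsilon> \<open>B \<ge> 1\<close> by (auto simp: \<delta>_def field_simps)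
  define f where "f = realization1 act (\<Phi> \<delta>)"
  note C1 = C1_differentiable_on_UNIV_differentiable[OF act]
  have dims: "in_dim (\<Phi> \<delta>) = d" "out_dim (\<Phi> \<delta>) = 1"
    and fc: "continuous_on (Rn d) (realization act (\<Phi> \<delta>))"
    using real[OF \<delta>] by (auto simp: realizes_C_def continuous_map_Euclidean_space)
  have f_cont: "continuous_on (Rn d) f"
    unfolding f_def realization1_def[abs_def] using fc by (rule continuous_on_coordinate)
  have "layered d (\<Phi> \<delta>) 1" using anns[OF \<delta>] dims by (simp add: anns_iff_layered)
  then have pd: "partially_differentiable i f w" for i w
    unfolding f_def by (rule realization1_partially_differentiable[OF act])
  have poly: "1 + L2_set x {..<d} powr c \<le> 2 * wt d x ^ k" for x
    by (rule one_plus_L2_set_powr_le) fact+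
  have bound: "\<bar>f x\<bar> \<le> 2 * A * wt d x ^ k" "i < d \<Longrightarrow> \<bar>partial_deriv i f x\<bar> \<le> 2 * A * wt d x ^ k"
    if "x \<in> Rn d" for x i
  proof -
    have le: "\<bar>f x\<bar> + L2_set (gradient d f x) {..<d} \<le> 2 * A * wt d x ^ k"
      using growth[OF \<delta> that] mult_left_mono[OF poly[of x] A] by (simp add: f_def A_def)
    then show "\<bar>f x\<bar> \<le> 2 * A * wt d x ^ k"
      using L2_set_nonneg[of "gradient d f x" "{..<d}"] by linarith
    assume "i < d"
    then have "\<bar>partial_deriv i f x\<bar> \<le> L2_set (gradient d f x) {..<d}"
      using member_le_L2_set[of "{..<d}" i "\<lambda>i. \<bar>gradient d f x i\<bar>"]
      by (simp add: gradient_def L2_set_def)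
    then show "\<bar>partial_deriv i f x\<bar> \<le> 2 * A * wt d x ^ k"
      using le by linarith
  qed
  define \<sigma> where "\<sigma> = sqrt (2 * T)"
  have \<sigma>: "\<sigma>\<^sup>2 \<le> 2 * T" using \<open>T > 0\<close> by (simp add: \<sigma>_def)
  have shift: "2 * A * wt d (ext0 d (\<lambda>i. x i + \<sigma> * z i)) ^ k \<le> H * wt d z ^ k" if "x \<in> cube d a b" for x z
  proof -
    have "wt d (\<lambda>i. x i + \<sigma> * z i) \<le> 2 * (1 + 2 * T) * wt d x * wt d z" by (rule wt_affine[OF \<sigma>])
    also have "\<dots> \<le> 2 * (1 + 2 * T) * (real d * (1 + a\<^sup>2 + b\<^sup>2)) * wt d z"
      using wt_cube_le[OF that \<open>d \<ge> 1\<close>] \<open>T > 0\<close> by (intro mult_right_mono mult_left_mono) auto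
    finally have "wt d (\<lambda>i. x i + \<sigma> * z i) ^ k \<le> (2 * (1 + 2 * T) * (real d * (1 + a\<^sup>2 + b\<^sup>2)) * wt d z) ^ k"
      by (intro power_mono) auto
    then have "2 * A * wt d (\<lambda>i. x i + \<sigma> * z i) ^ k
        \<le> 2 * A * (2 * (1 + 2 * T) * (real d * (1 + a\<^sup>2 + b\<^sup>2)) * wt d z) ^ k"
      using A by (intro mult_left_mono) auto
    also have "\<dots> = H * wt d z ^ k" unfolding H_def power_mult_distrib by (simp only: mult.assoc)
    finally show ?thesis by simp
  qed
  have fb: "\<bar>f (ext0 d (\<lambda>i. x i + \<sigma> * z i))\<bar> \<le> H * wt d z ^ k" if "x \<in> cube d a b" for x z
    using bound(1)[OF ext0_in_Rn] shift[OF that] by (rule order.trans)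
  have fl: "\<bar>f (ext0 d (\<lambda>i. x i + \<sigma> * z i)) - f (ext0 d (\<lambda>i. y i + \<sigma> * z i))\<bar>
      \<le> H * wt d z ^ k * (\<Sum>i<d. \<bar>x i - y i\<bar>)" if "x \<in> cube d a b" "y \<in> cube d a b" for x y z
    using that by (intro lipschitz_of_partial_deriv_bound[where a=a and b=b] pd
        order.trans[OF bound(2)[OF ext0_in_Rn] shift]) auto
  \<comment> \<open>The mesh is fine enough that moving to a grid point costs \<epsilon> / 4; the
    added 1 ensures a positive number.\<close>
  define n where "n = nat \<lceil>4 * B * d * (b - a) / \<epsilon>\<rceil> + 1"
  have n: "n > 0" "4 * B * d * (b - a) / \<epsilon> \<le> real n" "real n \<le> 4 * B * d * (b - a) / \<epsilon> + 2"
  proof -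
    have "4 * B * d * (b - a) / \<epsilon> \<ge> 0" using \<epsilon> \<open>B \<ge> 1\<close> \<open>a < b\<close> by auto
    then show "4 * B * d * (b - a) / \<epsilon> \<le> real n" "real n \<le> 4 * B * d * (b - a) / \<epsilon> + 2"
      unfolding n_def by linarith+
  qed (simp add: n_def)
  have grid: "B * (real d * ((b - a) / real n)) \<le> \<epsilon> / 4"
    using n(1,2) \<epsilon> by (simp add: field_simps)
  \<comment> \<open>The factor 32 is 2 * 16, from sampling accuracy \<epsilon> / 4. The logarithm of
    twice the number of grid points is replaced by the crude but polynomial d n + 1.\<close>
  define M where "M = nat \<lceil>32 * B\<^sup>2 * (real d * real n + 1) / \<epsilon>\<^sup>2\<rceil> + 1"
  have M: "M > 0" "32 * B\<^sup>2 * (real d * real n + 1) / \<epsilon>\<^sup>2 \<le> real M"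
    "real M \<le> 32 * B\<^sup>2 * (real d * real n + 1) / \<epsilon>\<^sup>2 + 2"
  proof -
    have "32 * B\<^sup>2 * (real d * real n + 1) / \<epsilon>\<^sup>2 \<ge> 0" by auto
    then show "32 * B\<^sup>2 * (real d * real n + 1) / \<epsilon>\<^sup>2 \<le> real M"
      "real M \<le> 32 * B\<^sup>2 * (real d * real n + 1) / \<epsilon>\<^sup>2 + 2"
      unfolding M_def by linarith+
  qed (simp add: M_def)
  have ln_le: "ln (2 * real n ^ d) \<le> real d * real n + 1"
  proof -
    have "ln (2 * real n ^ d) = ln 2 + real d * ln (real n)"
      using n(1) by (simp add: ln_mult ln_realpow)
    also have "\<dots> \<le> 1 + real d * real n"
      using ln_le_minus_one[of "real n"] ln_le_minus_one[of 2] n(1)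
      by (intro add_mono mult_left_mono) auto
    finally show ?thesis by simp
  qed
  have samples: "2 * B\<^sup>2 * ln (2 * real n ^ d) / (\<epsilon> / 4)\<^sup>2 \<le> real M"
  proof -
    have "2 * B\<^sup>2 * ln (2 * real n ^ d) / (\<epsilon> / 4)\<^sup>2 = 32 * B\<^sup>2 * ln (2 * real n ^ d) / \<epsilon>\<^sup>2"
      by (simp add: power_divide)
    also have "\<dots> \<le> 32 * B\<^sup>2 * (real d * real n + 1) / \<epsilon>\<^sup>2"
      using ln_le by (intro divide_right_mono mult_left_mono) auto
    finally show ?thesis using M(2) by linarith
  qed
  obtain cs zs where mc: "\<And>x. x \<in> cube d a b \<Longrightarrow>
    \<bar>(\<integral>w. f (ext0 d (\<lambda>i. x i + \<sigma> * w i)) \<partial>gauss d)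
      - (\<Sum>m<M. cs m * f (ext0 d (\<lambda>i. x i + \<sigma> * zs m i)))\<bar> \<le> 3 * (\<epsilon> / 4)"
    by (rule monte_carlo_on_cube[where f = f and a = a and b = b and H = H and k = k and B = B and d = d
          and \<sigma> = \<sigma> and \<epsilon> = "\<epsilon> / 4" and n = n and M = M])
      (use \<open>a < b\<close> f_cont fb fl H HB \<open>B \<ge> 1\<close> \<epsilon> n(1) grid M(1) samples in auto)
  define \<Psi> where "\<Psi> = average_net M cs (\<lambda>m. ext0 d (\<lambda>i. \<sigma> * zs m i)) (\<Phi> \<delta>)"
  have "M \<ge> 1" using M(1) by simp
  note net = average_net[OF anns[OF \<delta>] dims \<open>M \<ge> 1\<close>, where c = cs and z = "\<lambda>m. ext0 d (\<lambda>i. \<sigma> * zs m i)", folded \<Psi>_def]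
  have val: "realization1 act \<Psi> x = (\<Sum>m<M. cs m * f (ext0 d (\<lambda>i. x i + \<sigma> * zs m i)))" if "x \<in> Rn d" for x
  proof -
    have "(\<lambda>j. x j + ext0 d (\<lambda>i. \<sigma> * zs m i) j) = ext0 d (\<lambda>i. x i + \<sigma> * zs m i)" for m
      using that by (auto simp: ext0_def Rn_iff)
    then show ?thesis using net(5)[where i = 0 and x = x] by (simp add: realization1_def f_def)
  qed
  have err: "\<bar>heat_initial_value.heat_sol d \<phi> T x - realization1 act \<Psi> x\<bar> \<le> \<epsilon>" if x: "x \<in> cube d a b" for x
  proof -
    define p where "p z = ext0 d (\<lambda>i. x i + \<sigma> * z i)" for z
    have diff: "\<bar>\<phi> (p z) - f (p z)\<bar> \<le> \<delta> * (H * wt d z ^ k)" for z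
    proof -
      have "\<bar>\<phi> (p z) - f (p z)\<bar> \<le> \<delta> * (A * (1 + L2_set (p z) {..<d} powr c))"
        using approx[OF \<delta>, of "p z"] by (simp add: A_def f_def p_def mult.assoc)
      also have "\<dots> \<le> \<delta> * (H * wt d z ^ k)"
        using mult_left_mono[OF poly A, of "p z"] shift[OF x, of z] \<delta>
        by (intro mult_left_mono) (auto simp: p_def intro: order.trans)
      finally show ?thesis .
    qed
    have fi: "integrable (gauss d) (\<lambda>z. f (p z))"
      unfolding p_def by (rule integrable_shifted[OF f_cont fb[OF x]])
    have pi: "integrable (gauss d) (\<lambda>z. \<phi> (p z))"
      unfolding p_def
    proof (rule integrable_shifted[OF cont])
      fix z
      have "\<bar>\<phi> (p z)\<bar> \<le> H * wt d z ^ k + \<delta> * (H * wt d z ^ k)"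
        using fb[OF x, of z] diff[of z] unfolding p_def by linarith
      then show "\<bar>\<phi> (ext0 d (\<lambda>i. x i + \<sigma> * z i))\<bar> \<le> (H + \<delta> * H) * wt d z ^ k"
        by (simp add: p_def algebra_simps)
    qed
    have "\<bar>(\<integral>z. \<phi> (p z) \<partial>gauss d) - (\<integral>z. f (p z) \<partial>gauss d)\<bar> = \<bar>\<integral>z. \<phi> (p z) - f (p z) \<partial>gauss d\<bar>"
      by (simp add: Bochner_Integration.integral_diff fi pi)
    also have "\<dots> \<le> (\<integral>z. \<bar>\<phi> (p z) - f (p z)\<bar> \<partial>gauss d)" by (rule integral_abs_bound)
    also have "\<dots> \<le> (\<integral>z. \<delta> * (H * wt d z ^ k) \<partial>gauss d)"
      by (intro integral_mono integrable_abs Bochner_Integration.integrable_diff fi pi diff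
          integrable_mult_right gauss_wt_moment)
    also have "\<dots> = \<delta> * (H * (\<integral>z. wt d z ^ k \<partial>gauss d))" by simp
    also have "\<dots> \<le> \<delta> * B" using HB \<delta> by (intro mult_left_mono) auto
    also have "\<dots> = \<epsilon> / 4" using \<open>B \<ge> 1\<close> by (simp add: \<delta>_def)
    finally have "\<bar>(\<integral>z. \<phi> (p z) \<partial>gauss d) - (\<integral>z. f (p z) \<partial>gauss d)\<bar> \<le> \<epsilon> / 4" .
    moreover have "x \<in> Rn d" using x by (simp add: cube_def)
    \<comment> \<open>The defining equation of \<open>heat_sol\<close> is available only under the
      locale assumptions. One half of the constant bounds \<open>f\<close>, the other the distance
      of \<phi> from \<open>f\<close>, using \<delta> <= 1.\<close>
    moreover have "heat_initial_value d \<phi> (2 * A + 2 * A) k"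
    proof
      fix y assume y: "y \<in> Rn d"
      have "\<bar>\<phi> y - f y\<bar> \<le> \<delta> * (A * (1 + L2_set y {..<d} powr c))"
        using approx[OF \<delta> y] by (simp add: A_def f_def mult.assoc)
      also have "\<dots> \<le> 1 * (A * (1 + L2_set y {..<d} powr c))"
        using \<delta> A by (intro mult_right_mono) auto
      also have "\<dots> \<le> 2 * A * wt d y ^ k" using mult_left_mono[OF poly A, of y] by simp
      finally show "\<bar>\<phi> y\<bar> \<le> (2 * A + 2 * A) * wt d y ^ k"
        using bound(1)[OF y] unfolding distrib_right by linarith
    qed (rule cont)
    then have "heat_initial_value.heat_sol d \<phi> T x = (\<integral>z. \<phi> (p z) \<partial>gauss d)"
      by (simp add: heat_initial_value.heat_sol_def p_def \<sigma>_def)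
    ultimately show ?thesis
      using mc[OF x] val[of x] unfolding p_def by linarith
  qed
  \<comment> \<open>As \<open>B\<close>, \<open>d\<close> and 1 / \<epsilon> are at least 1, lower
    order terms are absorbed into the leading monomial: n contributes 4 (b - a) + 2, the summand 1
    makes it + 3, and rounding \<open>M\<close> adds the final 2.\<close>
  have M_le: "real M \<le> (32 * (4 * (b - a) + 3) + 2) * B ^ 3 * (real d)\<^sup>2 / \<epsilon> ^ 3"
  proof -
    define E where "E = 1 / \<epsilon>"
    define D where "D = real d"
    have E: "E \<ge> 1" using \<epsilon> by (simp add: E_def)
    have D: "D \<ge> 1" using \<open>d \<ge> 1\<close> by (simp add: D_def)
    have BDE: "B * D * E \<ge> 1" "B * D * D * E \<ge> 1"
      using E D \<open>B \<ge> 1\<close> by (auto intro!: mult_ge1_I)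
    have "real n \<le> 4 * (b - a) * (B * D * E) + 2 * (B * D * E)"
    proof -
      have "4 * B * d * (b - a) / \<epsilon> = 4 * (b - a) * (B * D * E)"
        by (simp add: E_def D_def)
      then show ?thesis using n(3) BDE(1) by linarith
    qed
    then have "D * real n \<le> D * ((4 * (b - a) + 2) * (B * D * E))"
      using D by (intro mult_left_mono) (auto simp: distrib_right)
    then have dn: "D * real n + 1 \<le> (4 * (b - a) + 3) * (B * D * D * E)"
      using BDE by (simp add: algebra_simps)
    have "32 * B\<^sup>2 * E\<^sup>2 * (D * real n + 1) \<le> 32 * B\<^sup>2 * E\<^sup>2 * ((4 * (b - a) + 3) * (B * D * D * E))"
      by (intro mult_left_mono dn) auto
    also have "\<dots> = 32 * (4 * (b - a) + 3) * (B ^ 3 * D\<^sup>2 * E ^ 3)"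
      by (simp add: power2_eq_square power3_eq_cube)
    finally have "32 * B\<^sup>2 * E\<^sup>2 * (D * real n + 1) \<le> 32 * (4 * (b - a) + 3) * (B ^ 3 * D\<^sup>2 * E ^ 3)" .
    moreover have "real M \<le> 32 * B\<^sup>2 * E\<^sup>2 * (D * real n + 1) + 2"
      using M(3) by (simp add: E_def D_def power_divide)
    moreover have "B ^ 3 * D\<^sup>2 * E ^ 3 \<ge> 1"
      using E D \<open>B \<ge> 1\<close> by (auto intro!: mult_ge1_I)
    ultimately have "real M \<le> 32 * (4 * (b - a) + 3) * (B ^ 3 * D\<^sup>2 * E ^ 3) + 2 * (B ^ 3 * D\<^sup>2 * E ^ 3)"
      by linarith
    also have "\<dots> = (32 * (4 * (b - a) + 3) + 2) * (B ^ 3 * D\<^sup>2 * E ^ 3)"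
      by (simp only: distrib_right)
    also have "\<dots> = (32 * (4 * (b - a) + 3) + 2) * B ^ 3 * (real d)\<^sup>2 / \<epsilon> ^ 3"
      by (simp add: D_def E_def power_one_over)
    finally show ?thesis .
  qed
  have "real (num_params \<Psi>) \<le> real (M\<^sup>2 * num_params (\<Phi> \<delta>))"
    using net(4) by (simp only: of_nat_le_iff)
  also have "\<dots> = (real M)\<^sup>2 * real (num_params (\<Phi> \<delta>))" by simp
  also have "\<dots> \<le> ((32 * (4 * (b - a) + 3) + 2) * B ^ 3 * (real d)\<^sup>2 / \<epsilon> ^ 3)\<^sup>2
      * (c * real d powr c * (4 * B / \<epsilon>) powr c)"
  proof (intro mult_mono power_mono M_le)
    have "\<delta> powr (- c) = (4 * B / \<epsilon>) powr c"
      using \<epsilon> \<open>B \<ge> 1\<close> by (simp add: \<delta>_def powr_minus powr_divide inverse_eq_divide)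
    then show "real (num_params (\<Phi> \<delta>)) \<le> c * real d powr c * (4 * B / \<epsilon>) powr c"
      using params[OF \<delta>] by simp
  qed auto
  finally have size: "real (num_params \<Psi>) \<le> ((32 * (4 * (b - a) + 3) + 2) * B ^ 3 * (real d)\<^sup>2 / \<epsilon> ^ 3)\<^sup>2
      * (c * real d powr c * (4 * B / \<epsilon>) powr c)" .
  have "realizes_C act \<Psi> d 1" by (rule realizes_C_if_layered[OF C1(2) net(2,3)])
  then show ?thesis using net(1) err size by blast
qed

theorem theorem1p1:
  fixes a b c T :: real
    and act :: "real \<Rightarrow> real"
    and \<phi> :: "nat \<Rightarrow> (nat \<Rightarrow> real) \<Rightarrow> real"
    and \<Phi> :: "real \<Rightarrow> nat \<Rightarrow> ann"
  assumes "a < b" and "c > 0" and "T > 0"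
    and "act C1_differentiable_on UNIV"
    and "\<And>d. d \<ge> 1 \<Longrightarrow> continuous_map (Euclidean_space d) euclideanreal (\<phi> d)"
    and "\<And>\<epsilon> d. \<epsilon> \<in> {0<..1} \<Longrightarrow> d \<ge> 1 \<Longrightarrow> \<Phi> \<epsilon> d \<in> anns"
    and "\<And>\<epsilon> d. \<epsilon> \<in> {0<..1} \<Longrightarrow> d \<ge> 1 \<Longrightarrow> realizes_C act (\<Phi> \<epsilon> d) d 1"
    and "\<And>\<epsilon> d x. \<epsilon> \<in> {0<..1} \<Longrightarrow> d \<ge> 1 \<Longrightarrow> x \<in> Rn d \<Longrightarrow>
           \<bar>realization1 act (\<Phi> \<epsilon> d) x\<bar>
             + L2_set (gradient d (realization1 act (\<Phi> \<epsilon> d)) x) {..<d}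
           \<le> c * real d powr c * (1 + L2_set x {..<d} powr c)"
    and "\<And>\<epsilon> d. \<epsilon> \<in> {0<..1} \<Longrightarrow> d \<ge> 1 \<Longrightarrow>
           real (num_params (\<Phi> \<epsilon> d)) \<le> c * real d powr c * \<epsilon> powr (- c)"
    and "\<And>\<epsilon> d x. \<epsilon> \<in> {0<..1} \<Longrightarrow> d \<ge> 1 \<Longrightarrow> x \<in> Rn d \<Longrightarrow>
           \<bar>\<phi> d x - realization1 act (\<Phi> \<epsilon> d) x\<bar>
           \<le> \<epsilon> * c * real d powr c * (1 + L2_set x {..<d} powr c)"
  shows "\<exists>u :: nat \<Rightarrow> real \<Rightarrow> (nat \<Rightarrow> real) \<Rightarrow> real.
    (\<forall>d \<ge> 1. heat_solution T d (\<phi> d) (u d)) \<and>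
    (\<forall>d \<ge> 1. \<forall>v. heat_solution T d (\<phi> d) v \<longrightarrow>
       (\<forall>t \<in> {0..T}. \<forall>x \<in> Rn d. v t x = u d t x)) \<and>
    (\<exists>(\<Psi> :: real \<Rightarrow> nat \<Rightarrow> ann) (\<kappa> :: real). \<forall>\<epsilon> \<in> {0<..1}. \<forall>d \<ge> 1.
       \<Psi> \<epsilon> d \<in> anns \<and>
       real (num_params (\<Psi> \<epsilon> d)) \<le> \<kappa> * real d powr \<kappa> * \<epsilon> powr (- \<kappa>) \<and>
       realizes_C act (\<Psi> \<epsilon> d) d 1 \<and>
       (SUP x \<in> {x \<in> Rn d. \<forall>i < d. x i \<in> {a..b}}.
          ereal \<bar>u d T x - realization1 act (\<Psi> \<epsilon> d) x\<bar>) \<le> ereal \<epsilon>)"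
proof -
  define k where "k = nat \<lceil>c\<rceil>"
  have k: "real k \<ge> c" unfolding k_def by linarith
  have cont: "continuous_on (Rn d) (\<phi> d)" if "d \<ge> 1" for d
    using assms(5)[OF that] by (simp add: continuous_map_Euclidean_space_real)
  define u where "u d = heat_initial_value.heat_sol d (\<phi> d)" for d
  have sol: "heat_solution T d (\<phi> d) (u d)" if d: "d \<ge> 1" for d
  proof -
    \<comment> \<open>The network of accuracy 1 bounds \<phi>: growth and error each give A (1 +
      |x|^c), and \<open>one_plus_L2_set_powr_le\<close> doubles this to 4 A.\<close>
    define A where "A = c * real d powr c"
    have "heat_initial_value d (\<phi> d) (4 * A) k"
    proof
      fix x assume x: "x \<in> Rn d"
      have "\<bar>realization1 act (\<Phi> 1 d) x\<bar> + L2_set (gradient d (realization1 act (\<Phi> 1 d)) x) {..<d}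
          \<le> A * (1 + L2_set x {..<d} powr c)"
        unfolding A_def using x d by (intro assms(8)) auto
      then have "\<bar>realization1 act (\<Phi> 1 d) x\<bar> \<le> A * (1 + L2_set x {..<d} powr c)"
        using L2_set_nonneg[of "gradient d (realization1 act (\<Phi> 1 d)) x" "{..<d}"] by linarith
      moreover have "\<bar>\<phi> d x - realization1 act (\<Phi> 1 d) x\<bar> \<le> A * (1 + L2_set x {..<d} powr c)"
        using assms(10)[of 1 d x] x d by (simp add: A_def)
      moreover have "A * (1 + L2_set x {..<d} powr c) \<le> A * (2 * wt d x ^ k)"
        using one_plus_L2_set_powr_le[OF \<open>c > 0\<close> k] \<open>c > 0\<close> by (intro mult_left_mono) (auto simp: A_def)
      ultimately show "\<bar>\<phi> d x\<bar> \<le> 4 * A * wt d x ^ k" by linarith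
    qed (rule cont[OF d])
    then show ?thesis
      unfolding u_def using \<open>T > 0\<close> by (rule heat_initial_value.heat_solution_heat_sol)
  qed
  define \<mu> where "\<mu> = (\<integral>r. std_normal_density r * r ^ (2 * k) \<partial>lborel)"
  have \<mu>: "\<mu> \<ge> 0"
    unfolding \<mu>_def by (intro Bochner_Integration.integral_nonneg) (auto simp: zero_le_even_power)
  \<comment> \<open>The factors of \<open>B\<close> that do not depend on the dimension; the maximum
    with 1 ensures \<open>B \<ge> 1\<close>.\<close>
  define \<beta> where "\<beta> = max 1 (2 * c * (2 * (1 + 2 * T) * (1 + a\<^sup>2 + b\<^sup>2)) ^ k * (2 ^ k * (1 + \<mu>)))"
  have \<beta>: "\<beta> \<ge> 1" by (simp add: \<beta>_def)
  \<comment> \<open>Powers of \<open>d\<close>: \<open>k\<close> from the growth constant,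
    \<open>k\<close> from the weight on the cube, and \<open>k + 1\<close> from the Gaussian
    moment.\<close>
  define q where "q = k + k + (k + 1)"
  have B: "2 * (c * real d powr c) * (2 * (1 + 2 * T) * (real d * (1 + a\<^sup>2 + b\<^sup>2))) ^ k * (\<integral>z. wt d z ^ k \<partial>gauss d)
    \<le> \<beta> * real d ^ q" if d: "d \<ge> 1" for d
  proof -
    have "real d powr c \<le> real d powr real k" using d k by (intro powr_mono) auto
    also have "\<dots> = real d ^ k" using d by (simp add: powr_realpow)
    finally have 1: "real d powr c \<le> real d ^ k" .
    have "(\<integral>z. wt d z ^ k \<partial>gauss d) \<le> (real d + 1) ^ k * (1 + real d * \<mu>)"
      unfolding \<mu>_def by (rule gauss_wt_moment)
    also have "\<dots> \<le> (2 * real d) ^ k * (real d * (1 + \<mu>))"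
      using d \<mu> by (intro mult_mono power_mono) (auto simp: distrib_left)
    also have "\<dots> = 2 ^ k * (1 + \<mu>) * real d ^ (k + 1)" by (simp add: power_mult_distrib)
    finally have 2: "(\<integral>z. wt d z ^ k \<partial>gauss d) \<le> 2 ^ k * (1 + \<mu>) * real d ^ (k + 1)" .
    have "2 * (c * real d powr c) * (2 * (1 + 2 * T) * (real d * (1 + a\<^sup>2 + b\<^sup>2))) ^ k * (\<integral>z. wt d z ^ k \<partial>gauss d)
      \<le> 2 * (c * real d ^ k) * (2 * (1 + 2 * T) * (real d * (1 + a\<^sup>2 + b\<^sup>2))) ^ k * (2 ^ k * (1 + \<mu>) * real d ^ (k + 1))"
      using 1 2 \<open>c > 0\<close> \<open>T > 0\<close> by (intro mult_mono) auto
    also have "\<dots> = (2 * c * (2 * (1 + 2 * T) * (1 + a\<^sup>2 + b\<^sup>2)) ^ k * (2 ^ k * (1 + \<mu>))) * real d ^ q"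
      unfolding q_def power_add power_mult_distrib by (simp only: mult_ac)
    also have "\<dots> \<le> \<beta> * real d ^ q"
      unfolding \<beta>_def by (intro mult_right_mono max.cobounded2) auto
    finally show ?thesis .
  qed
  define K0 where "K0 = 32 * (4 * (b - a) + 3) + 2"
  \<comment> \<open>Squaring the sample size gives B^6, d^4 and \<epsilon>^(-6); the given network
    adds \<open>k\<close> to each of these exponents, and inserting B = \<beta> d^q yields
    \<open>K\<close> and \<open>e\<close>.\<close>
  define K where "K = K0\<^sup>2 * c * 4 ^ k * \<beta> ^ (6 + k)"
  define e where "e = q * (6 + k) + 4 + k"
  \<comment> \<open>One number has to serve as factor, as exponent of \<open>d\<close> and as
    exponent of 1 / \<epsilon>; enlarging exponents is harmless since both bases are at least
    1.\<close>
  define \<kappa> where "\<kappa> = max K (max (real e) (real (6 + k)))"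
  have size: "(K0 * (\<beta> * real d ^ q) ^ 3 * (real d)\<^sup>2 / \<epsilon> ^ 3)\<^sup>2 * (c * real d powr c * (4 * (\<beta> * real d ^ q) / \<epsilon>) powr c)
      \<le> \<kappa> * real d powr \<kappa> * \<epsilon> powr (- \<kappa>)" if d: "d \<ge> 1" and \<epsilon>: "\<epsilon> \<in> {0<..1}" for d \<epsilon>
  proof -
    define B where "B = \<beta> * real d ^ q"
    have "B \<ge> 1" using \<beta> d by (simp add: B_def mult_ge1_I one_le_power)
    have "4 * B / \<epsilon> \<ge> 1" using \<epsilon> \<open>B \<ge> 1\<close> by (auto simp: field_simps)
    then have "(4 * B / \<epsilon>) powr c \<le> (4 * B / \<epsilon>) powr real k" using k by (intro powr_mono) auto
    also have "\<dots> = (4 * B / \<epsilon>) ^ k" using \<open>4 * B / \<epsilon> \<ge> 1\<close> by (intro powr_realpow) linarith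
    finally have 1: "(4 * B / \<epsilon>) powr c \<le> (4 * B / \<epsilon>) ^ k" .
    have "real d powr c \<le> real d powr real k" using d k by (intro powr_mono) auto
    also have "\<dots> = real d ^ k" using d by (simp add: powr_realpow)
    finally have 2: "real d powr c \<le> real d ^ k" .
    have "(K0 * B ^ 3 * (real d)\<^sup>2 / \<epsilon> ^ 3)\<^sup>2 * (c * real d powr c * (4 * B / \<epsilon>) powr c)
      \<le> (K0 * B ^ 3 * (real d)\<^sup>2 / \<epsilon> ^ 3)\<^sup>2 * (c * real d ^ k * (4 * B / \<epsilon>) ^ k)"
      using 1 2 \<open>c > 0\<close> \<epsilon> \<open>B \<ge> 1\<close> by (intro mult_left_mono mult_mono) auto
    also have "\<dots> = K0\<^sup>2 * c * 4 ^ k * B ^ (6 + k) * real d ^ (4 + k) * (1 / \<epsilon>) ^ (6 + k)"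
      by (simp add: power_mult_distrib power_divide power_add flip: power_mult)
    also have "\<dots> = K * real d ^ e * (1 / \<epsilon>) ^ (6 + k)"
      unfolding B_def K_def e_def power_mult_distrib power_add power_mult by (simp only: mult_ac)
    also have "\<dots> \<le> \<kappa> * real d powr \<kappa> * \<epsilon> powr (- \<kappa>)"
    proof (intro mult_mono)
      have "real d ^ e = real d powr real e" using d by (simp add: powr_realpow)
      also have "\<dots> \<le> real d powr \<kappa>" using d by (intro powr_mono) (auto simp: \<kappa>_def)
      finally show "real d ^ e \<le> real d powr \<kappa>" .
      have "(1 / \<epsilon>) ^ (6 + k) = (1 / \<epsilon>) powr real (6 + k)" using \<epsilon> by (intro powr_realpow[symmetric]) auto
      also have "\<dots> \<le> (1 / \<epsilon>) powr \<kappa>" using \<epsilon> by (intro powr_mono) (auto simp: \<kappa>_def)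
      also have "\<dots> = \<epsilon> powr (- \<kappa>)" using \<epsilon> by (simp add: powr_minus powr_divide inverse_eq_divide)
      finally show "(1 / \<epsilon>) ^ (6 + k) \<le> \<epsilon> powr (- \<kappa>)" .
    qed (use \<epsilon> in \<open>auto simp: \<kappa>_def\<close>)
    finally show ?thesis unfolding B_def .
  qed
  define P where "P \<epsilon> d \<Psi> \<longleftrightarrow> \<Psi> \<in> anns \<and>
       real (num_params \<Psi>) \<le> \<kappa> * real d powr \<kappa> * \<epsilon> powr (- \<kappa>) \<and>
       realizes_C act \<Psi> d 1 \<and>
       (SUP x \<in> {x \<in> Rn d. \<forall>i < d. x i \<in> {a..b}}. ereal \<bar>u d T x - realization1 act \<Psi> x\<bar>) \<le> ereal \<epsilon>"
    for \<epsilon> d \<Psi>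
  have ex: "\<exists>\<Psi>. P \<epsilon> d \<Psi>"
    if \<epsilon>: "\<epsilon> \<in> {0<..1}" and d: "d \<ge> 1" for \<epsilon> d
  proof -
    have "\<beta> * real d ^ q \<ge> 1" using \<beta> d by (simp add: mult_ge1_I one_le_power)
    then obtain \<Psi> where \<Psi>: "\<Psi> \<in> anns" "realizes_C act \<Psi> d 1"
      "\<And>x. x \<in> cube d a b \<Longrightarrow> \<bar>u d T x - realization1 act \<Psi> x\<bar> \<le> \<epsilon>"
      "real (num_params \<Psi>) \<le> (K0 * (\<beta> * real d ^ q) ^ 3 * (real d)\<^sup>2 / \<epsilon> ^ 3)\<^sup>2
         * (c * real d powr c * (4 * (\<beta> * real d ^ q) / \<epsilon>) powr c)"
      using exists_approximating_network[OF assms(1,2,3) d assms(4) cont[OF d], of "\<lambda>\<delta>. \<Phi> \<delta> d",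
          OF assms(6)[OF _ d] assms(7)[OF _ d] assms(8)[OF _ d] assms(9)[OF _ d] assms(10)[OF _ d] k _ B[OF d] \<epsilon>]
      unfolding u_def K0_def by blast
    have "(SUP x \<in> {x \<in> Rn d. \<forall>i < d. x i \<in> {a..b}}. ereal \<bar>u d T x - realization1 act \<Psi> x\<bar>) \<le> ereal \<epsilon>"
      using \<Psi>(3) by (intro SUP_least) (simp add: cube_def)
    then show ?thesis
      unfolding P_def using \<Psi>(1,2) order.trans[OF \<Psi>(4) size[OF d \<epsilon>]] by blast
  qed
  \<comment> \<open>\<kappa> is fixed independently of \<epsilon> and \<open>d\<close>, so the
    networks may be chosen separately for each pair.\<close>
  have nets: "P \<epsilon> d (SOME \<Psi>. P \<epsilon> d \<Psi>)" if "\<epsilon> \<in> {0<..1}" "d \<ge> 1" for \<epsilon> d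
    using ex[OF that] by (rule someI_ex[where P = "P \<epsilon> d"])
  show ?thesis
  proof (intro exI[of _ u] conjI)
    show "\<forall>d \<ge> 1. heat_solution T d (\<phi> d) (u d)" using sol by blast
    show "\<forall>d \<ge> 1. \<forall>v. heat_solution T d (\<phi> d) v \<longrightarrow> (\<forall>t \<in> {0..T}. \<forall>x \<in> Rn d. v t x = u d t x)"
      using heat_solution_unique[OF sol] by blast
    show "\<exists>\<Psi> \<kappa>. \<forall>\<epsilon> \<in> {0<..1}. \<forall>d \<ge> 1.
       \<Psi> \<epsilon> d \<in> anns \<and>
       real (num_params (\<Psi> \<epsilon> d)) \<le> \<kappa> * real d powr \<kappa> * \<epsilon> powr (- \<kappa>) \<and>
       realizes_C act (\<Psi> \<epsilon> d) d 1 \<and>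
       (SUP x \<in> {x \<in> Rn d. \<forall>i < d. x i \<in> {a..b}}.
          ereal \<bar>u d T x - realization1 act (\<Psi> \<epsilon> d) x\<bar>) \<le> ereal \<epsilon>"
    proof (rule exI[of _ "\<lambda>\<epsilon> d. SOME \<Psi>. P \<epsilon> d \<Psi>"], rule exI[of _ \<kappa>], intro ballI allI impI)
      fix \<epsilon> d assume "\<epsilon> \<in> {0<..1 :: real}" "1 \<le> (d :: nat)"
      then show "(SOME \<Psi>. P \<epsilon> d \<Psi>) \<in> anns \<and>
         real (num_params (SOME \<Psi>. P \<epsilon> d \<Psi>)) \<le> \<kappa> * real d powr \<kappa> * \<epsilon> powr (- \<kappa>) \<and>
         realizes_C act (SOME \<Psi>. P \<epsilon> d \<Psi>) d 1 \<and>
         (SUP x \<in> {x \<in> Rn d. \<forall>i < d. x i \<in> {a..b}}.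
            ereal \<bar>u d T x - realization1 act (SOME \<Psi>. P \<epsilon> d \<Psi>) x\<bar>) \<le> ereal \<epsilon>"
        by (rule iffD1[OF P_def nets])
    qed
  qed
qed

end
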